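(* Let $k$ be a positive integer and let $\alpha$ be a concave modulus. Then there is a positive number $C=C(k,\alpha)$, depending only on $k$ and $\alpha$, such that the following holds. Let $A$ be a positive integer, and set $D=[-2,2]$ and $E=[-2A,2A]$ if $k\ge2$, and $D=[-2A,2A]$ and $E=[-2,2]$ if $k=1$. Then there exist a positive number $\delta=\delta(k,A,\alpha)$ and a $C^k$-continuous map $$\Psi : V_E^{k,\alpha}(\delta)\to\mathrm{Diff}_D^{k,\alpha}(\mathbb{R})$$ such that for every $g\in V_E^{k,\alpha}(\delta)$: (1) $\|\Psi (g)\|_{k,\alpha}\le C\,\frac{|E|}{|D|}\, \|g\|_{k,\alpha}$; (2) $[\Psi(g)]=[g]$ in $H_1(\mathrm{Diff}_c^{k,\alpha}(\mathbb{R}))$.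
   Context: A concave modulus is a homeomorphism $\alpha:[0,\infty)\to[0,\infty)$ that is concave as a function. For $f:\mathbb{R}\to\mathbb{R}$, $[f]_\alpha=\sup_{x\ne y}|f(x)-f(y)|/\alpha(|x-y|)$; for a $C^k$ map $f$, $\|f\|_i=\sup_{x}|f^{(i)}(x)|$ and $\|f\|_{k,\alpha}=[f^{(k)}]_\alpha$. A $C^k$ map is $C^{k,\alpha}$ if each point has a neighborhood $U$ with $[f^{(k)}|_U]_\alpha<\infty$. $\mathrm{Diff}_c^{k,\alpha}(\mathbb{R})$ is the group of compactly supported orientation preserving $C^{k,\alpha}$ diffeomorphisms of $\mathbb{R}$; for a compact interval $J$, $\mathrm{Diff}_J^{k,\alpha}(\mathbb{R})$ is the subgroup of those with support (closure of $\{x:g(x)\ne x\}$) contained in $J$, and $V_J^{k,\alpha}(\delta)=\{ f\in \mathrm{Diff}_J^{k,\alpha}(\mathbb{R}): \|f-\mathrm{Id}\|_{k,\alpha}<\delta\}$. $|J|$ is the length of $J$. "$C^k$-continuous" means continuous with respect to the metric $d_k(f,g)=\sup_{0\le i\le k}\|f-g\|_i$ on both source and target. For a group $G$, $H_1(G)=G/[G,G]$ and $[g]$ denotes the class of $g$. *)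

theory Defs
  imports "HOL-Analysis.Analysis" "HOL-Algebra.Generated_Groups"
begin

text \<open>Values of a modulus outside \<open>[0,\<infinity>)\<close> are never used below.\<close>

definition concave_modulus :: "(real \<Rightarrow> real) \<Rightarrow> bool" where
  "concave_modulus \<alpha> \<longleftrightarrow> (\<exists>\<beta>. homeomorphism {0..} {0..} \<alpha> \<beta>) \<and> concave_on {0..} \<alpha>"

text \<open>Seminorms take values in \<open>[0,\<infinity>]\<close>, so that no finiteness is presupposed.
  \<open>holder_seminorm \<alpha> S f\<close> is \<open>[f|\<^sub>S]\<^sub>\<alpha>\<close>.\<close>

definition holder_seminorm :: "(real \<Rightarrow> real) \<Rightarrow> real set \<Rightarrow> (real \<Rightarrow> real) \<Rightarrow> ennreal" where
  "holder_seminorm \<alpha> S f =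
     (SUP (x, y) \<in> {(x, y). x \<in> S \<and> y \<in> S \<and> x \<noteq> y}. ennreal (\<bar>f x - f y\<bar> / \<alpha> \<bar>x - y\<bar>))"

definition sup_seminorm :: "nat \<Rightarrow> (real \<Rightarrow> real) \<Rightarrow> ennreal" where
  "sup_seminorm i f = (SUP x. ennreal \<bar>(deriv ^^ i) f x\<bar>)"

definition kalpha_seminorm :: "nat \<Rightarrow> (real \<Rightarrow> real) \<Rightarrow> (real \<Rightarrow> real) \<Rightarrow> ennreal" where
  "kalpha_seminorm k \<alpha> f = holder_seminorm \<alpha> UNIV ((deriv ^^ k) f)"

definition Ck :: "nat \<Rightarrow> (real \<Rightarrow> real) \<Rightarrow> bool" where
  "Ck k f \<longleftrightarrow> (\<forall>i<k. \<forall>x. (deriv ^^ i) f differentiable at x) \<and> continuous_on UNIV ((deriv ^^ k) f)"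

definition Ckalpha :: "nat \<Rightarrow> (real \<Rightarrow> real) \<Rightarrow> (real \<Rightarrow> real) \<Rightarrow> bool" where
  "Ckalpha k \<alpha> f \<longleftrightarrow>
     Ck k f \<and> (\<forall>x. \<exists>U. open U \<and> x \<in> U \<and> holder_seminorm \<alpha> U ((deriv ^^ k) f) < \<infinity>)"

definition supp :: "(real \<Rightarrow> real) \<Rightarrow> real set" where
  "supp g = closure {x. g x \<noteq> x}"

text \<open>For bijections of the line, orientation preserving means increasing.\<close>

definition Diff_c :: "nat \<Rightarrow> (real \<Rightarrow> real) \<Rightarrow> (real \<Rightarrow> real) set" where
  "Diff_c k \<alpha> = {f. bij f \<and> strict_mono f \<and> Ckalpha k \<alpha> f \<and> Ckalpha k \<alpha> (inv_into UNIV f) \<and> compact (supp f)}"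

definition Diff_on :: "real set \<Rightarrow> nat \<Rightarrow> (real \<Rightarrow> real) \<Rightarrow> (real \<Rightarrow> real) set" where
  "Diff_on J k \<alpha> = {f \<in> Diff_c k \<alpha>. supp f \<subseteq> J}"

definition V_nbhd :: "real set \<Rightarrow> nat \<Rightarrow> (real \<Rightarrow> real) \<Rightarrow> real \<Rightarrow> (real \<Rightarrow> real) set" where
  "V_nbhd J k \<alpha> \<delta> = {f \<in> Diff_on J k \<alpha>. kalpha_seminorm k \<alpha> (\<lambda>x. f x - x) < ennreal \<delta>}"

definition Diff_c_group :: "nat \<Rightarrow> (real \<Rightarrow> real) \<Rightarrow> (real \<Rightarrow> real) monoid" where
  "Diff_c_group k \<alpha> = \<lparr>carrier = Diff_c k \<alpha>, mult = (\<circ>), one = id\<rparr>"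

text \<open>The class of \<open>g\<close> in \<open>H\<^sub>1(G) = G Mod derived G (carrier G)\<close>, whose elements are the
  right cosets of the commutator subgroup.\<close>

definition H1_class :: "('a, 'b) monoid_scheme \<Rightarrow> 'a \<Rightarrow> 'a set" where
  "H1_class G g = derived G (carrier G) #>\<^bsub>G\<^esub> g"

definition Ck_dist :: "nat \<Rightarrow> (real \<Rightarrow> real) \<Rightarrow> (real \<Rightarrow> real) \<Rightarrow> ennreal" where
  "Ck_dist k f g = (SUP i \<in> {..k}. sup_seminorm i (\<lambda>x. f x - g x))"

text \<open>Metric continuity on \<open>S\<close> for \<^const>\<open>Ck_dist\<close> on both source and target.
  It is spelled out because \<^const>\<open>Ck_dist\<close> takes the value \<open>\<infinity>\<close> on arbitrary functions, while the
  library's metric spaces on a carrier need a real-valued distance; on \<^const>\<open>Diff_c\<close> it is finite.\<close>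

definition Ck_continuous_on ::
    "nat \<Rightarrow> (real \<Rightarrow> real) set \<Rightarrow> ((real \<Rightarrow> real) \<Rightarrow> (real \<Rightarrow> real)) \<Rightarrow> bool" where
  "Ck_continuous_on k S \<Psi> \<longleftrightarrow>
     (\<forall>f \<in> S. \<forall>\<epsilon>>0. \<exists>\<eta>>0. \<forall>g \<in> S. Ck_dist k f g < ennreal \<eta> \<longrightarrow> Ck_dist k (\<Psi> f) (\<Psi> g) < ennreal \<epsilon>)"

end

theory Submission
  imports Defs
begin

text \<open>
  Write \<open>g = id + f\<close>. For \<open>k = 1\<close>, the path \<open>id + t f\<close> from the identity to \<open>g\<close> is cut into \<open>A\<close> pieces, each
  of size \<open>1/A\<close>, and the pieces are translated to disjoint intervals; translation does not change the class.

  For \<open>k \<ge> 2\<close>, let \<open>T\<close> be the translation by 1. The composition \<open>G\<close> of the translates \<open>T\<^sup>i g T\<^sup>-\<^sup>i\<close>, in increasing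
  order, commutes with \<open>T\<close> on a neighbourhood of \<open>[-4, 4]\<close>, and \<open>T\<^sup>-\<^sup>1 G T G\<^sup>-\<^sup>1\<close> is there a translate of \<open>g\<close>. If \<open>L\<close> agrees with the
  identity on the left and with \<open>G\<close> on the right of \<open>[-1, 1]\<close>, then \<open>T\<^sup>-\<^sup>1 L T L\<^sup>-\<^sup>1\<close> has support in \<open>[-2, 2]\<close>
  and the class of \<open>g\<close>, since \<open>G L\<^sup>-\<^sup>1\<close> has compact support. The seminorm of \<open>G\<close> is at most a constant times \<open>A\<close>
  times that of \<open>g\<close>: the radius \<open>\<delta>\<close> may depend on \<open>A\<close>, so all terms of second order are negligible.
  By periodicity each derivative of \<open>G - id\<close> has a zero near the origin, which controls the lower derivatives
  with constants that do not depend on \<open>A\<close>. For \<open>G - id\<close> itself this fails when \<open>f\<close> has a nonzero mean; so \<open>g\<close> is first replaced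
  by \<open>g\<^sup>2 b g\<^sup>-\<^sup>1 b\<^sup>-\<^sup>1\<close>, where \<open>b\<close> is the dilation by \<open>\<surd>2\<close>.
\<close>

subsection \<open>Classes in the first homology group\<close>

text \<open>The dilation factor is forced: g^2 b g^-1 b^-1 has class 2[g] - [g] = [g], and passing
  from f to r f(x / r) multiplies the integral by r^2, so the mean cancels to first order exactly
  for r^2 = 2. The sum of the integer translates of a function with integral zero has mean zero over
  a period, hence a zero. The obstacle to rolling up is uniformity in A. The support of G has length
  of order A, so integrating down from outside the support costs constants that grow with A; they
  are tolerated only in smallness conditions that \<delta> pays for. The final estimate uses the
  window [-4, 4] alone, and A enters it only through the number of translates. Their effects must
  add up and not multiply, which needs a composition estimate that is sharp to first order. As G has
  finitely many factors, T^-1 L T L^-1 as a whole is trivial in homology: besides the wanted piece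
  near the origin it has a second one at the right end of G. Only the first piece is kept, by an
  explicit formula. For k = 1 the pieces are disjoint, so their seminorms do not add up: the total
  is at most twice the largest one.\<close>

lemma derived_conj_mem:
  assumes "group G" "a \<in> carrier G" "g \<in> carrier G"
  shows "a \<otimes>\<^bsub>G\<^esub> g \<otimes>\<^bsub>G\<^esub> inv\<^bsub>G\<^esub> a \<otimes>\<^bsub>G\<^esub> inv\<^bsub>G\<^esub> g \<in> derived G (carrier G)"
  unfolding derived_def using assms by (intro generate.incl) blast

lemma H1_class_mult_cong:
  assumes G: "group G" and car: "g \<in> carrier G" "g' \<in> carrier G" "h \<in> carrier G" "h' \<in> carrier G"
    and eq: "H1_class G g = H1_class G g'" "H1_class G h = H1_class G h'"
  shows "H1_class G (g \<otimes>\<^bsub>G\<^esub> h) = H1_class G (g' \<otimes>\<^bsub>G\<^esub> h')"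
proof -
  interpret normal "derived G (carrier G)" G
    by (rule group.derived_self_is_normal[OF G])
  show ?thesis
    using eq rcos_sum[OF car(1,3)] rcos_sum[OF car(2,4)] unfolding H1_class_def by simp
qed

lemma H1_class_conj:
  assumes G: "group G" and car: "a \<in> carrier G" "g \<in> carrier G"
  shows "H1_class G (a \<otimes>\<^bsub>G\<^esub> g \<otimes>\<^bsub>G\<^esub> inv\<^bsub>G\<^esub> a) = H1_class G g"
proof -
  interpret normal "derived G (carrier G)" G
    by (rule group.derived_self_is_normal[OF G])
  have "a \<otimes>\<^bsub>G\<^esub> g \<otimes>\<^bsub>G\<^esub> inv\<^bsub>G\<^esub> a = (a \<otimes>\<^bsub>G\<^esub> g \<otimes>\<^bsub>G\<^esub> inv\<^bsub>G\<^esub> a \<otimes>\<^bsub>G\<^esub> inv\<^bsub>G\<^esub> g) \<otimes>\<^bsub>G\<^esub> g"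
    using car by (simp add: m_assoc)
  moreover have "derived G (carrier G) #>\<^bsub>G\<^esub> (a \<otimes>\<^bsub>G\<^esub> g \<otimes>\<^bsub>G\<^esub> inv\<^bsub>G\<^esub> a \<otimes>\<^bsub>G\<^esub> inv\<^bsub>G\<^esub> g) = derived G (carrier G)"
    using derived_conj_mem[OF G car] by (intro coset_join2 subgroup_axioms) (use car in auto)
  ultimately show ?thesis
    unfolding H1_class_def using car
    by (metis coset_mult_assoc inv_closed m_closed subset)
qed

lemma H1_class_mult_right_cancel:
  assumes G: "group G" and car: "g \<in> carrier G" "g' \<in> carrier G" "h \<in> carrier G" "h' \<in> carrier G"
    and eq: "H1_class G (g \<otimes>\<^bsub>G\<^esub> h) = H1_class G (g' \<otimes>\<^bsub>G\<^esub> h')" "H1_class G h = H1_class G h'"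
  shows "H1_class G g = H1_class G g'"
proof -
  interpret group G by fact
  interpret normal "derived G (carrier G)" G
    by (rule group.derived_self_is_normal[OF G])
  have inv: "H1_class G (inv\<^bsub>G\<^esub> h) = H1_class G (inv\<^bsub>G\<^esub> h')"
    using eq(2) rcos_inv[OF car(3)] rcos_inv[OF car(4)] unfolding H1_class_def by simp
  have "H1_class G (g \<otimes>\<^bsub>G\<^esub> h \<otimes>\<^bsub>G\<^esub> inv\<^bsub>G\<^esub> h) = H1_class G (g' \<otimes>\<^bsub>G\<^esub> h' \<otimes>\<^bsub>G\<^esub> inv\<^bsub>G\<^esub> h')"
    using car by (intro H1_class_mult_cong G eq inv) auto
  then show ?thesis
    using car by (simp add: m_assoc)
qed

lemma H1_class_commute:
  assumes G: "group G" and car: "g \<in> carrier G" "h \<in> carrier G"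
  shows "H1_class G (g \<otimes>\<^bsub>G\<^esub> h) = H1_class G (h \<otimes>\<^bsub>G\<^esub> g)"
proof -
  interpret group G by fact
  have "H1_class G (h \<otimes>\<^bsub>G\<^esub> (g \<otimes>\<^bsub>G\<^esub> h) \<otimes>\<^bsub>G\<^esub> inv\<^bsub>G\<^esub> h) = H1_class G (g \<otimes>\<^bsub>G\<^esub> h)"
    using car by (intro H1_class_conj G) auto
  then show ?thesis
    using car by (simp add: m_assoc)
qed

subsection \<open>Concave moduli and differentiability classes\<close>

locale modulus =
  fixes \<alpha> :: "real \<Rightarrow> real"
  assumes concave_modulus: "concave_modulus \<alpha>"
begin

lemma alpha_nonneg: "0 \<le> t \<Longrightarrow> 0 \<le> \<alpha> t"
  using concave_modulus unfolding concave_modulus_def homeomorphism_def by auto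

lemma alpha_concave:
  "0 \<le> x \<Longrightarrow> 0 \<le> y \<Longrightarrow> 0 \<le> u \<Longrightarrow> u \<le> 1 \<Longrightarrow> (1 - u) * \<alpha> x + u * \<alpha> y \<le> \<alpha> ((1 - u) * x + u * y)"
  using concave_modulus unfolding concave_modulus_def concave_on_iff by auto

text \<open>A concave function that decreases somewhere on a half-line is negative far out, which
  nonnegativity excludes.\<close>

lemma alpha_mono:
  assumes "0 \<le> s" "s \<le> t"
  shows "\<alpha> s \<le> \<alpha> t"
proof (rule ccontr)
  assume "\<not> ?thesis"
  then have less: "\<alpha> t < \<alpha> s" and "s < t"
    using assms by (auto simp: not_le le_less)
  have pos: "0 < \<alpha> s" "0 \<le> \<alpha> t"
    using less alpha_nonneg[of t] assms by auto
  \<comment> \<open>\<open>y\<close> will make \<open>t\<close> the convex combination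
    \<open>(1 - u) * s + u * y\<close>, and \<open>u\<close> is tuned so that
    \<open>(1 - u) * \<alpha> s\<close> is the midpoint of \<open>\<alpha> s\<close> and
    \<open>\<alpha> t\<close>, hence above \<open>\<alpha> t\<close>.\<close>
  define u where "u = (\<alpha> s - \<alpha> t) / (2 * \<alpha> s)"
  have u: "0 < u" "u \<le> 1"
    using less pos by (auto simp: u_def field_simps)
  define y where "y = s + (t - s) / u"
  have y: "0 \<le> y" using assms u by (auto simp: y_def)
  have "(1 - u) * \<alpha> s + u * \<alpha> y \<le> \<alpha> ((1 - u) * s + u * y)"
    using alpha_concave[of s y u] assms y u by auto
  also have "(1 - u) * s + u * y = t"
    using u by (simp add: y_def field_simps)
  finally have "(1 - u) * \<alpha> s \<le> \<alpha> t"
    using mult_nonneg_nonneg[of u "\<alpha> y"] alpha_nonneg[OF y] u by linarith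
  moreover have "(1 - u) * \<alpha> s = (\<alpha> s + \<alpha> t) / 2"
    using pos by (simp add: u_def field_simps)
  ultimately show False using less by simp
qed

lemma alpha_inj: "0 \<le> s \<Longrightarrow> 0 \<le> t \<Longrightarrow> \<alpha> s = \<alpha> t \<Longrightarrow> s = t"
  using concave_modulus unfolding concave_modulus_def homeomorphism_def by (metis atLeast_iff)

lemma alpha_0 [simp]: "\<alpha> 0 = 0"
proof -
  obtain s where "0 \<le> s" "\<alpha> s = 0"
    using concave_modulus unfolding concave_modulus_def homeomorphism_def
    by (metis atLeast_iff imageE order_refl)
  with alpha_mono[of 0 s] alpha_nonneg[of 0] show ?thesis by auto
qed

lemma alpha_pos: "0 < t \<Longrightarrow> 0 < \<alpha> t"
  using alpha_inj[of t 0] alpha_nonneg[of t] by (auto simp: less_le)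

text \<open>Concavity on a chord from 0, where \<open>\<alpha>\<close> vanishes. This lets a Hoelder
  condition for an arbitrary concave modulus survive composition with Lipschitz maps.\<close>

lemma alpha_scale:
  assumes "1 \<le> c" "0 \<le> t"
  shows "\<alpha> (c * t) \<le> c * \<alpha> t"
proof -
  have "(1 - 1 / c) * \<alpha> 0 + 1 / c * \<alpha> (c * t) \<le> \<alpha> ((1 - 1 / c) * 0 + 1 / c * (c * t))"
    using assms by (intro alpha_concave) auto
  then show ?thesis using assms by (simp add: field_simps)
qed

text \<open>Concavity on the chord over [0, 1]; at small distances a Lipschitz bound thus implies a
  Hoelder bound.\<close>

lemma le_alpha: "0 \<le> t \<Longrightarrow> t \<le> 1 \<Longrightarrow> t \<le> \<alpha> t / \<alpha> 1"
  using alpha_concave[of 0 1 t] alpha_pos[of 1] by (simp add: field_simps)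

lemma alpha_small:
  assumes "0 < e"
  obtains d where "0 < d" "\<And>t. 0 \<le> t \<Longrightarrow> t \<le> d \<Longrightarrow> \<alpha> t < e"
proof -
  have "continuous_on {0..} \<alpha>"
    using concave_modulus unfolding concave_modulus_def homeomorphism_def by auto
  then obtain d where d: "0 < d" "\<And>t. 0 \<le> t \<Longrightarrow> \<bar>t\<bar> < d \<Longrightarrow> \<bar>\<alpha> t\<bar> < e"
    using assms unfolding continuous_on_iff dist_real_def
    by (metis alpha_0 atLeast_iff diff_zero order_refl)
  show ?thesis
    by (rule that[of "d / 2"]) (use d in \<open>force+\<close>)
qed

end

section \<open>Iterated derivatives and the classes C^k\<close>

lemma funpow_deriv_Suc: "(deriv ^^ Suc n) f = (deriv ^^ n) (deriv f)"
  by (simp add: funpow_Suc_right del: funpow.simps)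

lemma Ck_0: "Ck 0 f \<longleftrightarrow> continuous_on UNIV f"
  by (simp add: Ck_def)

text \<open>\<open>Ck\<close> is defined through iterated derivatives. This form peels off the
  innermost one, and the inductions on the order run on it.\<close>

lemma Ck_Suc: "Ck (Suc n) f \<longleftrightarrow> (\<forall>x. f differentiable at x) \<and> Ck n (deriv f)"
  unfolding Ck_def funpow_deriv_Suc by (auto simp: All_less_Suc2 funpow_deriv_Suc simp del: funpow.simps(2))

lemma Ck_SucD: "Ck (Suc n) f \<Longrightarrow> Ck n f"
proof (induction n arbitrary: f)
  case 0
  then show ?case
    by (auto simp: Ck_0 Ck_Suc differentiable_imp_continuous_within continuous_on_eq_continuous_within)
next
  case (Suc n)
  then show ?case using Ck_Suc by blast
qed

lemma Ck_mono: "Ck n f \<Longrightarrow> m \<le> n \<Longrightarrow> Ck m f"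
proof (induction "n - m" arbitrary: n)
  case (Suc d)
  then obtain n' where "n = Suc n'" by (cases n) auto
  with Suc show ?case using Ck_SucD[of n' f] by (auto intro: Suc.hyps(1)[of n'])
qed auto

lemma Ck_continuous: "Ck n f \<Longrightarrow> continuous_on UNIV f"
  using Ck_mono[of n f 0] by (simp add: Ck_0)

lemma Ck_has_deriv: "Ck (Suc n) f \<Longrightarrow> (f has_real_derivative deriv f x) (at x)"
  by (simp add: Ck_Suc DERIV_deriv_iff_real_differentiable)

lemma Ck_has_deriv': "Ck n f \<Longrightarrow> 1 \<le> n \<Longrightarrow> (f has_real_derivative deriv f x) (at x)"
  using Ck_has_deriv[of "n - 1" f x] by simp

lemma Ck_Suc_intro:
  assumes "\<And>x. (f has_real_derivative f' x) (at x)" "Ck n f'"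
  shows "Ck (Suc n) f"
proof -
  have "deriv f = f'" using assms(1) by (auto intro: DERIV_imp_deriv)
  then show ?thesis using assms by (auto simp: Ck_Suc real_differentiable_def)
qed

lemma Ck_funpow_deriv: "Ck (m + n) f \<Longrightarrow> Ck n ((deriv ^^ m) f)"
  by (induction m arbitrary: f) (auto simp: Ck_Suc funpow_deriv_Suc simp del: funpow.simps(2))

lemma deriv_eqI: "(\<And>x. (f has_real_derivative f' x) (at x)) \<Longrightarrow> deriv f = f'"
  by (auto intro: DERIV_imp_deriv)

lemma deriv_const [simp]: "deriv (\<lambda>x::real. c::real) = (\<lambda>x. 0)"
  by (rule deriv_eqI) auto

lemma deriv_id' [simp]: "deriv (\<lambda>x::real. x) = (\<lambda>x. 1)"
  by (rule deriv_eqI) auto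

lemma deriv_add':
  "Ck (Suc n) f \<Longrightarrow> Ck (Suc n) g \<Longrightarrow> deriv (\<lambda>x. f x + g x) = (\<lambda>x. deriv f x + deriv g x)"
  by (rule deriv_eqI) (auto intro!: derivative_eq_intros dest: Ck_has_deriv)

lemma deriv_mult':
  "Ck (Suc n) f \<Longrightarrow> Ck (Suc n) g \<Longrightarrow> deriv (\<lambda>x. f x * g x) = (\<lambda>x. deriv f x * g x + f x * deriv g x)"
  by (rule deriv_eqI) (auto intro!: derivative_eq_intros dest: Ck_has_deriv)

lemma deriv_comp':
  assumes "Ck (Suc n) f" "Ck (Suc n) g"
  shows "deriv (\<lambda>x. f (g x)) = (\<lambda>x. deriv f (g x) * deriv g x)"
  by (rule deriv_eqI, rule DERIV_chain2) (use assms in \<open>auto intro: Ck_has_deriv\<close>)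

lemma Ck_const [simp]: "Ck n (\<lambda>x. c)"
  by (induction n arbitrary: c) (auto simp: Ck_0 Ck_Suc)

lemma Ck_ident [simp]: "Ck n (\<lambda>x. x)"
  by (cases n) (auto simp: Ck_0 Ck_Suc)

lemma Ck_add: "Ck n f \<Longrightarrow> Ck n g \<Longrightarrow> Ck n (\<lambda>x. f x + g x)"
proof (induction n arbitrary: f g)
  case (Suc n)
  then show ?case
    by (subst Ck_Suc) (auto simp: deriv_add' Ck_Suc)
qed (auto simp: Ck_0 intro: continuous_intros)

lemma Ck_mult: "Ck n f \<Longrightarrow> Ck n g \<Longrightarrow> Ck n (\<lambda>x. f x * g x)"
proof (induction n arbitrary: f g)
  case (Suc n)
  then have "Ck n f" "Ck n g" by (auto dest: Ck_SucD)
  with Suc show ?case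
    by (subst Ck_Suc) (auto simp: deriv_mult' Ck_Suc intro!: Ck_add)
qed (auto simp: Ck_0 intro: continuous_intros)

lemma Ck_minus: "Ck n f \<Longrightarrow> Ck n (\<lambda>x. - f x)"
  using Ck_mult[of n "\<lambda>x. - 1" f] by simp

lemma Ck_diff: "Ck n f \<Longrightarrow> Ck n g \<Longrightarrow> Ck n (\<lambda>x. f x - g x)"
  using Ck_add[of n f "\<lambda>x. - g x"] by (simp add: Ck_minus)

lemma Ck_compose: "Ck n f \<Longrightarrow> Ck n g \<Longrightarrow> Ck n (\<lambda>x. f (g x))"
proof (induction n arbitrary: f g)
  case 0
  then show ?case by (auto simp: Ck_0 intro: continuous_on_compose2)
next
  case (Suc n)
  then have "Ck n g" by (auto dest: Ck_SucD)
  have "(\<lambda>x. f (g x)) differentiable at x" for x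
    using Suc.prems by (auto simp: Ck_Suc intro: differentiable_compose)
  with Suc \<open>Ck n g\<close> show ?case
    by (subst Ck_Suc) (auto simp: deriv_comp' Ck_Suc intro!: Ck_mult)
qed

lemma funpow_deriv_add:
  "Ck n f \<Longrightarrow> Ck n g \<Longrightarrow> (deriv ^^ n) (\<lambda>x. f x + g x) = (\<lambda>x. (deriv ^^ n) f x + (deriv ^^ n) g x)"
proof (induction n arbitrary: f g)
  case (Suc n)
  then show ?case
    unfolding funpow_deriv_Suc deriv_add'[OF Suc.prems] by (simp add: Ck_Suc)
qed auto

lemma funpow_deriv_cmult:
  "Ck n f \<Longrightarrow> (deriv ^^ n) (\<lambda>x. c * f x) = (\<lambda>x. c * (deriv ^^ n) f x)"
proof (induction n arbitrary: f)
  case (Suc n)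
  have "deriv (\<lambda>x. c * f x) = (\<lambda>x. c * deriv f x)"
    using deriv_mult'[of n "\<lambda>x. c" f] Suc.prems by simp
  with Suc show ?case
    unfolding funpow_deriv_Suc by (simp add: Ck_Suc)
qed auto

lemma funpow_deriv_diff:
  assumes "Ck n f" "Ck n g"
  shows "(deriv ^^ n) (\<lambda>x. f x - g x) = (\<lambda>x. (deriv ^^ n) f x - (deriv ^^ n) g x)"
  using funpow_deriv_add[of n f "\<lambda>x. - 1 * g x"] funpow_deriv_cmult[of n g "-1"] assms
  by (simp add: Ck_minus)

lemma funpow_deriv_affine:
  "Ck n f \<Longrightarrow> (deriv ^^ n) (\<lambda>x. f (a * x + b)) = (\<lambda>x. a ^ n * (deriv ^^ n) f (a * x + b))"
proof (induction n arbitrary: f)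
  case (Suc n)
  have "deriv (\<lambda>x. a * x + b) = (\<lambda>x. a)"
    by (rule deriv_eqI) (auto intro!: derivative_eq_intros)
  then have *: "deriv (\<lambda>x. f (a * x + b)) = (\<lambda>x. a * deriv f (a * x + b))"
    using deriv_comp'[of n f "\<lambda>x. a * x + b"] Suc.prems by (simp add: Ck_add Ck_mult mult.commute)
  have "Ck n (\<lambda>x. deriv f (a * x + b))"
  proof (rule Ck_compose[where f = "deriv f" and g = "\<lambda>x. a * x + b"])
    show "Ck n (deriv f)" using Suc.prems by (simp add: Ck_Suc)
    show "Ck n (\<lambda>x. a * x + b)" by (intro Ck_add Ck_mult Ck_const Ck_ident)
  qed
  then have "(deriv ^^ n) (\<lambda>x. a * deriv f (a * x + b)) = (\<lambda>x. a * (deriv ^^ n) (\<lambda>x. deriv f (a * x + b)) x)"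
    by (rule funpow_deriv_cmult)
  also have "(deriv ^^ n) (\<lambda>x. deriv f (a * x + b)) = (\<lambda>x. a ^ n * (deriv ^^ n) (deriv f) (a * x + b))"
    using Suc.prems by (intro Suc.IH) (simp add: Ck_Suc)
  finally show ?case
    unfolding funpow_deriv_Suc * by (simp add: mult.assoc)
qed auto

lemma funpow_deriv_minus_id:
  assumes "Ck n g"
  shows "(deriv ^^ n) (\<lambda>x. g x - x) = (\<lambda>x. (deriv ^^ n) g x - (deriv ^^ n) (\<lambda>x. x) x)"
  using assms by (simp add: funpow_deriv_diff)

lemma funpow_deriv_const: "(deriv ^^ n) (\<lambda>x::real. c::real) = (\<lambda>x. if n = 0 then c else 0)"
proof (induction n arbitrary: c)
  case (Suc n)
  then show ?case unfolding funpow_deriv_Suc by simp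
qed simp

lemma funpow_deriv_ident: "1 \<le> n \<Longrightarrow> (deriv ^^ n) (\<lambda>x::real. x) = (\<lambda>x. if n = 1 then 1 else 0)"
  by (cases n) (auto simp: funpow_deriv_Suc funpow_deriv_const simp del: funpow.simps(2))

lemma funpow_deriv_cong_on_open:
  assumes "open S" "\<And>x. x \<in> S \<Longrightarrow> f x = g x" "x \<in> S"
  shows "(deriv ^^ n) f x = (deriv ^^ n) (g :: real \<Rightarrow> real) x"
  using assms(2,3)
proof (induction n arbitrary: f g x)
  case (Suc n)
  have "deriv f y = deriv g y" if "y \<in> S" for y
  proof -
    have "eventually (\<lambda>z. z \<in> S) (nhds y)" using assms(1) that by (rule eventually_nhds_in_open)
    then show ?thesis
      by (intro deriv_cong_ev refl) (rule eventually_mono, assumption, rule Suc.prems(1))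
  qed
  then show ?case unfolding funpow_deriv_Suc by (intro Suc.IH Suc.prems)
qed auto

lemma deriv_eq_0_outside:
  assumes "\<And>x. R < \<bar>x\<bar> \<Longrightarrow> f x = (0::real)" "R < \<bar>x\<bar>"
  shows "(deriv ^^ n) f x = 0"
proof -
  have "open {x::real. R < \<bar>x\<bar>}"
    by (intro open_Collect_less continuous_intros)
  from funpow_deriv_cong_on_open[OF this, of f "\<lambda>x. 0" x n] assms show ?thesis
    by (simp add: funpow_deriv_const)
qed

text \<open>Support conditions are stated with a strict inequality. Adding the boundary allows
  translated intervals to share endpoints.\<close>

lemma continuous_eq_0_boundary:
  fixes f :: "real \<Rightarrow> real"
  assumes "continuous_on UNIV f" "\<And>x. R < \<bar>x\<bar> \<Longrightarrow> f x = (0::real)" "R \<le> \<bar>x\<bar>" "0 \<le> R"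
  shows "f x = 0"
proof (cases "R < \<bar>x\<bar>")
  case False
  with assms(3) have x: "\<bar>x\<bar> = R" by linarith
  \<comment> \<open>The sign \<open>s\<close> points away from the origin, so the sequence
    approaches \<open>x\<close> from outside the support.\<close>
  define s where "s = (if 0 \<le> x then 1 else -1 :: real)"
  have "((\<lambda>n. f (x + s * (1 / real (Suc n)))) \<longlonglongrightarrow> f (x + s * 0))"
    by (intro continuous_on_tendsto_compose[OF assms(1)] tendsto_intros LIMSEQ_Suc lim_1_over_n) auto
  moreover have "f (x + s * (1 / real (Suc n))) = 0" for n
  proof -
    have "0 < 1 / real (Suc n)" by simp
    then have "R < \<bar>x + s * (1 / real (Suc n))\<bar>"
      using x unfolding s_def by (cases "0 \<le> x"; simp only: if_True if_False; linarith)
    then show ?thesis by (rule assms(2))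
  qed
  ultimately show ?thesis by (simp add: LIMSEQ_const_iff)
qed (use assms in auto)

section \<open>Local Hoelder continuity and the classes C^{k,alpha}\<close>

context modulus
begin

definition locally_holder :: "(real \<Rightarrow> real) \<Rightarrow> bool" where
  "locally_holder f \<longleftrightarrow> (\<forall>x. \<exists>d>0. \<exists>M\<ge>0. \<forall>y z. \<bar>y - x\<bar> < d \<longrightarrow> \<bar>z - x\<bar> < d \<longrightarrow> \<bar>f y - f z\<bar> \<le> M * \<alpha> \<bar>y - z\<bar>)"

lemma holder_seminorm_le_iff:
  assumes "0 \<le> M"
  shows "holder_seminorm \<alpha> S f \<le> ennreal M \<longleftrightarrow> (\<forall>x\<in>S. \<forall>y\<in>S. \<bar>f x - f y\<bar> \<le> M * \<alpha> \<bar>x - y\<bar>)"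
proof -
  have "ennreal (\<bar>f x - f y\<bar> / \<alpha> \<bar>x - y\<bar>) \<le> ennreal M \<longleftrightarrow> \<bar>f x - f y\<bar> \<le> M * \<alpha> \<bar>x - y\<bar>" if "x \<noteq> y" for x y
  proof -
    have "0 < \<alpha> \<bar>x - y\<bar>" using that by (intro alpha_pos) simp
    then show ?thesis by (simp only: ennreal_le_iff[OF assms] pos_divide_le_eq)
  qed
  then have "holder_seminorm \<alpha> S f \<le> ennreal M \<longleftrightarrow> (\<forall>x\<in>S. \<forall>y\<in>S. x \<noteq> y \<longrightarrow> \<bar>f x - f y\<bar> \<le> M * \<alpha> \<bar>x - y\<bar>)"
    unfolding holder_seminorm_def SUP_le_iff by (simp add: Ball_def split_paired_All) metis
  moreover have "\<bar>f x - f x\<bar> \<le> M * \<alpha> \<bar>x - x\<bar>" for x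
    by simp
  ultimately show ?thesis by metis
qed

lemma holder_seminorm_finiteD:
  assumes "holder_seminorm \<alpha> S f < \<infinity>"
  obtains M where "0 \<le> M" "\<And>x y. x \<in> S \<Longrightarrow> y \<in> S \<Longrightarrow> \<bar>f x - f y\<bar> \<le> M * \<alpha> \<bar>x - y\<bar>"
proof -
  obtain M where "0 \<le> M" "holder_seminorm \<alpha> S f = ennreal M"
    using assms by (cases "holder_seminorm \<alpha> S f") auto
  then show ?thesis using that[of M] holder_seminorm_le_iff[of M S f] by simp
qed

lemma Ckalpha_iff: "Ckalpha k \<alpha> f \<longleftrightarrow> Ck k f \<and> locally_holder ((deriv ^^ k) f)"
proof -
  have "(\<exists>U. open U \<and> x \<in> U \<and> holder_seminorm \<alpha> U g < \<infinity>) \<longleftrightarrow>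
      (\<exists>d>0. \<exists>M\<ge>0. \<forall>y z. \<bar>y - x\<bar> < d \<longrightarrow> \<bar>z - x\<bar> < d \<longrightarrow> \<bar>g y - g z\<bar> \<le> M * \<alpha> \<bar>y - z\<bar>)"
    (is "?L \<longleftrightarrow> ?R") for x g
  proof
    assume ?L
    then obtain U where U: "open U" "x \<in> U" "holder_seminorm \<alpha> U g < \<infinity>" by blast
    from U(3) obtain M where M: "0 \<le> M" "\<And>y z. y \<in> U \<Longrightarrow> z \<in> U \<Longrightarrow> \<bar>g y - g z\<bar> \<le> M * \<alpha> \<bar>y - z\<bar>"
      by (rule holder_seminorm_finiteD) auto
    obtain d where "0 < d" "\<And>y. \<bar>y - x\<bar> < d \<Longrightarrow> y \<in> U"
      using U(1,2) unfolding open_dist dist_real_def by blast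
    with M show ?R by blast
  next
    assume ?R
    then obtain d M where dM: "0 < d" "0 \<le> M"
      "\<And>y z. \<bar>y - x\<bar> < d \<Longrightarrow> \<bar>z - x\<bar> < d \<Longrightarrow> \<bar>g y - g z\<bar> \<le> M * \<alpha> \<bar>y - z\<bar>" by blast
    then have "holder_seminorm \<alpha> (ball x d) g \<le> ennreal M"
      by (subst holder_seminorm_le_iff) (auto simp: dist_real_def abs_minus_commute)
    then have "holder_seminorm \<alpha> (ball x d) g < \<infinity>" by (rule le_less_trans) simp
    with dM(1) show ?L by (intro exI[of _ "ball x d"]) auto
  qed
  then show ?thesis unfolding Ckalpha_def locally_holder_def by simp
qed

lemma ex_pos_nonnegI: "(0::real) < d \<Longrightarrow> (0::real) \<le> M \<Longrightarrow> P d M \<Longrightarrow> \<exists>d>0. \<exists>M\<ge>0. P d M"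
  by blast

lemma locally_holderE:
  assumes "locally_holder f"
  obtains d M where "0 < d" "0 \<le> M"
    "\<And>y z. \<bar>y - x\<bar> < d \<Longrightarrow> \<bar>z - x\<bar> < d \<Longrightarrow> \<bar>f y - f z\<bar> \<le> M * \<alpha> \<bar>y - z\<bar>"
  using assms unfolding locally_holder_def by meson

lemma locally_holder_imp_bounded:
  assumes "locally_holder f"
  obtains d B where "0 < d" "0 \<le> B" "\<And>y. \<bar>y - x\<bar> < d \<Longrightarrow> \<bar>f y\<bar> \<le> B"
proof -
  obtain d M where d: "0 < d" and M: "0 \<le> M"
    and H: "\<And>y z. \<bar>y - x\<bar> < d \<Longrightarrow> \<bar>z - x\<bar> < d \<Longrightarrow> \<bar>f y - f z\<bar> \<le> M * \<alpha> \<bar>y - z\<bar>"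
    using locally_holderE[OF assms, of x] by blast
  have "\<bar>f y\<bar> \<le> \<bar>f x\<bar> + M * \<alpha> d" if "\<bar>y - x\<bar> < d" for y
  proof -
    have "\<bar>f y - f x\<bar> \<le> M * \<alpha> \<bar>y - x\<bar>" using H[of y x] that d by simp
    also have "\<dots> \<le> M * \<alpha> d" using that M by (intro mult_left_mono alpha_mono) auto
    finally show ?thesis by linarith
  qed
  moreover have "0 \<le> \<bar>f x\<bar> + M * \<alpha> d" using M d alpha_nonneg[of d] by simp
  ultimately show ?thesis using that d by blast
qed

lemma locally_holder_add:
  assumes "locally_holder f" "locally_holder g"
  shows "locally_holder (\<lambda>x. f x + g x)"
  unfolding locally_holder_def
proof
  fix x
  obtain d M where f: "0 < d" "0 \<le> M"
    "\<And>y z. \<bar>y - x\<bar> < d \<Longrightarrow> \<bar>z - x\<bar> < d \<Longrightarrow> \<bar>f y - f z\<bar> \<le> M * \<alpha> \<bar>y - z\<bar>"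
    using locally_holderE[OF assms(1), of x] by blast
  obtain d' M' where g: "0 < d'" "0 \<le> M'"
    "\<And>y z. \<bar>y - x\<bar> < d' \<Longrightarrow> \<bar>z - x\<bar> < d' \<Longrightarrow> \<bar>g y - g z\<bar> \<le> M' * \<alpha> \<bar>y - z\<bar>"
    using locally_holderE[OF assms(2), of x] by blast
  show "\<exists>d>0. \<exists>M\<ge>0. \<forall>y z. \<bar>y - x\<bar> < d \<longrightarrow> \<bar>z - x\<bar> < d \<longrightarrow> \<bar>f y + g y - (f z + g z)\<bar> \<le> M * \<alpha> \<bar>y - z\<bar>"
  proof (rule ex_pos_nonnegI[of "min d d'" "M + M'"]; (intro allI impI)?)
    fix y z assume "\<bar>y - x\<bar> < min d d'" "\<bar>z - x\<bar> < min d d'"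
    then show "\<bar>f y + g y - (f z + g z)\<bar> \<le> (M + M') * \<alpha> \<bar>y - z\<bar>"
      using f(3)[of y z] g(3)[of y z] by (simp add: distrib_right)
  qed (use f g in auto)
qed

lemma locally_holder_mult:
  assumes "locally_holder f" "locally_holder g"
  shows "locally_holder (\<lambda>x. f x * g x)"
  unfolding locally_holder_def
proof
  fix x
  obtain d M where f: "0 < d" "0 \<le> M"
    "\<And>y z. \<bar>y - x\<bar> < d \<Longrightarrow> \<bar>z - x\<bar> < d \<Longrightarrow> \<bar>f y - f z\<bar> \<le> M * \<alpha> \<bar>y - z\<bar>"
    using locally_holderE[OF assms(1), of x] by blast
  obtain d' M' where g: "0 < d'" "0 \<le> M'"
    "\<And>y z. \<bar>y - x\<bar> < d' \<Longrightarrow> \<bar>z - x\<bar> < d' \<Longrightarrow> \<bar>g y - g z\<bar> \<le> M' * \<alpha> \<bar>y - z\<bar>"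
    using locally_holderE[OF assms(2), of x] by blast
  obtain e B where B: "0 < e" "0 \<le> B" "\<And>y. \<bar>y - x\<bar> < e \<Longrightarrow> \<bar>f y\<bar> \<le> B"
    using locally_holder_imp_bounded[OF assms(1), of x] by blast
  obtain e' B' where B': "0 < e'" "0 \<le> B'" "\<And>y. \<bar>y - x\<bar> < e' \<Longrightarrow> \<bar>g y\<bar> \<le> B'"
    using locally_holder_imp_bounded[OF assms(2), of x] by blast
  show "\<exists>d>0. \<exists>M\<ge>0. \<forall>y z. \<bar>y - x\<bar> < d \<longrightarrow> \<bar>z - x\<bar> < d \<longrightarrow> \<bar>f y * g y - (f z * g z)\<bar> \<le> M * \<alpha> \<bar>y - z\<bar>"
  proof (rule ex_pos_nonnegI[of "min (min d d') (min e e')" "B * M' + M * B'"]; (intro allI impI)?)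
    fix y z assume yz: "\<bar>y - x\<bar> < min (min d d') (min e e')" "\<bar>z - x\<bar> < min (min d d') (min e e')"
    have "\<bar>f y * g y - (f z * g z)\<bar> = \<bar>f y * (g y - g z) + (f y - f z) * g z\<bar>"
      by (simp add: algebra_simps)
    also have "\<dots> \<le> \<bar>f y\<bar> * \<bar>g y - g z\<bar> + \<bar>f y - f z\<bar> * \<bar>g z\<bar>"
      by (metis abs_mult abs_triangle_ineq)
    also have "\<dots> \<le> B * (M' * \<alpha> \<bar>y - z\<bar>) + (M * \<alpha> \<bar>y - z\<bar>) * B'"
    proof (intro add_mono mult_mono)
      show "\<bar>f y\<bar> \<le> B" "\<bar>g z\<bar> \<le> B'" using yz B(3) B'(3) by simp_all
      show "\<bar>g y - g z\<bar> \<le> M' * \<alpha> \<bar>y - z\<bar>" "\<bar>f y - f z\<bar> \<le> M * \<alpha> \<bar>y - z\<bar>"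
        using yz f(3) g(3) by simp_all
      show "0 \<le> M * \<alpha> \<bar>y - z\<bar>" using f(2) by (simp add: alpha_nonneg)
    qed (use B(2) in simp_all)
    finally show "\<bar>f y * g y - (f z * g z)\<bar> \<le> (B * M' + M * B') * \<alpha> \<bar>y - z\<bar>"
      by (simp add: algebra_simps)
  qed (use f(1,2) g(1,2) B(1,2) B'(1,2) in auto)
qed

lemma C1_locally_lipschitz:
  assumes "Ck 1 f"
  obtains d L where "0 < d" "1 \<le> L"
    "\<And>y z. \<bar>y - x\<bar> < d \<Longrightarrow> \<bar>z - x\<bar> < d \<Longrightarrow> \<bar>f y - f z\<bar> \<le> L * \<bar>y - z\<bar>"
proof -
  have "continuous_on {x - 1..x + 1} (deriv f)"
    using assms by (auto simp: Ck_Suc Ck_0 intro: continuous_on_subset)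
  then obtain L where L: "\<And>y. y \<in> {x - 1..x + 1} \<Longrightarrow> \<bar>deriv f y\<bar> \<le> L"
    using compact_imp_bounded[OF compact_continuous_image, of "{x - 1..x + 1}" "deriv f"]
    unfolding bounded_iff by (metis compact_Icc imageI real_norm_def)
  show ?thesis
  proof (rule that[of 1 "max L 1"])
    fix y z assume yz: "\<bar>y - x\<bar> < 1" "\<bar>z - x\<bar> < 1"
    have "norm (f z - f y) \<le> max L 1 * norm (z - y)"
    proof (rule field_differentiable_bound[of "{x - 1..x + 1}" f "deriv f" "max L 1"])
      show "(f has_field_derivative deriv f w) (at w within {x - 1..x + 1})" for w
        using Ck_has_deriv'[OF assms, of w] by (simp add: has_field_derivative_at_within)
      show "norm (deriv f w) \<le> max L 1" if "w \<in> {x - 1..x + 1}" for w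
        using L[OF that] by simp
    qed (use yz in auto)
    then show "\<bar>f y - f z\<bar> \<le> max L 1 * \<bar>y - z\<bar>" by (simp add: abs_minus_commute)
  qed auto
qed

lemma C1_imp_locally_holder:
  assumes "Ck 1 f"
  shows "locally_holder f"
  unfolding locally_holder_def
proof
  fix x
  obtain d L where dL: "0 < d" "1 \<le> L"
    "\<And>y z. \<bar>y - x\<bar> < d \<Longrightarrow> \<bar>z - x\<bar> < d \<Longrightarrow> \<bar>f y - f z\<bar> \<le> L * \<bar>y - z\<bar>"
    using C1_locally_lipschitz[OF assms, of x] by blast
  show "\<exists>d>0. \<exists>M\<ge>0. \<forall>y z. \<bar>y - x\<bar> < d \<longrightarrow> \<bar>z - x\<bar> < d \<longrightarrow> \<bar>f y - f z\<bar> \<le> M * \<alpha> \<bar>y - z\<bar>"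
  \<comment> \<open>Radius 1/2 keeps \<open>y\<close> and \<open>z\<close> at distance at most 1,
    the range of \<open>le_alpha\<close>.\<close>
  proof (rule ex_pos_nonnegI[of "min d (1/2)" "L / \<alpha> 1"]; (intro allI impI)?)
    fix y z assume yz: "\<bar>y - x\<bar> < min d (1/2)" "\<bar>z - x\<bar> < min d (1/2)"
    then have "\<bar>f y - f z\<bar> \<le> L * \<bar>y - z\<bar>" using dL by simp
    also have "L * \<bar>y - z\<bar> \<le> L * (\<alpha> \<bar>y - z\<bar> / \<alpha> 1)"
    proof (rule mult_left_mono[OF le_alpha])
      show "\<bar>y - z\<bar> \<le> 1" using yz unfolding min_less_iff_conj by linarith
    qed (use dL in auto)
    finally show "\<bar>f y - f z\<bar> \<le> L / \<alpha> 1 * \<alpha> \<bar>y - z\<bar>" by simp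
  qed (use dL alpha_pos[of 1] in auto)
qed

lemma locally_holder_compose:
  assumes "locally_holder f" "Ck 1 g"
  shows "locally_holder (\<lambda>x. f (g x))"
  unfolding locally_holder_def
proof
  fix x
  obtain d M where f: "0 < d" "0 \<le> M"
    "\<And>y z. \<bar>y - g x\<bar> < d \<Longrightarrow> \<bar>z - g x\<bar> < d \<Longrightarrow> \<bar>f y - f z\<bar> \<le> M * \<alpha> \<bar>y - z\<bar>"
    using locally_holderE[OF assms(1), of "g x"] by blast
  obtain e L where g: "0 < e" "1 \<le> L"
    "\<And>y z. \<bar>y - x\<bar> < e \<Longrightarrow> \<bar>z - x\<bar> < e \<Longrightarrow> \<bar>g y - g z\<bar> \<le> L * \<bar>y - z\<bar>"
    using C1_locally_lipschitz[OF assms(2), of x] by blast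
  show "\<exists>d>0. \<exists>M\<ge>0. \<forall>y z. \<bar>y - x\<bar> < d \<longrightarrow> \<bar>z - x\<bar> < d \<longrightarrow> \<bar>f (g y) - f (g z)\<bar> \<le> M * \<alpha> \<bar>y - z\<bar>"
  proof (rule ex_pos_nonnegI[of "min e (d / L)" "M * L"]; (intro allI impI)?)
    fix y z assume yz: "\<bar>y - x\<bar> < min e (d / L)" "\<bar>z - x\<bar> < min e (d / L)"
    have "\<bar>g w - g x\<bar> < d" if "\<bar>w - x\<bar> < min e (d / L)" for w
    proof -
      have "\<bar>g w - g x\<bar> \<le> L * \<bar>w - x\<bar>" using g that by simp
      also have "\<dots> < L * (d / L)" using that g by (intro mult_strict_left_mono) auto
      finally show ?thesis using g by simp
    qed
    then have "\<bar>f (g y) - f (g z)\<bar> \<le> M * \<alpha> \<bar>g y - g z\<bar>" using yz f by blast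
    also have "\<dots> \<le> M * \<alpha> (L * \<bar>y - z\<bar>)"
      using yz f g by (intro mult_left_mono alpha_mono) auto
    also have "\<dots> \<le> M * (L * \<alpha> \<bar>y - z\<bar>)"
      using f g by (intro mult_left_mono alpha_scale) auto
    finally show "\<bar>f (g y) - f (g z)\<bar> \<le> M * L * \<alpha> \<bar>y - z\<bar>" by simp
  qed (use f g in auto)
qed

lemma Ckalpha_0: "Ckalpha 0 \<alpha> f \<longleftrightarrow> Ck 0 f \<and> locally_holder f"
  by (simp add: Ckalpha_iff)

lemma Ckalpha_Suc: "Ckalpha (Suc n) \<alpha> f \<longleftrightarrow> (\<forall>x. f differentiable at x) \<and> Ckalpha n \<alpha> (deriv f)"
  by (auto simp: Ckalpha_iff Ck_Suc funpow_deriv_Suc simp del: funpow.simps)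

lemma Ckalpha_imp_Ck: "Ckalpha n \<alpha> f \<Longrightarrow> Ck n f"
  by (simp add: Ckalpha_iff)

text \<open>One more derivative makes the top one locally Lipschitz, hence locally Hoelder. In the
  inductions below this supplies the regularity of \<open>f\<close> in products of \<open>f\<close>
  with a derivative.\<close>

lemma Ck_Suc_imp_Ckalpha: "Ck (Suc n) f \<Longrightarrow> Ckalpha n \<alpha> f"
  using Ck_funpow_deriv[of n 1 f] by (auto simp: Ckalpha_iff Ck_SucD intro: C1_imp_locally_holder)

lemma Ckalpha_SucD: "Ckalpha (Suc n) \<alpha> f \<Longrightarrow> Ckalpha n \<alpha> f"
  by (rule Ck_Suc_imp_Ckalpha, erule Ckalpha_imp_Ck)

lemma Ckalpha_mono: "Ckalpha n \<alpha> f \<Longrightarrow> m \<le> n \<Longrightarrow> Ckalpha m \<alpha> f"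
  using Ck_Suc_imp_Ckalpha[of m f] Ck_mono[of n f "Suc m"] Ckalpha_imp_Ck[of n f]
  by (cases "m = n") (simp_all add: Suc_le_eq)

lemma Ckalpha_const [simp]: "Ckalpha n \<alpha> (\<lambda>x. c)" and Ckalpha_ident [simp]: "Ckalpha n \<alpha> (\<lambda>x. x)"
  by (rule Ck_Suc_imp_Ckalpha, simp)+

lemma Ckalpha_add: "Ckalpha n \<alpha> f \<Longrightarrow> Ckalpha n \<alpha> g \<Longrightarrow> Ckalpha n \<alpha> (\<lambda>x. f x + g x)"
  by (simp add: Ckalpha_iff Ck_add funpow_deriv_add locally_holder_add)

lemma Ckalpha_mult: "Ckalpha n \<alpha> f \<Longrightarrow> Ckalpha n \<alpha> g \<Longrightarrow> Ckalpha n \<alpha> (\<lambda>x. f x * g x)"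
proof (induction n arbitrary: f g)
  case 0
  then show ?case by (simp add: Ckalpha_0 Ck_mult locally_holder_mult)
next
  case (Suc n)
  note Ck = Ckalpha_imp_Ck[OF Suc.prems(1)] Ckalpha_imp_Ck[OF Suc.prems(2)]
  note Ckalpha = Ckalpha_SucD[OF Suc.prems(1)] Ckalpha_SucD[OF Suc.prems(2)]
  have "(\<lambda>x. f x * g x) differentiable at x" for x
    using Ck_mult[OF Ck] by (simp add: Ck_Suc)
  moreover have "Ckalpha n \<alpha> (\<lambda>x. deriv f x * g x + f x * deriv g x)"
    using Suc.prems Ckalpha by (intro Ckalpha_add Suc.IH) (simp_all add: Ckalpha_Suc)
  ultimately show ?case
    by (simp add: Ckalpha_Suc deriv_mult'[OF Ck])
qed

text \<open>At order 0 the inner map has to be locally Lipschitz for the modulus to stay the same;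
  hence the separate hypothesis \<open>Ck 1 g\<close>.\<close>

lemma Ckalpha_compose: "Ckalpha n \<alpha> f \<Longrightarrow> Ckalpha n \<alpha> g \<Longrightarrow> Ck 1 g \<Longrightarrow> Ckalpha n \<alpha> (\<lambda>x. f (g x))"
proof (induction n arbitrary: f g)
  case 0
  then show ?case
    using Ck_compose[of 0 f g] locally_holder_compose[of f g] by (simp add: Ckalpha_0)
next
  case (Suc n)
  note Ck = Ckalpha_imp_Ck[OF Suc.prems(1)] Ckalpha_imp_Ck[OF Suc.prems(2)]
  have "Ckalpha n \<alpha> (\<lambda>x. deriv f (g x))"
    using Suc.IH[of "deriv f" g] Suc.prems Ckalpha_SucD[OF Suc.prems(2)] by (simp add: Ckalpha_Suc)
  moreover have "(\<lambda>x. f (g x)) differentiable at x" for x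
    using Ck_compose[OF Ck] by (simp add: Ck_Suc)
  ultimately show ?case
    using Suc.prems by (simp add: Ckalpha_Suc deriv_comp'[OF Ck] Ckalpha_mult)
qed

end

section \<open>Reciprocals and inverse functions\<close>

lemma deriv_inverse':
  assumes "Ck (Suc n) f" "\<And>x. f x \<noteq> 0"
  shows "(\<lambda>x. 1 / f x) differentiable at x"
    "deriv (\<lambda>x. 1 / f x) = (\<lambda>x. - 1 * (deriv f x * ((1 / f x) * (1 / f x))))"
proof -
  have *: "((\<lambda>x. 1 / f x) has_real_derivative - 1 * (deriv f x * ((1 / f x) * (1 / f x)))) (at x)" for x
    using assms by (auto intro!: derivative_eq_intros Ck_has_deriv[OF assms(1)] simp: field_simps)
  show "(\<lambda>x. 1 / f x) differentiable at x"
    using * real_differentiable_def by blast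
  show "deriv (\<lambda>x. 1 / f x) = (\<lambda>x. - 1 * (deriv f x * ((1 / f x) * (1 / f x))))"
    by (rule deriv_eqI) (rule *)
qed

lemma Ck_recip:
  assumes "Ck n f" "\<And>x. f x \<noteq> 0"
  shows "Ck n (\<lambda>x. 1 / f x)"
  using assms(1)
proof (induction n)
  case 0
  then show ?case using assms(2) by (auto simp: Ck_0 intro!: continuous_intros)
next
  case (Suc n)
  then have "Ck n (\<lambda>x. 1 / f x)" "Ck n (deriv f)" by (auto simp: Ck_SucD Ck_Suc)
  then show ?case
    unfolding Ck_Suc deriv_inverse'(2)[OF Suc.prems assms(2)]
    by (intro conjI allI deriv_inverse'(1)[OF Suc.prems assms(2)] Ck_mult Ck_const)
qed

context modulus
begin

lemma locally_holder_recip: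
  assumes "locally_holder f" "Ck 0 f" "\<And>x. f x \<noteq> 0"
  shows "locally_holder (\<lambda>x. 1 / f x)"
  unfolding locally_holder_def
proof
  fix x
  obtain d M where f: "0 < d" "0 \<le> M"
    "\<And>y z. \<bar>y - x\<bar> < d \<Longrightarrow> \<bar>z - x\<bar> < d \<Longrightarrow> \<bar>f y - f z\<bar> \<le> M * \<alpha> \<bar>y - z\<bar>"
    using locally_holderE[OF assms(1), of x] by blast
  define c where "c = \<bar>f x\<bar> / 2"
  have c: "0 < c" using assms(3) by (simp add: c_def)
  obtain e where e: "0 < e" "\<And>y. \<bar>y - x\<bar> < e \<Longrightarrow> \<bar>f y - f x\<bar> < c"
    using assms(2)[unfolded Ck_0 continuous_on_iff, rule_format, of x c] c by (auto simp: dist_real_def)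
  show "\<exists>d>0. \<exists>M\<ge>0. \<forall>y z. \<bar>y - x\<bar> < d \<longrightarrow> \<bar>z - x\<bar> < d \<longrightarrow> \<bar>1 / f y - 1 / f z\<bar> \<le> M * \<alpha> \<bar>y - z\<bar>"
  proof (rule ex_pos_nonnegI[of "min d e" "M / (c * c)"]; (intro allI impI)?)
    fix y z assume yz: "\<bar>y - x\<bar> < min d e" "\<bar>z - x\<bar> < min d e"
    have low: "c \<le> \<bar>f w\<bar>" if "\<bar>w - x\<bar> < e" for w
      using e(2)[OF that] unfolding c_def by linarith
    have "1 / f y - 1 / f z = (f z - f y) / (f y * f z)"
      using assms(3)[of y] assms(3)[of z] by (simp add: field_simps)
    then have "\<bar>1 / f y - 1 / f z\<bar> = \<bar>f y - f z\<bar> / (\<bar>f y\<bar> * \<bar>f z\<bar>)"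
      by (simp only: abs_divide abs_mult abs_minus_commute[of "f z"])
    also have "\<dots> \<le> (M * \<alpha> \<bar>y - z\<bar>) / (c * c)"
      using yz low[of y] low[of z] c f alpha_nonneg[of "\<bar>y - z\<bar>"] by (intro frac_le mult_mono) auto
    finally show "\<bar>1 / f y - 1 / f z\<bar> \<le> M / (c * c) * \<alpha> \<bar>y - z\<bar>" by simp
  qed (use f e c in auto)
qed

lemma Ckalpha_recip:
  assumes "Ckalpha n \<alpha> f" "\<And>x. f x \<noteq> 0"
  shows "Ckalpha n \<alpha> (\<lambda>x. 1 / f x)"
  using assms(1)
proof (induction n)
  case 0
  then show ?case using assms(2) by (simp add: Ckalpha_0 Ck_recip locally_holder_recip)
next
  case (Suc n)
  have "Ckalpha n \<alpha> (\<lambda>x. 1 / f x)" "Ckalpha n \<alpha> (deriv f)"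
    using Suc.IH[OF Ckalpha_SucD] Suc.prems by (simp_all add: Ckalpha_Suc)
  then show ?case
    unfolding Ckalpha_Suc deriv_inverse'(2)[OF Ckalpha_imp_Ck[OF Suc.prems] assms(2)]
    by (intro conjI allI deriv_inverse'(1)[OF Ckalpha_imp_Ck[OF Suc.prems] assms(2)] Ckalpha_mult Ckalpha_const)
qed

end

lemma inverse_has_deriv:
  fixes g v :: "real \<Rightarrow> real"
  assumes "Ck 1 g" "\<And>x. deriv g x \<noteq> 0" "\<And>x. g (v x) = x" "\<And>x. v (g x) = x"
  shows "(v has_real_derivative 1 / deriv g (v x)) (at x)"
proof -
  have cont: "isCont g x" for x
    using assms(1) by (intro DERIV_isCont[OF Ck_has_deriv'[of 1]]) auto
  have "isCont v (g (v x))"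
    by (rule isCont_inverse_function[of 1]) (use assms cont in auto)
  then have "isCont v x" by (simp add: assms(3))
  then have "(v has_real_derivative inverse (deriv g (v x))) (at x)"
    using assms
    by (intro DERIV_inverse_function[where f = g and a = "x - 1" and b = "x + 1"] Ck_has_deriv'[of 1]) auto
  then show ?thesis by (simp add: inverse_eq_divide)
qed

context modulus
begin

text \<open>Bootstrapping: the derivative of \<open>v\<close> is \<open>1 / deriv g (v x)\<close>,
  so each order of regularity of \<open>v\<close> yields the next one, up to that of
  \<open>g\<close>.\<close>

lemma Ckalpha_inverse_function:
  assumes g: "Ckalpha n \<alpha> g" "1 \<le> n" "\<And>x. deriv g x \<noteq> 0" and v: "\<And>x. g (v x) = x" "\<And>x. v (g x) = x"
  shows "Ckalpha n \<alpha> v"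
proof -
  have "Ck 1 g" using Ckalpha_imp_Ck[OF g(1)] g(2) by (rule Ck_mono)
  then have D: "(v has_real_derivative 1 / deriv g (v x)) (at x)" for x
    by (rule inverse_has_deriv[OF _ g(3) v])
  then have cont: "continuous_on UNIV v"
    by (intro continuous_at_imp_continuous_on ballI DERIV_isCont[OF D])
  have "Ck 0 (deriv g)" "Ck 0 v"
    using \<open>Ck 1 g\<close> cont by (auto simp: Ck_Suc Ck_0)
  then have "Ck 0 (\<lambda>x. 1 / deriv g (v x))"
    using g(3) by (intro Ck_recip Ck_compose[of 0 "deriv g" v])
  then have C1: "Ck 1 v"
    using Ck_Suc_intro[OF D, of 0] by simp
  have "Ckalpha m \<alpha> v" if "m \<le> n" for m
    using that
  proof (induction m)
    case 0
    then show ?case using C1 by (intro Ck_Suc_imp_Ckalpha) simp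
  next
    case (Suc m)
    have "Ckalpha m \<alpha> (deriv g)"
    proof -
      have "n = Suc (n - 1)" "m \<le> n - 1" using Suc.prems by simp_all
      then have "Ckalpha (n - 1) \<alpha> (deriv g)" using g(1) Ckalpha_Suc by metis
      then show ?thesis using \<open>m \<le> n - 1\<close> by (rule Ckalpha_mono)
    qed
    moreover have "Ckalpha m \<alpha> v" using Suc by simp
    ultimately have "Ckalpha m \<alpha> (\<lambda>x. deriv g (v x))"
      using C1 by (rule Ckalpha_compose)
    then have "Ckalpha m \<alpha> (\<lambda>x. 1 / deriv g (v x))"
      by (rule Ckalpha_recip) (rule g(3))
    moreover have "v differentiable at x" for x
      unfolding real_differentiable_def by (rule exI, rule D)
    ultimately show ?case
      unfolding Ckalpha_Suc deriv_eqI[OF D] by simp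
  qed
  then show ?thesis by simp
qed

end

subsection \<open>Quantitative estimates\<close>

context modulus
begin

definition holder_on :: "real \<Rightarrow> real set \<Rightarrow> (real \<Rightarrow> real) \<Rightarrow> bool" where
  "holder_on M S f \<longleftrightarrow> (\<forall>x\<in>S. \<forall>y\<in>S. \<bar>f x - f y\<bar> \<le> M * \<alpha> \<bar>x - y\<bar>)"

lemma holder_onI: "(\<And>x y. x \<in> S \<Longrightarrow> y \<in> S \<Longrightarrow> \<bar>f x - f y\<bar> \<le> M * \<alpha> \<bar>x - y\<bar>) \<Longrightarrow> holder_on M S f"
  by (simp add: holder_on_def)

lemma holder_onD: "holder_on M S f \<Longrightarrow> x \<in> S \<Longrightarrow> y \<in> S \<Longrightarrow> \<bar>f x - f y\<bar> \<le> M * \<alpha> \<bar>x - y\<bar>"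
  by (simp add: holder_on_def)

lemma holder_seminorm_le_iff_holder: "0 \<le> M \<Longrightarrow> holder_seminorm \<alpha> S f \<le> ennreal M \<longleftrightarrow> holder_on M S f"
  by (simp add: holder_seminorm_le_iff holder_on_def)

lemma holder_on_mono:
  assumes "holder_on M S f" "M \<le> M'"
  shows "holder_on M' S f"
proof (rule holder_onI)
  fix x y assume "x \<in> S" "y \<in> S"
  then have "\<bar>f x - f y\<bar> \<le> M * \<alpha> \<bar>x - y\<bar>" by (rule holder_onD[OF assms(1)])
  also have "\<dots> \<le> M' * \<alpha> \<bar>x - y\<bar>" by (intro mult_right_mono assms(2) alpha_nonneg) simp
  finally show "\<bar>f x - f y\<bar> \<le> M' * \<alpha> \<bar>x - y\<bar>" .
qed

lemma holder_on_add:
  assumes "holder_on M S f" "holder_on M' S g"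
  shows "holder_on (M + M') S (\<lambda>x. f x + g x)"
proof (rule holder_onI)
  fix x y assume "x \<in> S" "y \<in> S"
  then have "\<bar>f x - f y\<bar> \<le> M * \<alpha> \<bar>x - y\<bar>" "\<bar>g x - g y\<bar> \<le> M' * \<alpha> \<bar>x - y\<bar>"
    using assms by (simp_all add: holder_onD)
  then show "\<bar>f x + g x - (f y + g y)\<bar> \<le> (M + M') * \<alpha> \<bar>x - y\<bar>"
    unfolding distrib_right by linarith
qed

lemma holder_on_cmult:
  assumes "holder_on M S f"
  shows "holder_on (\<bar>a\<bar> * M) S (\<lambda>x. a * f x)"
proof (rule holder_onI)
  fix x y assume "x \<in> S" "y \<in> S"
  then have "\<bar>a\<bar> * \<bar>f x - f y\<bar> \<le> \<bar>a\<bar> * (M * \<alpha> \<bar>x - y\<bar>)"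
    by (intro mult_left_mono holder_onD[OF assms]) auto
  moreover have "\<bar>a * f x - a * f y\<bar> = \<bar>a\<bar> * \<bar>f x - f y\<bar>"
    by (simp only: abs_mult right_diff_distrib[symmetric])
  ultimately show "\<bar>a * f x - a * f y\<bar> \<le> \<bar>a\<bar> * M * \<alpha> \<bar>x - y\<bar>"
    by (simp only: mult.assoc)
qed

lemma holder_on_compose:
  assumes f: "holder_on M UNIV f" and M: "0 \<le> M" and L: "1 \<le> L" "\<And>x y. \<bar>t x - t y\<bar> \<le> L * \<bar>x - y\<bar>"
  shows "holder_on (L * M) UNIV (\<lambda>x. f (t x))"
proof (rule holder_onI)
  fix x y :: real
  have "\<bar>f (t x) - f (t y)\<bar> \<le> M * \<alpha> \<bar>t x - t y\<bar>" by (rule holder_onD[OF f]) auto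
  also have "\<dots> \<le> M * \<alpha> (L * \<bar>x - y\<bar>)"
    by (intro mult_left_mono alpha_mono M L(2)) auto
  also have "\<dots> \<le> M * (L * \<alpha> \<bar>x - y\<bar>)"
    using L(1) by (intro mult_left_mono alpha_scale M) auto
  finally show "\<bar>f (t x) - f (t y)\<bar> \<le> L * M * \<alpha> \<bar>x - y\<bar>" by (simp add: mult_ac)
qed

text \<open>A single constant for all orders is coarse but keeps the inductions short. The Hoelder
  constant of the top derivative is tracked separately where sharpness matters, in
  \<open>holder_on_compose_sharp\<close>.\<close>

primrec Ckalpha_bound :: "nat \<Rightarrow> real set \<Rightarrow> real \<Rightarrow> (real \<Rightarrow> real) \<Rightarrow> bool" where
  "Ckalpha_bound 0 S M f \<longleftrightarrow> (\<forall>x\<in>S. \<bar>f x\<bar> \<le> M) \<and> holder_on M S f"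
| "Ckalpha_bound (Suc n) S M f \<longleftrightarrow> (\<forall>x\<in>S. \<bar>f x\<bar> \<le> M) \<and> Ckalpha_bound n S M (deriv f)"

lemma Ckalpha_bound_iff:
  "Ckalpha_bound n S M f \<longleftrightarrow> (\<forall>i\<le>n. \<forall>x\<in>S. \<bar>(deriv ^^ i) f x\<bar> \<le> M) \<and> holder_on M S ((deriv ^^ n) f)"
proof (induction n arbitrary: f)
  case (Suc n)
  have "(\<forall>i\<le>Suc n. \<forall>x\<in>S. \<bar>(deriv ^^ i) f x\<bar> \<le> M) \<longleftrightarrow>
      (\<forall>x\<in>S. \<bar>f x\<bar> \<le> M) \<and> (\<forall>i\<le>n. \<forall>x\<in>S. \<bar>(deriv ^^ i) (deriv f) x\<bar> \<le> M)"
    unfolding less_Suc_eq_le[symmetric] All_less_Suc2 funpow_deriv_Suc by simp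
  then show ?case by (simp only: Ckalpha_bound.simps Suc.IH funpow_deriv_Suc conj_assoc)
qed simp

lemma Ckalpha_bound_abs_le: "Ckalpha_bound n S M f \<Longrightarrow> x \<in> S \<Longrightarrow> \<bar>f x\<bar> \<le> M"
  by (cases n) auto

lemma Ckalpha_bound_holder: "Ckalpha_bound n S M f \<Longrightarrow> holder_on M S ((deriv ^^ n) f)"
  by (simp add: Ckalpha_bound_iff)

lemma Ckalpha_bound_deriv_le: "Ckalpha_bound n S M f \<Longrightarrow> 1 \<le> n \<Longrightarrow> x \<in> S \<Longrightarrow> \<bar>deriv f x\<bar> \<le> M"
  unfolding Ckalpha_bound_iff by (metis funpow_0 funpow_deriv_Suc One_nat_def)

lemma Ckalpha_bound_mono: "Ckalpha_bound n S M f \<Longrightarrow> M \<le> M' \<Longrightarrow> Ckalpha_bound n S M' f"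
  unfolding Ckalpha_bound_iff by (meson holder_on_mono order_trans)

lemma Ckalpha_bound_add:
  "Ck n f \<Longrightarrow> Ck n g \<Longrightarrow> Ckalpha_bound n S M f \<Longrightarrow> Ckalpha_bound n S M' g \<Longrightarrow> Ckalpha_bound n S (M + M') (\<lambda>x. f x + g x)"
proof (induction n arbitrary: f g)
  case 0
  then show ?case by (auto intro!: holder_on_add order_trans[OF abs_triangle_ineq] add_mono)
next
  case (Suc n)
  have "Ckalpha_bound n S (M + M') (\<lambda>x. deriv f x + deriv g x)"
    using Suc.prems by (intro Suc.IH) (simp_all add: Ck_Suc)
  moreover have "\<forall>x\<in>S. \<bar>f x + g x\<bar> \<le> M + M'"
    using Suc.prems by (auto intro!: order_trans[OF abs_triangle_ineq] add_mono)
  ultimately show ?case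
    by (simp add: deriv_add'[OF Suc.prems(1,2)])
qed

lemma Ckalpha_bound_cmult:
  assumes "Ck n f" "Ckalpha_bound n S M f"
  shows "Ckalpha_bound n S (\<bar>a\<bar> * M) (\<lambda>x. a * f x)"
  unfolding Ckalpha_bound_iff
proof (intro conjI allI impI ballI)
  fix i x assume "i \<le> n" "x \<in> S"
  then show "\<bar>(deriv ^^ i) (\<lambda>x. a * f x) x\<bar> \<le> \<bar>a\<bar> * M"
    using assms(2) Ck_mono[OF assms(1) \<open>i \<le> n\<close>]
    by (auto simp: funpow_deriv_cmult abs_mult Ckalpha_bound_iff intro: mult_left_mono)
next
  show "holder_on (\<bar>a\<bar> * M) S ((deriv ^^ n) (\<lambda>x. a * f x))"
    using assms by (simp add: funpow_deriv_cmult holder_on_cmult Ckalpha_bound_holder)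
qed

text \<open>The loss in deducing a bound at order n from one at order n + 1. Any number at least
  \<open>2 / \<alpha> 1\<close> and 1 would serve.\<close>

definition slack :: real where
  "slack = 1 + 3 / \<alpha> 1"

lemma slack_ge_1: "1 \<le> slack"
  using alpha_pos[of 1] by (simp add: slack_def)

text \<open>Up to distance 1 the Lipschitz bound and \<open>le_alpha\<close> apply; beyond it the
  oscillation is at most \<open>2 * M\<close> while \<open>\<alpha>\<close> is at least
  \<open>\<alpha> 1\<close>.\<close>

lemma lipschitz_imp_holder_oner:
  assumes M: "0 \<le> M" and bd: "\<And>x. x \<in> S \<Longrightarrow> \<bar>f x\<bar> \<le> M"
    and lip: "\<And>x y. x \<in> S \<Longrightarrow> y \<in> S \<Longrightarrow> \<bar>f x - f y\<bar> \<le> M * \<bar>x - y\<bar>"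
  shows "holder_on (slack * M) S f"
proof (rule holder_onI)
  fix x y assume S: "x \<in> S" "y \<in> S"
  have a1: "0 < \<alpha> 1" by (simp add: alpha_pos)
  have "\<bar>f x - f y\<bar> \<le> 2 * M * (\<alpha> \<bar>x - y\<bar> / \<alpha> 1)"
  proof (cases "\<bar>x - y\<bar> \<le> 1")
    case True
    have "\<bar>f x - f y\<bar> \<le> M * \<bar>x - y\<bar>" using lip S by blast
    also have "\<dots> \<le> M * (\<alpha> \<bar>x - y\<bar> / \<alpha> 1)"
      using True by (intro mult_left_mono le_alpha M) auto
    also have "\<dots> \<le> 2 * M * (\<alpha> \<bar>x - y\<bar> / \<alpha> 1)"
      using M a1 alpha_nonneg[of "\<bar>x - y\<bar>"] by (intro mult_right_mono) auto
    finally show ?thesis .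
  next
    case False
    have "\<bar>f x - f y\<bar> \<le> 2 * M * 1" using bd[OF S(1)] bd[OF S(2)] by linarith
    also have "\<dots> \<le> 2 * M * (\<alpha> \<bar>x - y\<bar> / \<alpha> 1)"
      using False M a1 alpha_mono[of 1 "\<bar>x - y\<bar>"] by (intro mult_left_mono) auto
    finally show ?thesis .
  qed
  also have "\<dots> = 2 / \<alpha> 1 * (M * \<alpha> \<bar>x - y\<bar>)" by simp
  also have "\<dots> \<le> slack * (M * \<alpha> \<bar>x - y\<bar>)"
    using a1 M by (intro mult_right_mono mult_nonneg_nonneg alpha_nonneg) (auto simp: slack_def field_simps)
  finally show "\<bar>f x - f y\<bar> \<le> slack * M * \<alpha> \<bar>x - y\<bar>" by (simp add: mult.assoc)
qed

lemma deriv_bound_imp_lipschitz: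
  assumes "Ck 1 f" "convex S" "\<And>x. x \<in> S \<Longrightarrow> \<bar>deriv f x\<bar> \<le> M" "x \<in> S" "y \<in> S"
  shows "\<bar>f x - f y\<bar> \<le> M * \<bar>x - y\<bar>"
proof -
  have "norm (f x - f y) \<le> M * norm (x - y)"
  proof (rule field_differentiable_bound[of S f "deriv f"])
    show "(f has_field_derivative deriv f z) (at z within S)" for z
      using Ck_has_deriv'[OF assms(1), of z] by (simp add: has_field_derivative_at_within)
  qed (use assms in auto)
  then show ?thesis by simp
qed

lemma Ckalpha_bound_SucD:
  assumes "convex S" "0 \<le> M"
  shows "Ck (Suc n) f \<Longrightarrow> Ckalpha_bound (Suc n) S M f \<Longrightarrow> Ckalpha_bound n S (slack * M) f"
proof (induction n arbitrary: f)
  case 0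
  have le: "M \<le> slack * M" using slack_ge_1 mult_right_mono[OF slack_ge_1 assms(2)] by simp
  have "holder_on (slack * M) S f"
    using 0 by (intro lipschitz_imp_holder_oner assms deriv_bound_imp_lipschitz[of f S]) auto
  then show ?case using 0 le by force
next
  case (Suc n)
  have le: "M \<le> slack * M" using slack_ge_1 mult_right_mono[OF slack_ge_1 assms(2)] by simp
  have "Ckalpha_bound n S (slack * M) (deriv f)"
    using Suc.prems by (intro Suc.IH) (simp_all add: Ck_Suc)
  then show ?case using Suc.prems le by force
qed

lemma Ckalpha_bound_imp_holder_oner_on:
  assumes "convex S"
  shows "Ck n f \<Longrightarrow> 0 \<le> M \<Longrightarrow> Ckalpha_bound n S M f \<Longrightarrow> holder_on (slack ^ n * M) S f"
proof (induction n arbitrary: M)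
  case (Suc n)
  have "holder_on (slack ^ n * (slack * M)) S f"
    using Suc.prems slack_ge_1 by (intro Suc.IH[OF Ck_SucD] Ckalpha_bound_SucD assms) auto
  then show ?case by (simp add: mult_ac)
qed simp

text \<open>The recursion mirrors the product rule: two products, each with one factor moved down an
  order at the price of \<open>slack\<close>.\<close>

primrec product_const :: "nat \<Rightarrow> real" where
  "product_const 0 = 2"
| "product_const (Suc n) = 2 * slack * product_const n + 1"

lemma product_const_nonneg: "0 \<le> product_const n"
  using slack_ge_1 by (induction n) auto

lemma Ckalpha_bound_mult:
  assumes S: "convex S" and M: "0 \<le> M" "0 \<le> M'"
  shows "Ck n f \<Longrightarrow> Ck n g \<Longrightarrow> Ckalpha_bound n S M f \<Longrightarrow> Ckalpha_bound n S M' g \<Longrightarrow>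
    Ckalpha_bound n S (product_const n * (M * M')) (\<lambda>x. f x * g x)"
  using M
proof (induction n arbitrary: f g M M')
  case 0
  have le: "\<bar>f x * g x\<bar> \<le> M * M'" if "x \<in> S" for x
    unfolding abs_mult using 0 that by (intro mult_mono) auto
  have "holder_on (2 * (M * M')) S (\<lambda>x. f x * g x)"
  proof (rule holder_onI)
    fix x y assume xy: "x \<in> S" "y \<in> S"
    have "\<bar>f x * g x - f y * g y\<bar> = \<bar>f x * (g x - g y) + (f x - f y) * g y\<bar>"
      by (simp add: algebra_simps)
    also have "\<dots> \<le> \<bar>f x\<bar> * \<bar>g x - g y\<bar> + \<bar>f x - f y\<bar> * \<bar>g y\<bar>"
      by (metis abs_mult abs_triangle_ineq)
    also have "\<dots> \<le> M * (M' * \<alpha> \<bar>x - y\<bar>) + (M * \<alpha> \<bar>x - y\<bar>) * M'"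
    proof (intro add_mono mult_mono)
      show "\<bar>g x - g y\<bar> \<le> M' * \<alpha> \<bar>x - y\<bar>" "\<bar>f x - f y\<bar> \<le> M * \<alpha> \<bar>x - y\<bar>"
        using 0 xy by (auto intro: holder_onD)
    qed (use 0 xy alpha_nonneg[of "\<bar>x - y\<bar>"] in auto)
    finally show "\<bar>f x * g x - f y * g y\<bar> \<le> 2 * (M * M') * \<alpha> \<bar>x - y\<bar>" by (simp add: mult_ac)
  qed
  moreover have "M * M' \<le> 2 * (M * M')" using mult_nonneg_nonneg[OF 0(5,6)] by linarith
  ultimately show ?case using order_trans[OF le] by simp
next
  case (Suc n)
  have Ck: "Ck n f" "Ck n g" "Ck n (deriv f)" "Ck n (deriv g)"
    using Suc.prems by (auto simp: Ck_SucD Ck_Suc[of n])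
  have "\<bar>f x * g x\<bar> \<le> product_const (Suc n) * (M * M')" if "x \<in> S" for x
  proof -
    have "\<bar>f x * g x\<bar> \<le> 1 * (M * M')"
      unfolding abs_mult mult_1 using Suc.prems that by (intro mult_mono) auto
    also have "\<dots> \<le> product_const (Suc n) * (M * M')"
      using Suc.prems slack_ge_1 product_const_nonneg[of n] by (intro mult_right_mono) auto
    finally show ?thesis .
  qed
  moreover
  have "Ckalpha_bound n S (product_const n * (M * (slack * M'))) (\<lambda>x. deriv f x * g x)"
    using Suc.prems Ck slack_ge_1 by (intro Suc.IH Ckalpha_bound_SucD S) auto
  moreover have "Ckalpha_bound n S (product_const n * ((slack * M) * M')) (\<lambda>x. f x * deriv g x)"
    using Suc.prems Ck slack_ge_1 by (intro Suc.IH Ckalpha_bound_SucD S) auto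
  ultimately have "Ckalpha_bound n S (product_const n * (M * (slack * M')) + product_const n * ((slack * M) * M'))
      (deriv (\<lambda>x. f x * g x))"
    unfolding deriv_mult'[OF Suc.prems(1,2)] using Ck by (intro Ckalpha_bound_add Ck_mult) auto
  moreover have "product_const n * (M * (slack * M')) + product_const n * ((slack * M) * M') \<le> product_const (Suc n) * (M * M')"
    using Suc.prems by (simp add: algebra_simps)
  ultimately have "Ckalpha_bound n S (product_const (Suc n) * (M * M')) (deriv (\<lambda>x. f x * g x))"
    by (rule Ckalpha_bound_mono)
  then show ?case using \<open>\<And>x. x \<in> S \<Longrightarrow> \<bar>f x * g x\<bar> \<le> product_const (Suc n) * (M * M')\<close>
    by (simp only: Ckalpha_bound.simps) blast
qed

lemma perturbation_lipschitz:
  assumes "Ck 1 h" "\<And>x. \<bar>deriv h x\<bar> \<le> L"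
  shows "\<bar>(x + h x) - (y + h y)\<bar> \<le> (1 + L) * \<bar>x - y\<bar>"
proof -
  have "\<bar>h x - h y\<bar> \<le> L * \<bar>x - y\<bar>"
    using assms by (intro deriv_bound_imp_lipschitz[of h UNIV]) auto
  moreover have "(1 + L) * \<bar>x - y\<bar> = \<bar>x - y\<bar> + L * \<bar>x - y\<bar>" by (simp add: distrib_right)
  ultimately show ?thesis by linarith
qed

primrec compose_const :: "nat \<Rightarrow> real \<Rightarrow> real" where
  "compose_const 0 B = 1 + B"
| "compose_const (Suc n) B = 1 + compose_const n (slack * B) + product_const n * (compose_const n (slack * B) * B)"

lemma compose_const_nonneg: "0 \<le> B \<Longrightarrow> 0 \<le> compose_const n B"
  using slack_ge_1 product_const_nonneg by (induction n arbitrary: B) auto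

lemma deriv_compose_perturbation:
  assumes "Ck (Suc n) f" "Ck (Suc n) h"
  shows "deriv (\<lambda>x. f (x + h x)) = (\<lambda>x. deriv f (x + h x) + deriv f (x + h x) * deriv h x)"
proof -
  have "Ck (Suc n) (\<lambda>x. x + h x)" using assms by (intro Ck_add) auto
  then show ?thesis
    using deriv_comp'[OF assms(1), of "\<lambda>x. x + h x"] deriv_add'[of n "\<lambda>x. x" h] assms
    by (simp add: distrib_left)
qed

lemma Ck_compose_perturbation: "Ck n f \<Longrightarrow> Ck n h \<Longrightarrow> Ck n (\<lambda>x. f (x + h x))"
  by (rule Ck_compose[of n f "\<lambda>x. x + h x"]) (auto intro: Ck_add)

text \<open>Induction along (f o (id + h))' = f' o (id + h) + (f' o (id + h)) h'. The bound is
  linear in the size of \<open>f\<close>, but with a factor that would compound under repeated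
  composition.\<close>

lemma Ckalpha_bound_compose:
  "Ck n f \<Longrightarrow> Ck n h \<Longrightarrow> Ck 1 h \<Longrightarrow> (\<And>x. \<bar>deriv h x\<bar> \<le> B) \<Longrightarrow> Ckalpha_bound n UNIV B h \<Longrightarrow>
    Ckalpha_bound n UNIV M f \<Longrightarrow> 0 \<le> M \<Longrightarrow> 0 \<le> B \<Longrightarrow> Ckalpha_bound n UNIV (compose_const n B * M) (\<lambda>x. f (x + h x))"
proof (induction n arbitrary: f B)
  case 0
  have "holder_on ((1 + B) * M) UNIV (\<lambda>x. f (x + h x))"
    using 0 by (intro holder_on_compose perturbation_lipschitz) auto
  moreover have "M \<le> (1 + B) * M" using 0 by (simp add: distrib_right)
  moreover have "\<bar>f x\<bar> \<le> M" for x using 0 by auto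
  ultimately show ?case by (auto intro: order_trans)
next
  case (Suc n)
  let ?c = "compose_const n (slack * B)"
  have c: "0 \<le> ?c" using Suc.prems slack_ge_1 by (intro compose_const_nonneg) auto
  have "B \<le> slack * B" using mult_right_mono[OF slack_ge_1 Suc.prems(8)] by simp
  then have dh: "\<bar>deriv h x\<bar> \<le> slack * B" for x using Suc.prems(4) order_trans by blast
  have Ck: "Ck n (deriv f)" "Ck n h" "Ck n (deriv h)"
    using Suc.prems by (auto simp: Ck_SucD Ck_Suc[of n])
  have 1: "Ckalpha_bound n UNIV (?c * M) (\<lambda>x. deriv f (x + h x))"
    using Suc.prems Ck dh slack_ge_1 by (intro Suc.IH Ckalpha_bound_SucD) auto
  have Ck1: "Ck n (\<lambda>x. deriv f (x + h x))" using Ck by (intro Ck_compose_perturbation)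
  have 2: "Ckalpha_bound n UNIV (product_const n * ((?c * M) * B)) (\<lambda>x. deriv f (x + h x) * deriv h x)"
    using Suc.prems c Ck Ck1 by (intro Ckalpha_bound_mult 1) auto
  have "Ckalpha_bound n UNIV (?c * M + product_const n * ((?c * M) * B)) (deriv (\<lambda>x. f (x + h x)))"
    unfolding deriv_compose_perturbation[OF Suc.prems(1,2)] using Ck Ck1
    by (intro Ckalpha_bound_add 1 2 Ck_mult)
  moreover have "?c * M + product_const n * ((?c * M) * B) \<le> compose_const (Suc n) B * M"
    using Suc.prems by (simp add: algebra_simps)
  ultimately have "Ckalpha_bound n UNIV (compose_const (Suc n) B * M) (deriv (\<lambda>x. f (x + h x)))"
    by (rule Ckalpha_bound_mono)
  moreover have "\<bar>f x\<bar> \<le> compose_const (Suc n) B * M" for x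
  proof -
    have "\<bar>f x\<bar> \<le> 1 * M" using Suc.prems by auto
    also have "\<dots> \<le> compose_const (Suc n) B * M"
      using Suc.prems c product_const_nonneg[of n] by (intro mult_right_mono) auto
    finally show ?thesis .
  qed
  ultimately show ?case by (simp only: Ckalpha_bound.simps) blast
qed

primrec compose_defect :: "nat \<Rightarrow> real \<Rightarrow> real" where
  "compose_defect 0 B = 0"
| "compose_defect (Suc n) B = slack * compose_defect n (slack * B) + product_const n * compose_const n (slack * B)"

lemma compose_defect_nonneg: "0 \<le> B \<Longrightarrow> 0 \<le> compose_defect n B"
  using slack_ge_1 product_const_nonneg compose_const_nonneg by (induction n arbitrary: B) auto

text \<open>The Hoelder constant \<open>e\<close> of the top derivative is multiplied by 1 + L only;
  everything else contains a product of the sizes of \<open>f\<close> and \<open>h\<close> and is of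
  second order. For this reason the seminorm of a long composition grows linearly and not
  exponentially with the number of factors.\<close>

lemma holder_on_compose_sharp:
  "Ck n f \<Longrightarrow> Ck n h \<Longrightarrow> Ck 1 h \<Longrightarrow> (\<And>x. \<bar>deriv h x\<bar> \<le> L) \<Longrightarrow> 0 \<le> L \<Longrightarrow> L \<le> b \<Longrightarrow> b \<le> B \<Longrightarrow>
    Ckalpha_bound n UNIV b h \<Longrightarrow> Ckalpha_bound n UNIV M f \<Longrightarrow> holder_on e UNIV ((deriv ^^ n) f) \<Longrightarrow> 0 \<le> M \<Longrightarrow> 0 \<le> e \<Longrightarrow>
    holder_on ((1 + L) * e + compose_defect n B * (M * b)) UNIV ((deriv ^^ n) (\<lambda>x. f (x + h x)))"
proof (induction n arbitrary: f b B)
  case 0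
  then show ?case using holder_on_compose[of e f "1 + L" "\<lambda>x. x + h x"] perturbation_lipschitz[of h L] by simp
next
  case (Suc n)
  have b: "0 \<le> b" "0 \<le> B" using Suc.prems by auto
  let ?c = "compose_const n (slack * B)"
  have sb: "b \<le> slack * b" "slack * b \<le> slack * B" "0 \<le> slack * B" "0 \<le> slack * b"
    using mult_right_mono[OF slack_ge_1 b(1)] slack_ge_1 b Suc.prems by auto
  have c: "0 \<le> ?c" using sb by (intro compose_const_nonneg) auto
  have Ck: "Ck n (deriv f)" "Ck n h" "Ck n (deriv h)"
    using Suc.prems by (auto simp: Ck_SucD Ck_Suc[of n])
  have h: "Ckalpha_bound n UNIV (slack * b) h" using Suc.prems b by (intro Ckalpha_bound_SucD) auto
  have f': "Ckalpha_bound n UNIV M (deriv f)" using Suc.prems by simp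
  have 1: "holder_on ((1 + L) * e + compose_defect n (slack * B) * (M * (slack * b))) UNIV
      ((deriv ^^ n) (\<lambda>x. deriv f (x + h x)))"
  proof (rule Suc.IH)
    show "holder_on e UNIV ((deriv ^^ n) (deriv f))" using Suc.prems(10) by (simp only: funpow_deriv_Suc)
    show "L \<le> slack * b" using Suc.prems(6) sb(1) by (rule order_trans)
  qed (use Suc.prems Ck h f' sb in auto)
  have dh: "\<bar>deriv h x\<bar> \<le> slack * B" for x
    using Suc.prems(4)[of x] Suc.prems(6) sb(1,2) by linarith
  have "Ckalpha_bound n UNIV (?c * M) (\<lambda>x. deriv f (x + h x))"
    using Ckalpha_bound_mono[OF h sb(2)] f' sb(3) Suc.prems(3,11) Ck dh by (intro Ckalpha_bound_compose) auto
  moreover have Ck1: "Ck n (\<lambda>x. deriv f (x + h x))" using Ck by (intro Ck_compose_perturbation)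
  ultimately have "Ckalpha_bound n UNIV (product_const n * ((?c * M) * b)) (\<lambda>x. deriv f (x + h x) * deriv h x)"
    using Suc.prems c b Ck by (intro Ckalpha_bound_mult) auto
  then have 2: "holder_on (product_const n * ((?c * M) * b)) UNIV ((deriv ^^ n) (\<lambda>x. deriv f (x + h x) * deriv h x))"
    by (rule Ckalpha_bound_holder)
  have "(deriv ^^ Suc n) (\<lambda>x. f (x + h x)) = (\<lambda>x. (deriv ^^ n) (\<lambda>x. deriv f (x + h x)) x
      + (deriv ^^ n) (\<lambda>x. deriv f (x + h x) * deriv h x) x)"
    unfolding funpow_deriv_Suc deriv_compose_perturbation[OF Suc.prems(1,2)]
    by (rule funpow_deriv_add[OF Ck1 Ck_mult[OF Ck1 Ck(3)]])
  with holder_on_add[OF 1 2]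
  have "holder_on ((1 + L) * e + compose_defect n (slack * B) * (M * (slack * b)) + product_const n * ((?c * M) * b)) UNIV
      ((deriv ^^ Suc n) (\<lambda>x. f (x + h x)))"
    by simp
  then show ?case by (simp add: algebra_simps)
qed

end

section \<open>Estimates for reciprocals and for inverses of perturbations of the identity\<close>

context modulus
begin

primrec recip_const :: "nat \<Rightarrow> real \<Rightarrow> real" where
  "recip_const 0 B = 4"
| "recip_const (Suc n) B = 4 + product_const n * (1 + (2 * (recip_const n (slack * B) * (slack * B))
      + product_const n * ((recip_const n (slack * B) * (slack * B)) * (recip_const n (slack * B) * (slack * B)))))"

lemma recip_const_nonneg: "0 \<le> B \<Longrightarrow> 0 \<le> recip_const n B"
proof (induction n arbitrary: B)
  case (Suc n)
  have "0 \<le> slack * B" using Suc.prems slack_ge_1 by simp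
  then show ?case using Suc.IH[of "slack * B"] product_const_nonneg[of n] by simp
qed simp

lemma Ck_div_one_plus:
  assumes "Ck n w" "\<And>x. \<bar>w x\<bar> \<le> 1 / 2"
  shows "Ck n (\<lambda>x. w x * (1 / (1 + w x)))"
proof (intro Ck_mult Ck_recip Ck_add Ck_const assms(1))
  show "1 + w x \<noteq> 0" for x using assms(2)[of x] by auto
qed

text \<open>The quotient w / (1 + w) is estimated in place of 1 / (1 + w) because it is small with
  \<open>w\<close>: the bound has to be linear in \<open>b\<close>.\<close>

lemma Ckalpha_bound_div_one_plus:
  "Ck n w \<Longrightarrow> (\<And>x. \<bar>w x\<bar> \<le> 1 / 2) \<Longrightarrow> 0 \<le> b \<Longrightarrow> b \<le> B \<Longrightarrow> Ckalpha_bound n UNIV b w \<Longrightarrow>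
    Ckalpha_bound n UNIV (recip_const n B * b) (\<lambda>x. w x * (1 / (1 + w x)))"
proof (induction n arbitrary: b B)
  case (0 b B)
  have low: "1 / 2 \<le> 1 + w x" for x using 0(2)[of x] by auto
  have "\<bar>w x * (1 / (1 + w x))\<bar> \<le> 4 * b" for x
  proof -
    have "\<bar>w x * (1 / (1 + w x))\<bar> = \<bar>w x\<bar> / (1 + w x)" using low[of x] by (simp add: abs_mult)
    also have "\<dots> \<le> b / (1 / 2)" using 0 low[of x] by (intro frac_le) auto
    finally show ?thesis using 0 by simp
  qed
  moreover have "holder_on (4 * b) UNIV (\<lambda>x. w x * (1 / (1 + w x)))"
  proof (rule holder_onI)
    fix x y :: real
    have "w x * (1 / (1 + w x)) - w y * (1 / (1 + w y)) = (w x - w y) / ((1 + w x) * (1 + w y))"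
      using low[of x] low[of y] by (simp add: field_simps)
    then have "\<bar>w x * (1 / (1 + w x)) - w y * (1 / (1 + w y))\<bar> = \<bar>w x - w y\<bar> / ((1 + w x) * (1 + w y))"
      using low[of x] low[of y] by (simp add: abs_mult)
    also have "\<dots> \<le> (b * \<alpha> \<bar>x - y\<bar>) / (1 / 2 * (1 / 2))"
    proof (rule frac_le)
      show "\<bar>w x - w y\<bar> \<le> b * \<alpha> \<bar>x - y\<bar>" using 0 by (auto intro: holder_onD)
      show "1 / 2 * (1 / 2) \<le> (1 + w x) * (1 + w y)" using low[of x] low[of y] by (intro mult_mono) auto
    qed (use 0 in \<open>auto intro!: alpha_nonneg mult_nonneg_nonneg\<close>)
    finally show "\<bar>w x * (1 / (1 + w x)) - w y * (1 / (1 + w y))\<bar> \<le> 4 * b * \<alpha> \<bar>x - y\<bar>" by simp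
  qed
  ultimately show ?case by simp
next
  case (Suc n b B)
  let ?q = "\<lambda>x. w x * (1 / (1 + w x))"
  define b1 where "b1 = recip_const n (slack * B) * (slack * B)"
  have B: "0 \<le> B" "0 \<le> slack * B" "0 \<le> slack * b" "slack * b \<le> slack * B"
    using Suc.prems(3,4) slack_ge_1 by auto
  have b1: "0 \<le> b1" unfolding b1_def using B recip_const_nonneg[of "slack * B" n] by simp
  have low: "1 / 2 \<le> 1 + w x" for x using Suc.prems(2)[of x] by auto
  have Ck: "Ck n w" "Ck n (deriv w)" using Suc.prems(1) by (auto simp: Ck_SucD Ck_Suc[of n])
  have Ckq: "Ck n ?q" by (intro Ck_div_one_plus Ck Suc.prems(2))
  have "Ckalpha_bound n UNIV (recip_const n (slack * B) * (slack * b)) ?q"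
    using Suc.prems B Ck by (intro Suc.IH Ckalpha_bound_SucD) auto
  then have q: "Ckalpha_bound n UNIV b1 ?q"
    by (rule Ckalpha_bound_mono) (unfold b1_def, intro mult_left_mono B recip_const_nonneg)
  have one: "Ckalpha_bound n UNIV 1 (\<lambda>x. 1)"
    by (auto simp: Ckalpha_bound_iff funpow_deriv_const holder_on_def intro: alpha_nonneg)
  have 2: "Ckalpha_bound n UNIV (2 * b1) (\<lambda>x. - 2 * ?q x)"
    using Ckalpha_bound_cmult[OF Ckq q, of "- 2"] by simp
  have 3: "Ckalpha_bound n UNIV (product_const n * (b1 * b1)) (\<lambda>x. ?q x * ?q x)"
    by (rule Ckalpha_bound_mult[OF _ b1 b1 Ckq Ckq q q]) simp
  let ?R = "1 + (2 * b1 + product_const n * (b1 * b1))"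
  \<comment> \<open>\<open>?r\<close> is the square of 1 - q, that is 1 / (1 + w)^2, written as a
    polynomial in the quotient q so that the bound on q from the induction hypothesis
    applies.\<close>
  let ?r = "\<lambda>x. 1 + (- 2 * ?q x + ?q x * ?q x)"
  have R: "Ckalpha_bound n UNIV ?R ?r"
    by (rule Ckalpha_bound_add[OF _ _ one Ckalpha_bound_add[OF _ _ 2 3]]) (intro Ck_add Ck_mult[OF Ck_const] Ck_mult[OF Ckq Ckq] Ckq Ck_const)+
  have Ckr: "Ck n ?r" by (intro Ck_add Ck_mult[OF Ck_const] Ck_mult[OF Ckq Ckq] Ckq Ck_const)
  have A: "Ckalpha_bound n UNIV (product_const n * (b * ?R)) (\<lambda>x. deriv w x * ?r x)"
    using Suc.prems(5) b1 product_const_nonneg[of n] by (intro Ckalpha_bound_mult[OF _ Suc.prems(3) _ Ck(2) Ckr _ R]) auto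
  have dq: "deriv ?q = (\<lambda>x. deriv w x * ?r x)"
  proof (rule deriv_eqI)
    fix x
    have "(?q has_real_derivative deriv w x * (1 / (1 + w x)) + w x * (- (deriv w x) / ((1 + w x) * (1 + w x)))) (at x)"
    proof -
      have nz: "1 + w x \<noteq> 0" using low[of x] by auto
      have "((\<lambda>x. 1 / (1 + w x)) has_real_derivative - deriv w x / ((1 + w x) * (1 + w x))) (at x)"
        using nz by (auto intro!: derivative_eq_intros Ck_has_deriv[OF Suc.prems(1)])
      from DERIV_mult[OF Ck_has_deriv[OF Suc.prems(1)] this] show ?thesis
        by (simp add: mult.commute add.commute)
    qed
    moreover have "deriv w x * (1 / (1 + w x)) + w x * (- (deriv w x) / ((1 + w x) * (1 + w x))) = deriv w x * ?r x"
    proof -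
      define s where "s = 1 / (1 + w x)"
      have s: "w x * s = 1 - s" using low[of x] by (simp add: s_def field_simps)
      have "deriv w x * s + w x * (- (deriv w x) * (s * s)) = deriv w x * (s - (w x * s) * s)"
        by (simp add: algebra_simps)
      also have "\<dots> = deriv w x * (1 + (- 2 * (w x * s) + (w x * s) * (w x * s)))"
        unfolding s by (simp add: algebra_simps)
      finally show ?thesis by (simp add: s_def)
    qed
    ultimately show "(?q has_real_derivative deriv w x * ?r x) (at x)" by simp
  qed
  have le: "product_const n * (b * ?R) \<le> recip_const (Suc n) B * b"
    using Suc.prems(3) unfolding b1_def by (simp add: algebra_simps)
  have "Ckalpha_bound n UNIV (recip_const (Suc n) B * b) (deriv ?q)"
    unfolding dq by (rule Ckalpha_bound_mono[OF A le])
  moreover have "\<bar>?q x\<bar> \<le> recip_const (Suc n) B * b" for x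
  proof -
    have "\<bar>?q x\<bar> = \<bar>w x\<bar> / (1 + w x)" using low[of x] by (simp add: abs_mult)
    also have "\<dots> \<le> b / (1 / 2)" using Suc.prems(3,5) low[of x] by (intro frac_le) auto
    also have "\<dots> \<le> 4 * b" using Suc.prems(3) by simp
    also have "\<dots> \<le> recip_const (Suc n) B * b"
      using Suc.prems(3) b1 product_const_nonneg[of n] unfolding recip_const.simps b1_def[symmetric]
      by (intro mult_right_mono) auto
    finally show ?thesis .
  qed
  ultimately show ?case by (simp only: Ckalpha_bound.simps) blast
qed

end

lemma inverse_perturbation_deriv:
  assumes f: "Ck 1 f" "\<And>x. \<bar>deriv f x\<bar> \<le> 1 / 2" and v: "\<And>x. v x + f (v x) = x" "\<And>x. v (x + f x) = x"
  shows "((\<lambda>x. v x - x) has_real_derivative - (deriv f (v x) * (1 / (1 + deriv f (v x))))) (at x)"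
proof -
  have d: "deriv (\<lambda>x. x + f x) = (\<lambda>x. 1 + deriv f x)"
    using deriv_add'[of 0 "\<lambda>x. x" f] f(1) by simp
  have nz: "1 + deriv f x \<noteq> 0" for x using f(2)[of x] by auto
  have "(v has_real_derivative 1 / deriv (\<lambda>x. x + f x) (v x)) (at x)"
  proof (rule inverse_has_deriv)
    show "Ck 1 (\<lambda>x. x + f x)" by (intro Ck_add f(1) Ck_ident)
  qed (use v nz d in auto)
  then have "((\<lambda>x. v x - x) has_real_derivative 1 / (1 + deriv f (v x)) - 1) (at x)"
    unfolding d by (intro derivative_intros)
  moreover have "1 / (1 + deriv f (v x)) - 1 = - (deriv f (v x) * (1 / (1 + deriv f (v x))))"
    using nz[of "v x"] by (simp add: field_simps)
  ultimately show ?thesis by simp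
qed

lemma inverse_perturbation_lipschitz:
  assumes f: "Ck 1 f" "\<And>x. \<bar>deriv f x\<bar> \<le> 1 / 2" and v: "\<And>x. v x + f (v x) = x"
  shows "\<bar>v x - v y\<bar> \<le> 2 * \<bar>x - y\<bar>"
proof -
  have "\<bar>f (v x) - f (v y)\<bar> \<le> 1 / 2 * \<bar>v x - v y\<bar>"
  proof -
    have "norm (f (v x) - f (v y)) \<le> 1 / 2 * norm (v x - v y)"
    proof (rule field_differentiable_bound[of UNIV f "deriv f"])
      show "(f has_field_derivative deriv f z) (at z within UNIV)" for z
        using Ck_has_deriv'[OF f(1), of z] by simp
    qed (use f in auto)
    then show ?thesis by simp
  qed
  moreover have "v x - v y = (x - y) - (f (v x) - f (v y))" using v[of x] v[of y] by linarith
  then have "\<bar>v x - v y\<bar> \<le> \<bar>x - y\<bar> + \<bar>f (v x) - f (v y)\<bar>" by (simp only: abs_triangle_ineq4)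
  ultimately have "\<bar>v x - v y\<bar> \<le> \<bar>x - y\<bar> + 1 / 2 * \<bar>v x - v y\<bar>" by (meson add_left_mono order_trans)
  then show ?thesis by simp
qed

context modulus
begin

text \<open>Lowering the order by one multiplies a bound by \<open>slack\<close>; the division makes
  the smallness hypothesis survive that step.\<close>

primrec inverse_radius :: "nat \<Rightarrow> real" where
  "inverse_radius 0 = 1"
| "inverse_radius (Suc n) = inverse_radius n / slack"

primrec inverse_const :: "nat \<Rightarrow> real" where
  "inverse_const 0 = 2"
| "inverse_const (Suc n) = 1 + recip_const n (compose_const n (inverse_const n * inverse_radius n + 1) * inverse_radius (Suc n))
      * compose_const n (inverse_const n * inverse_radius n + 1)"

lemma inverse_radius_pos: "0 < inverse_radius n"
  using slack_ge_1 by (induction n) auto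

lemma inverse_const_ge_1: "1 \<le> inverse_const n"
proof (induction n)
  case (Suc n)
  have "0 \<le> inverse_const n * inverse_radius n + 1" using Suc inverse_radius_pos[of n] by simp
  then have "0 \<le> compose_const n (inverse_const n * inverse_radius n + 1)" by (rule compose_const_nonneg)
  moreover have "0 \<le> inverse_radius (Suc n)" using inverse_radius_pos[of "Suc n"] by linarith
  ultimately have "0 \<le> recip_const n (compose_const n (inverse_const n * inverse_radius n + 1) * inverse_radius (Suc n))
      * compose_const n (inverse_const n * inverse_radius n + 1)"
    by (intro mult_nonneg_nonneg recip_const_nonneg)
  then show ?case unfolding inverse_const.simps by linarith
qed simp

text \<open>The derivative of v - id is -w / (1 + w) with w = f' o (id + (v - id)). So the bound on
  v - id at one order controls w, and thereby v - id at the next order.\<close>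

lemma Ckalpha_bound_inverse:
  assumes f1: "Ck 1 f" "\<And>x. \<bar>deriv f x\<bar> \<le> 1 / 2" and v: "\<And>x. v x + f (v x) = x" "\<And>x. v (x + f x) = x"
  shows "Ck n f \<Longrightarrow> Ck n v \<Longrightarrow> 0 \<le> d \<Longrightarrow> d \<le> inverse_radius n \<Longrightarrow> Ckalpha_bound n UNIV d f \<Longrightarrow>
    Ckalpha_bound n UNIV (inverse_const n * d) (\<lambda>x. v x - x)"
proof (induction n arbitrary: d)
  case (0 d)
  have h: "v x - x = - f (v x)" for x using v(1)[of x] by simp
  have "holder_on (2 * d) UNIV (\<lambda>x. f (v x))"
    using 0 inverse_perturbation_lipschitz[OF f1 v(1)] by (intro holder_on_compose) auto
  then have "holder_on (2 * d) UNIV (\<lambda>x. - f (v x))" using holder_on_cmult[of "2 * d" UNIV "\<lambda>x. f (v x)" "- 1"] by simp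
  moreover have "\<bar>f x\<bar> \<le> 2 * d" for x
  proof -
    have "\<bar>f x\<bar> \<le> d" using 0 by simp
    then show ?thesis using 0(3) by linarith
  qed
  ultimately show ?case by (simp add: h)
next
  case (Suc n d)
  \<comment> \<open>\<open>B\<close> has to dominate v - id at order n, which is at most
    \<open>inverse_const n * inverse_radius n\<close>, as well as its derivative, which is at most
    1.\<close>
  define B where "B = inverse_const n * inverse_radius n + 1"
  define c where "c = compose_const n B"
  have B: "0 \<le> B" "1 \<le> B" using inverse_const_ge_1[of n] inverse_radius_pos[of n] by (auto simp: B_def)
  have c: "0 \<le> c" unfolding c_def using B by (intro compose_const_nonneg)
  let ?h = "\<lambda>x. v x - x" and ?w = "\<lambda>x. deriv f (v x)"
  have Ck: "Ck n f" "Ck n (deriv f)" "Ck n v" using Suc.prems(1,2) by (auto simp: Ck_SucD Ck_Suc[of n])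
  have sd: "0 \<le> slack * d" "slack * d \<le> inverse_radius n"
    using Suc.prems(3,4) slack_ge_1 by (auto simp: field_simps)
  have "Ckalpha_bound n UNIV (inverse_const n * (slack * d)) ?h"
    using Suc.prems Ck sd by (intro Suc.IH Ckalpha_bound_SucD) auto
  moreover have "inverse_const n * (slack * d) \<le> B"
    using mult_left_mono[OF sd(2), of "inverse_const n"] inverse_const_ge_1[of n] unfolding B_def by linarith
  ultimately have h: "Ckalpha_bound n UNIV B ?h" by (rule Ckalpha_bound_mono)
  have dh: "deriv ?h = (\<lambda>x. - 1 * (?w x * (1 / (1 + ?w x))))"
    by (rule deriv_eqI) (use inverse_perturbation_deriv[OF f1 v] in simp)
  have wle: "\<bar>?w x\<bar> \<le> 1 / 2" for x by (rule f1)
  have dh1: "\<bar>deriv ?h x\<bar> \<le> B" for x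
  proof -
    have low: "1 / 2 \<le> 1 + ?w x" using wle[of x] by auto
    have "\<bar>deriv ?h x\<bar> = \<bar>?w x\<bar> / (1 + ?w x)" using low unfolding dh by (simp add: abs_mult)
    also have "\<dots> \<le> (1 / 2) / (1 / 2)" using low wle[of x] by (intro frac_le) auto
    finally show ?thesis using B by simp
  qed
  have "Ck (Suc n) ?h" by (intro Ck_diff Suc.prems(2) Ck_ident)
  then have Ckh: "Ck n ?h" "Ck 1 ?h" by (auto intro: Ck_mono)
  have "Ckalpha_bound n UNIV (c * d) (\<lambda>x. deriv f (x + ?h x))"
    unfolding c_def using Suc.prems(3,5) by (intro Ckalpha_bound_compose Ck Ckh dh1 h B) auto
  then have w: "Ckalpha_bound n UNIV (c * d) ?w" by simp
  have Ckw: "Ck n ?w" by (rule Ck_compose[OF Ck(2,3)])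
  have "Ckalpha_bound n UNIV (recip_const n (c * inverse_radius (Suc n)) * (c * d)) (\<lambda>x. ?w x * (1 / (1 + ?w x)))"
    using Suc.prems(3,4) c by (intro Ckalpha_bound_div_one_plus Ckw wle w mult_left_mono mult_nonneg_nonneg) auto
  from Ckalpha_bound_cmult[OF Ck_div_one_plus[OF Ckw wle] this, of "- 1"]
  have 1: "Ckalpha_bound n UNIV (recip_const n (c * inverse_radius (Suc n)) * (c * d)) (deriv ?h)"
    unfolding dh by simp
  have rc: "0 \<le> recip_const n (c * inverse_radius (Suc n))"
    by (intro recip_const_nonneg mult_nonneg_nonneg c less_imp_le[OF inverse_radius_pos])
  have IC: "inverse_const (Suc n) * d = d + recip_const n (c * inverse_radius (Suc n)) * (c * d)"
    by (simp add: c_def B_def algebra_simps)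
  have "Ckalpha_bound n UNIV (inverse_const (Suc n) * d) (deriv ?h)"
    unfolding IC by (rule Ckalpha_bound_mono[OF 1]) (simp add: Suc.prems(3))
  moreover have "\<bar>?h x\<bar> \<le> inverse_const (Suc n) * d" for x
  proof -
    have "\<bar>f (v x)\<bar> \<le> d" using Suc.prems(5) by simp
    moreover have "?h x = - f (v x)" using v(1)[of x] by simp
    moreover have "0 \<le> recip_const n (c * inverse_radius (Suc n)) * (c * d)" using rc c Suc.prems(3) by simp
    ultimately show ?thesis unfolding IC by simp
  qed
  ultimately show ?case by (simp only: Ckalpha_bound.simps) blast
qed

section \<open>Compactly supported functions: control by the seminorm of the top derivative\<close>

definition vanishes_outside :: "real \<Rightarrow> (real \<Rightarrow> real) \<Rightarrow> bool" where
  "vanishes_outside R f \<longleftrightarrow> (\<forall>x. R < \<bar>x\<bar> \<longrightarrow> f x = 0)"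

lemma vanishes_outsideD: "vanishes_outside R f \<Longrightarrow> R < \<bar>x\<bar> \<Longrightarrow> f x = 0"
  by (simp add: vanishes_outside_def)

lemma vanishes_outside_mono: "vanishes_outside R f \<Longrightarrow> R \<le> R' \<Longrightarrow> vanishes_outside R' f"
  by (auto simp: vanishes_outside_def)

lemma vanishes_outside_funpow_deriv: "vanishes_outside R f \<Longrightarrow> vanishes_outside R ((deriv ^^ n) f)"
  using deriv_eq_0_outside[of R f] by (auto simp: vanishes_outside_def)

lemma vanishes_outside_deriv: "vanishes_outside R f \<Longrightarrow> vanishes_outside R (deriv f)"
  using vanishes_outside_funpow_deriv[of R f 1] by simp

primrec taylor_const :: "nat \<Rightarrow> real \<Rightarrow> real" where
  "taylor_const 0 R = 1 + \<alpha> (2 * R + 1)"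
| "taylor_const (Suc n) R = taylor_const n R * (2 * R + 2)"

lemma taylor_const_ge_1: "0 \<le> R \<Longrightarrow> 1 \<le> taylor_const n R"
proof (induction n)
  case (Suc n)
  then have "1 * 1 \<le> taylor_const n R * (2 * R + 2)" by (intro mult_mono) auto
  then show ?case by simp
qed (simp add: alpha_nonneg)

text \<open>Integrate down from the point R + 1, where all derivatives vanish and whose distance
  from the support is at most 2 R + 1. The constant grows with the support.\<close>

lemma Ckalpha_bound_of_support:
  assumes R: "0 \<le> R" and e: "0 \<le> e"
  shows "Ck n f \<Longrightarrow> vanishes_outside R f \<Longrightarrow> holder_on e UNIV ((deriv ^^ n) f) \<Longrightarrow> Ckalpha_bound n UNIV (taylor_const n R * e) f"
proof (induction n arbitrary: f)
  case 0
  have end0: "f (R + 1) = 0" using 0 R by (auto intro: vanishes_outsideD)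
  have a: "0 \<le> \<alpha> (2 * R + 1)" using R by (intro alpha_nonneg) auto
  have "\<bar>f x\<bar> \<le> (1 + \<alpha> (2 * R + 1)) * e" for x
  proof (cases "R < \<bar>x\<bar>")
    case True
    then show ?thesis using 0 e a by (simp add: vanishes_outsideD)
  next
    case False
    have "\<bar>f x - f (R + 1)\<bar> \<le> e * \<alpha> \<bar>x - (R + 1)\<bar>" using 0 by (auto intro: holder_onD)
    also have "\<dots> \<le> e * \<alpha> (2 * R + 1)" using False R by (intro mult_left_mono alpha_mono e) auto
    finally show ?thesis using end0 e by (simp add: algebra_simps)
  qed
  moreover have "1 * e \<le> (1 + \<alpha> (2 * R + 1)) * e" by (intro mult_right_mono e) (simp add: a)
  then have "holder_on ((1 + \<alpha> (2 * R + 1)) * e) UNIV f"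
    by (rule holder_on_mono[rotated]) (use 0(3) in simp_all)
  ultimately show ?case by simp
next
  case (Suc n)
  let ?K = "taylor_const n R"
  have K: "1 \<le> ?K" using R by (rule taylor_const_ge_1)
  have end0: "f (R + 1) = 0" using Suc.prems R by (auto intro: vanishes_outsideD)
  have d: "Ckalpha_bound n UNIV (?K * e) (deriv f)"
    using Suc.prems by (intro Suc.IH vanishes_outside_deriv) (simp_all add: Ck_Suc[of n] funpow_deriv_Suc del: funpow.simps)
  have Ke: "0 \<le> ?K * e" using K e by simp
  have le: "?K * e * (2 * R + 1) \<le> taylor_const (Suc n) R * e"
    using mult_left_mono[of "2 * R + 1" "2 * R + 2" "?K * e"] Ke by (simp add: mult_ac)
  have "\<bar>f x\<bar> \<le> taylor_const (Suc n) R * e" for x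
  proof (cases "R < \<bar>x\<bar>")
    case True
    then show ?thesis using Suc.prems e taylor_const_ge_1[OF R, of "Suc n"] by (simp add: vanishes_outsideD)
  next
    case False
    have "\<bar>f x - f (R + 1)\<bar> \<le> (?K * e) * \<bar>x - (R + 1)\<bar>"
      using Ck_mono[OF Suc.prems(1), of 1] Ckalpha_bound_abs_le[OF d]
      by (intro deriv_bound_imp_lipschitz[of f UNIV]) auto
    also have "\<dots> \<le> (?K * e) * (2 * R + 1)" using False R by (intro mult_left_mono Ke) auto
    finally show ?thesis using end0 le by simp
  qed
  moreover have "?K * e \<le> taylor_const (Suc n) R * e"
    using mult_left_mono[of 1 "2 * R + 1" "?K * e"] Ke le R by simp
  ultimately show ?case using Ckalpha_bound_mono[OF d] by simp
qed

definition compose_err :: "nat \<Rightarrow> real \<Rightarrow> real" where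
  "compose_err n R = taylor_const n R + compose_defect n (taylor_const n R) * (taylor_const n R * taylor_const n R)"

lemma compose_err_nonneg: "0 \<le> R \<Longrightarrow> 0 \<le> compose_err n R"
  using taylor_const_ge_1[of R n] compose_defect_nonneg[of "taylor_const n R" n] by (simp add: compose_err_def)

text \<open>The displacement of (id + f) o (id + h) is h + f o (id + h): up to a term of second
  order the seminorm of displacements is subadditive.\<close>

lemma holder_on_compose_sum:
  assumes n: "1 \<le> n" and R: "0 \<le> R" and Ck: "Ck n f" "Ck n h" and "vanishes_outside R f" "vanishes_outside R h"
    and holder_on: "holder_on e1 UNIV ((deriv ^^ n) f)" "holder_on e2 UNIV ((deriv ^^ n) h)" and e: "0 \<le> e1" "0 \<le> e2" "e2 \<le> 1"
  shows "holder_on (e2 + e1 + compose_err n R * (e1 * e2)) UNIV ((deriv ^^ n) (\<lambda>x. h x + f (x + h x)))"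
proof -
  let ?K = "taylor_const n R"
  have K: "1 \<le> ?K" using R by (rule taylor_const_ge_1)
  have f: "Ckalpha_bound n UNIV (?K * e1) f" and h: "Ckalpha_bound n UNIV (?K * e2) h"
    using assms by (simp_all add: Ckalpha_bound_of_support)
  have "holder_on ((1 + ?K * e2) * e1 + compose_defect n ?K * ((?K * e1) * (?K * e2))) UNIV ((deriv ^^ n) (\<lambda>x. f (x + h x)))"
  proof (rule holder_on_compose_sharp[OF Ck _ _ _ _ _ h f holder_on(1)])
    show "Ck 1 h" using Ck(2) n by (rule Ck_mono)
    show "\<bar>deriv h x\<bar> \<le> ?K * e2" for x using h n by (intro Ckalpha_bound_deriv_le) auto
    show "?K * e2 \<le> ?K" using mult_left_mono[OF e(3), of ?K] K by simp
  qed (use K e in auto)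
  from holder_on_add[OF holder_on(2) this]
  have "holder_on (e2 + ((1 + ?K * e2) * e1 + compose_defect n ?K * ((?K * e1) * (?K * e2)))) UNIV
      ((deriv ^^ n) (\<lambda>x. h x + f (x + h x)))"
    by (simp add: funpow_deriv_add[OF Ck(2) Ck_compose_perturbation[OF Ck]])
  then show ?thesis by (simp add: compose_err_def algebra_simps)
qed

text \<open>Since v - id = - f o (id + (v - id)), the sharp composition estimate gives
  \<open>e\<close> plus a term of second order, which a small radius brings below
  \<open>e\<close>.\<close>

lemma holder_on_inverse:
  assumes n: "1 \<le> n" and R: "0 \<le> R"
  obtains \<delta> where "0 < \<delta>" and
    "\<And>f v e. Ck n f \<Longrightarrow> Ck n v \<Longrightarrow> (\<And>x. v x + f (v x) = x) \<Longrightarrow> (\<And>x. v (x + f x) = x) \<Longrightarrow> vanishes_outside R f \<Longrightarrow>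
      holder_on e UNIV ((deriv ^^ n) f) \<Longrightarrow> 0 \<le> e \<Longrightarrow> e \<le> \<delta> \<Longrightarrow> holder_on (2 * e) UNIV ((deriv ^^ n) (\<lambda>x. v x - x))"
proof -
  define K where "K = taylor_const n R"
  define C where "C = inverse_const n"
  define c where "c = compose_defect n 1"
  have pos: "1 \<le> K" "1 \<le> C" "0 \<le> c" "0 < inverse_radius n"
    using taylor_const_ge_1[OF R] inverse_const_ge_1 compose_defect_nonneg[of 1 n] inverse_radius_pos
    by (auto simp: K_def C_def c_def)
  \<comment> \<open>In this order: \<open>Ckalpha_bound_inverse\<close> applies, the derivative of
    \<open>f\<close> is at most 1/2, and the second-order terms are at most
    \<open>e\<close>.\<close>
  define \<delta> where "\<delta> = min (inverse_radius n / K) (min (1 / (2 * K)) (1 / (C * K * (1 + c * K))))"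
  have cK: "0 < C * K * (1 + c * K)" using pos by (simp add: add_pos_nonneg)
  show thesis
  proof (rule that)
    show "0 < \<delta>" using pos cK by (simp add: \<delta>_def)
    fix f v e
    assume Ck: "Ck n f" "Ck n v" and v: "\<And>x. v x + f (v x) = x" "\<And>x. v (x + f x) = x"
      and f: "vanishes_outside R f" "holder_on e UNIV ((deriv ^^ n) f)" and e: "0 \<le> e" "e \<le> \<delta>"
    have "e * K \<le> inverse_radius n" "e * (2 * K) \<le> 1" "e * (C * K * (1 + c * K)) \<le> 1"
      using e(2) pos cK unfolding \<delta>_def by (simp_all add: pos_le_divide_eq)
    then have small: "K * e \<le> inverse_radius n" "K * e \<le> 1 / 2" "C * (K * e) * (1 + c * K) \<le> 1"
      by (simp_all add: mult_ac)
    have Ke: "0 \<le> K * e" using pos e by simp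
    have cb: "Ckalpha_bound n UNIV (K * e) f" unfolding K_def by (intro Ckalpha_bound_of_support R e Ck f)
    have Ck1: "Ck 1 f" using Ck(1) n by (rule Ck_mono)
    have df: "\<bar>deriv f x\<bar> \<le> 1 / 2" for x
      using Ckalpha_bound_deriv_le[OF cb n, of x] small(2) by simp
    define b where "b = C * (K * e)"
    have h: "Ckalpha_bound n UNIV b (\<lambda>x. v x - x)"
      unfolding b_def C_def by (rule Ckalpha_bound_inverse[OF Ck1 df v Ck Ke small(1) cb])
    have b: "0 \<le> b" using pos Ke by (simp add: b_def)
    have "b * 1 \<le> b * (1 + c * K)" using b pos by (intro mult_left_mono) auto
    then have b1: "b \<le> 1" using small(3) by (simp add: b_def)
    have Ckh: "Ck n (\<lambda>x. v x - x)" by (intro Ck_diff Ck Ck_ident)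
    have "holder_on ((1 + b) * e + compose_defect n 1 * ((K * e) * b)) UNIV ((deriv ^^ n) (\<lambda>x. f (x + (v x - x))))"
    proof (rule holder_on_compose_sharp[OF Ck(1) Ckh _ _ b order_refl b1 h cb f(2) Ke e(1)])
      show "Ck 1 (\<lambda>x. v x - x)" using Ckh n by (rule Ck_mono)
      show "\<bar>deriv (\<lambda>x. v x - x) x\<bar> \<le> b" for x using h n by (intro Ckalpha_bound_deriv_le) auto
    qed
    then have "holder_on ((1 + b) * e + c * ((K * e) * b)) UNIV ((deriv ^^ n) (\<lambda>x. f (v x)))" by (simp add: c_def)
    moreover have "(1 + b) * e + c * ((K * e) * b) \<le> 2 * e"
    proof -
      have "(1 + b) * e + c * ((K * e) * b) = e + e * (b * (1 + c * K))" by (simp add: algebra_simps)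
      also have "\<dots> \<le> e + e * 1" using small(3) e(1) by (intro add_left_mono mult_left_mono) (simp_all add: b_def)
      finally show ?thesis by simp
    qed
    ultimately have "holder_on (2 * e) UNIV ((deriv ^^ n) (\<lambda>x. f (v x)))" by (rule holder_on_mono)
    moreover have "(\<lambda>x. v x - x) = (\<lambda>x. - 1 * f (v x))"
    proof
      show "v x - x = - 1 * f (v x)" for x using v(1)[of x] by simp
    qed
    moreover have "Ck n (\<lambda>x. f (v x))" by (rule Ck_compose[OF Ck])
    ultimately show "holder_on (2 * e) UNIV ((deriv ^^ n) (\<lambda>x. v x - x))"
      using holder_on_cmult[of "2 * e" UNIV _ "- 1"] by (simp only: funpow_deriv_cmult) simp
  qed
qed

text \<open>An outer point may be replaced by the endpoint on its side: \<open>f\<close> vanishes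
  there too and the distance shrinks. Hence no constant is lost.\<close>

lemma holder_on_extend:
  assumes "holder_on M {-r..r} f" "\<And>x. r \<le> \<bar>x\<bar> \<Longrightarrow> f x = 0" "0 \<le> M" "0 \<le> r"
  shows "holder_on M UNIV f"
proof (rule holder_onI)
  have *: "\<bar>f x - f y\<bar> \<le> M * \<alpha> \<bar>x - y\<bar>" if "\<bar>x\<bar> \<le> r" "r < \<bar>y\<bar>" for x y
  proof -
    define z where "z = (if 0 \<le> y then r else - r)"
    have z: "\<bar>z\<bar> = r" "\<bar>x - z\<bar> \<le> \<bar>x - y\<bar>" using that assms(4) by (auto simp: z_def)
    have "\<bar>f x - f z\<bar> \<le> M * \<alpha> \<bar>x - z\<bar>" using that z by (intro holder_onD[OF assms(1)]) auto
    also have "\<dots> \<le> M * \<alpha> \<bar>x - y\<bar>" using z by (intro mult_left_mono alpha_mono assms(3)) auto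
    finally show ?thesis using assms(2)[of y] assms(2)[of z] z that by simp
  qed
  fix x y :: real
  consider "\<bar>x\<bar> \<le> r" "\<bar>y\<bar> \<le> r" | "\<bar>x\<bar> \<le> r" "r < \<bar>y\<bar>" | "r < \<bar>x\<bar>" "\<bar>y\<bar> \<le> r" | "r < \<bar>x\<bar>" "r < \<bar>y\<bar>"
    by linarith
  then show "\<bar>f x - f y\<bar> \<le> M * \<alpha> \<bar>x - y\<bar>"
  proof cases
    case 1
    then show ?thesis by (intro holder_onD[OF assms(1)]) auto
  next
    case 2
    then show ?thesis by (rule *)
  next
    case 3
    then show ?thesis using *[of y x] by (simp add: abs_minus_commute)
  next
    case 4
    then show ?thesis using assms(2)[of x] assms(2)[of y] assms(3) by (simp add: alpha_nonneg)
  qed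
qed

lemma Ckalpha_bound_extend:
  assumes "Ckalpha_bound n {-r..r} M f" "vanishes_outside r' f" "r' < r" "0 \<le> M" "0 \<le> r"
  shows "Ckalpha_bound n UNIV M f"
proof -
  have 0: "(deriv ^^ i) f x = 0" if "r \<le> \<bar>x\<bar>" for i x
    using vanishes_outsideD[OF vanishes_outside_funpow_deriv[OF assms(2)]] that assms(3) by auto
  have "holder_on M UNIV ((deriv ^^ n) f)"
    using assms(4,5) by (intro holder_on_extend[of M r] 0 Ckalpha_bound_holder[OF assms(1)])
  moreover have "\<bar>(deriv ^^ i) f x\<bar> \<le> M" if "i \<le> n" for i x
  proof (cases "\<bar>x\<bar> \<le> r")
    case True
    then have "x \<in> {-r..r}" by auto
    then show ?thesis using assms(1) that unfolding Ckalpha_bound_iff by blast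
  next
    case False
    then show ?thesis using 0[of x i] assms(4) by simp
  qed
  ultimately show ?thesis unfolding Ckalpha_bound_iff by blast
qed

text \<open>A small function with a bounded Hoelder constant has small derivatives: a difference
  quotient over a short step bounds the derivative at one point of the step, and Hoelder continuity
  carries the bound across it.\<close>

lemma interpolation:
  assumes R: "0 \<le> R" and M: "0 \<le> M" and "0 < \<epsilon>"
  obtains \<eta> where "0 < \<eta>" and "\<And>f i x. Ck n f \<Longrightarrow> vanishes_outside R f \<Longrightarrow> holder_on M UNIV ((deriv ^^ n) f) \<Longrightarrow>
    (\<And>x. \<bar>f x\<bar> \<le> \<eta>) \<Longrightarrow> i \<le> n \<Longrightarrow> \<bar>(deriv ^^ i) f x\<bar> \<le> \<epsilon>"
proof -
  have "\<exists>\<eta>>0. \<forall>f. Ck n f \<longrightarrow> vanishes_outside R f \<longrightarrow> holder_on M UNIV ((deriv ^^ n) f) \<longrightarrow> (\<forall>x. \<bar>f x\<bar> \<le> \<eta>) \<longrightarrow>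
      (\<forall>i\<le>n. \<forall>x. \<bar>(deriv ^^ i) f x\<bar> \<le> \<epsilon>)"
  proof (induction n)
    case 0
    then show ?case using assms(3) by (intro exI[of _ \<epsilon>]) auto
  next
    case (Suc n)
    then obtain \<eta>' where \<eta>': "0 < \<eta>'" and IH: "\<And>f. Ck n f \<Longrightarrow> vanishes_outside R f \<Longrightarrow> holder_on M UNIV ((deriv ^^ n) f) \<Longrightarrow>
        (\<forall>x. \<bar>f x\<bar> \<le> \<eta>') \<Longrightarrow> (\<forall>i\<le>n. \<forall>x. \<bar>(deriv ^^ i) f x\<bar> \<le> \<epsilon>)"
      by blast
    define H where "H = slack ^ n * (taylor_const n R * M)"
    have H: "0 \<le> H" using slack_ge_1 taylor_const_ge_1[OF R, of n] M by (simp add: H_def)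
    \<comment> \<open>\<open>H\<close> is a Hoelder constant for the first derivative; over a step
      of length \<open>s\<close> that derivative varies by at most half of
      \<open>\<eta>'\<close>.\<close>
    obtain s where s: "0 < s" "\<And>t. 0 \<le> t \<Longrightarrow> t \<le> s \<Longrightarrow> \<alpha> t < \<eta>' / (2 * (H + 1))"
      using alpha_small[of "\<eta>' / (2 * (H + 1))"] \<eta>' H by auto
    \<comment> \<open>The difference quotient over the step is at most
      \<open>2 * \<eta> / s\<close>, and so at most the other half of
      \<open>\<eta>'\<close>.\<close>
    define \<eta> where "\<eta> = min \<epsilon> (\<eta>' * s / 4)"
    have \<eta>: "0 < \<eta>" using \<eta>' s assms(3) by (simp add: \<eta>_def)
    have "\<bar>(deriv ^^ i) f x\<bar> \<le> \<epsilon>"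
      if f: "Ck (Suc n) f" "vanishes_outside R f" "holder_on M UNIV ((deriv ^^ Suc n) f)" "\<forall>x. \<bar>f x\<bar> \<le> \<eta>"
        and i: "i \<le> Suc n" for f i x
    proof -
      have f': "Ck n (deriv f)" "vanishes_outside R (deriv f)" "holder_on M UNIV ((deriv ^^ n) (deriv f))"
        using f(1,3) vanishes_outside_deriv[OF f(2)] by (simp_all only: Ck_Suc funpow_deriv_Suc)
      have Hol: "holder_on H UNIV (deriv f)"
        unfolding H_def using taylor_const_ge_1[OF R, of n] M
        by (intro Ckalpha_bound_imp_holder_oner_on f' Ckalpha_bound_of_support R) auto
      have "\<bar>deriv f y\<bar> \<le> \<eta>'" for y
      proof -
        obtain z where z: "y < z" "z < y + s" "f (y + s) - f y = (y + s - y) * deriv f z"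
          using MVT2[of y "y + s" f "deriv f"] s(1) Ck_has_deriv[OF f(1)] by auto
        have "s * \<bar>deriv f z\<bar> = \<bar>f (y + s) - f y\<bar>" using z(3) s(1) by (simp add: abs_mult)
        also have "\<dots> \<le> 2 * \<eta>" using f(4)[rule_format, of "y + s"] f(4)[rule_format, of y] by linarith
        also have "\<dots> \<le> 2 * (\<eta>' * s / 4)" unfolding \<eta>_def by (intro mult_left_mono min.cobounded2) simp
        also have "\<dots> = s * (\<eta>' / 2)" by simp
        finally have 1: "\<bar>deriv f z\<bar> \<le> \<eta>' / 2" using s(1) by (rule mult_left_le_imp_le)
        have "\<bar>deriv f y - deriv f z\<bar> \<le> H * \<alpha> \<bar>y - z\<bar>" by (rule holder_onD[OF Hol]) auto
        also have "\<dots> \<le> H * (\<eta>' / (2 * (H + 1)))"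
          using z s(2)[of "\<bar>y - z\<bar>"] by (intro mult_left_mono H) auto
        also have "\<dots> \<le> (H + 1) * (\<eta>' / (2 * (H + 1)))"
          using \<eta>' H by (intro mult_right_mono) auto
        also have "\<dots> = \<eta>' / 2" using H by (simp add: field_simps)
        finally show ?thesis using 1 by linarith
      qed
      then have all: "\<bar>(deriv ^^ j) (deriv f) x\<bar> \<le> \<epsilon>" if "j \<le> n" for j
        using IH[OF f'] that by blast
      show ?thesis
      proof (cases i)
        case 0
        have "\<bar>f x\<bar> \<le> \<eta>" using f(4) by blast
        also have "\<eta> \<le> \<epsilon>" by (simp add: \<eta>_def)
        finally show ?thesis using 0 by simp
      next
        case (Suc j)
        then show ?thesis using all[of j] i by (simp only: funpow_deriv_Suc)
      qed
    qed
    with \<eta> show ?case by blast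
  qed
  then obtain \<eta> where "0 < \<eta>" "\<And>f. Ck n f \<Longrightarrow> vanishes_outside R f \<Longrightarrow> holder_on M UNIV ((deriv ^^ n) f) \<Longrightarrow> (\<forall>x. \<bar>f x\<bar> \<le> \<eta>) \<Longrightarrow>
      (\<forall>i\<le>n. \<forall>x. \<bar>(deriv ^^ i) f x\<bar> \<le> \<epsilon>)"
    by blast
  then show thesis using that[of \<eta>] by blast
qed

end

subsection \<open>The group of compactly supported diffeomorphisms\<close>

text \<open>Only finitely many derivatives of the cutoffs matter, so a power of the positive part
  can replace the usual exponential.\<close>

lemma Ck_max_power: "Ck n (\<lambda>x::real. max 0 x ^ Suc n)"
proof (induction n)
  case 0
  show ?case by (auto simp: Ck_0 intro!: continuous_intros)
next
  case (Suc n)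
  have D: "((\<lambda>x::real. max 0 x ^ Suc (Suc n)) has_real_derivative real (n + 2) * max 0 x ^ Suc n) (at x)" for x
  proof -
    consider "0 < x" | "x < 0" | "x = 0" by linarith
    then show ?thesis
    proof cases
      case 1
      have "((\<lambda>x::real. x ^ Suc (Suc n)) has_real_derivative real (n + 2) * max 0 x ^ Suc n) (at x)"
        using 1 DERIV_pow[of "Suc (Suc n)" x UNIV] by (simp add: max_def)
      then show ?thesis
        by (rule has_field_derivative_transform_within_open[of _ _ _ "{0<..}"]) (use 1 in auto)
    next
      case 2
      have "((\<lambda>x::real. 0) has_real_derivative real (n + 2) * max 0 x ^ Suc n) (at x)"
        using 2 by (auto simp: max_def)
      then show ?thesis
        by (rule has_field_derivative_transform_within_open[of _ _ _ "{..<0}"]) (use 2 in \<open>auto simp: max_def\<close>)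
    next
      case 3
      have "((\<lambda>h::real. max 0 h ^ Suc n) \<longlongrightarrow> max 0 0 ^ Suc n) (at 0)"
        by (intro tendsto_intros)
      then have "((\<lambda>h::real. max 0 h ^ Suc (Suc n) / h) \<longlongrightarrow> max 0 0 ^ Suc n) (at 0)"
        by (rule Lim_transform_eventually) (auto simp: eventually_at_filter max_def)
      then show ?thesis using 3 by (simp add: DERIV_def)
    qed
  qed
  show ?case by (rule Ck_Suc_intro[OF D]) (intro Ck_mult Ck_const Suc.IH)
qed

lemma Ck_step_exists:
  obtains \<theta> :: "real \<Rightarrow> real" where "Ck n \<theta>" "\<And>x. x \<le> - 1 \<Longrightarrow> \<theta> x = 0" "\<And>x. 1 \<le> x \<Longrightarrow> \<theta> x = 1"
    "\<And>x. 0 \<le> \<theta> x" "\<And>x. \<theta> x \<le> 1"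
proof -
  define s :: "real \<Rightarrow> real" where "s = (\<lambda>x. max 0 x ^ Suc n)"
  have s: "0 \<le> s x" "x \<le> 0 \<Longrightarrow> s x = 0" "0 < x \<Longrightarrow> 0 < s x" for x
    by (auto simp: s_def max_def)
  have pos: "0 < s (1 * x + 1) + s (- 1 * x + 1)" for x
  proof (cases "0 < x + 1")
    case True
    then show ?thesis using s(3)[of "x + 1"] s(1)[of "1 - x"] by (simp add: add_pos_nonneg)
  next
    case False
    then show ?thesis using s(3)[of "1 - x"] s(1)[of "x + 1"] by (simp add: add_nonneg_pos)
  qed
  have Cks: "Ck n s" unfolding s_def by (rule Ck_max_power)
  have Ckc: "Ck n (\<lambda>x. s (a * x + 1))" for a
    by (rule Ck_compose[OF Cks]) (intro Ck_add Ck_mult Ck_const Ck_ident)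
  \<comment> \<open>The quotient s(1 + x) / (s(1 + x) + s(1 - x)), with both arguments in the form
    \<open>a * x + 1\<close> of the preceding fact.\<close>
  define \<theta> where "\<theta> = (\<lambda>x. s (1 * x + 1) * (1 / (s (1 * x + 1) + s (- 1 * x + 1))))"
  show thesis
  proof (rule that[of \<theta>])
    show "Ck n \<theta>" unfolding \<theta>_def
      using pos by (intro Ck_mult Ckc Ck_recip Ck_add) (metis less_irrefl)
    show "\<theta> x = 0" if "x \<le> - 1" for x using s(2)[of "x + 1"] that by (simp add: \<theta>_def)
    show "\<theta> x = 1" if "1 \<le> x" for x
      using s(2)[of "1 - x"] s(3)[of "x + 1"] that by (simp add: \<theta>_def)
    show "0 \<le> \<theta> x" for x using s(1) pos[of x] by (simp add: \<theta>_def)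
    show "\<theta> x \<le> 1" for x using s(1)[of "1 - x"] pos[of x] by (simp add: \<theta>_def)
  qed
qed

lemma bounded_of_support:
  assumes "continuous_on UNIV f" "\<And>x. R < \<bar>x\<bar> \<Longrightarrow> f x = (0::real)"
  obtains M :: real where "0 \<le> M" "\<And>x::real. \<bar>f x\<bar> \<le> M"
proof -
  have "bounded (f ` {-R..R})"
    using assms(1) by (intro compact_imp_bounded compact_continuous_image) (auto intro: continuous_on_subset)
  then obtain M where M: "\<And>x. x \<in> {-R..R} \<Longrightarrow> \<bar>f x\<bar> \<le> M"
    unfolding bounded_iff by (metis imageI real_norm_def)
  show thesis
  proof (rule that[of "max M 0"])
    show "\<bar>f x\<bar> \<le> max M 0" for x
    proof (cases "R < \<bar>x\<bar>")
      case False
      then have "x \<in> {-R..R}" by auto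
      then show ?thesis using M[of x] by simp
    qed (simp add: assms(2))
  qed simp
qed

context modulus
begin

lemma Ckalpha_bound_exists_of_support:
  "Ck (Suc n) f \<Longrightarrow> vanishes_outside R f \<Longrightarrow> \<exists>M\<ge>0. Ckalpha_bound n UNIV M f"
proof (induction n arbitrary: f)
  case 0
  obtain M1 where M1: "0 \<le> M1" "\<And>x. \<bar>f x\<bar> \<le> M1"
    using bounded_of_support[OF Ck_continuous[OF 0(1)], of R] 0(2) by (auto dest: vanishes_outsideD)
  have "Ck 0 (deriv f)" using 0(1) by (simp add: Ck_Suc)
  then obtain M2 where M2: "0 \<le> M2" "\<And>x. \<bar>deriv f x\<bar> \<le> M2"
    using bounded_of_support[OF Ck_continuous, of 0 "deriv f" R] vanishes_outside_deriv[OF 0(2)]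
    by (auto dest: vanishes_outsideD)
  define M where "M = max M1 M2"
  have M: "0 \<le> M" "\<And>x. \<bar>f x\<bar> \<le> M" "\<And>x. \<bar>deriv f x\<bar> \<le> M"
    using M1 M2 by (simp_all add: M_def le_max_iff_disj)
  have "holder_on (slack * M) UNIV f"
    using M 0(1) by (intro lipschitz_imp_holder_oner deriv_bound_imp_lipschitz[of f UNIV]) auto
  moreover have "\<bar>f x\<bar> \<le> slack * M" for x
    using M(2)[of x] mult_right_mono[OF slack_ge_1 M(1)] by linarith
  ultimately show ?case using M(1) slack_ge_1 by (intro exI[of _ "slack * M"]) simp
next
  case (Suc n)
  obtain M1 where M1: "0 \<le> M1" "\<And>x. \<bar>f x\<bar> \<le> M1"
    using bounded_of_support[OF Ck_continuous[OF Suc.prems(1)], of R] Suc.prems(2)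
    by (auto dest: vanishes_outsideD)
  obtain M2 where M2: "0 \<le> M2" "Ckalpha_bound n UNIV M2 (deriv f)"
    using Suc.IH[of "deriv f"] Suc.prems(1) vanishes_outside_deriv[OF Suc.prems(2)] unfolding Ck_Suc[of "Suc n"] by blast
  have "Ckalpha_bound n UNIV (max M1 M2) (deriv f)" by (rule Ckalpha_bound_mono[OF M2(2)]) simp
  moreover have "\<bar>f x\<bar> \<le> max M1 M2" for x using M1(2)[of x] by simp
  ultimately show ?case using M1(1) by (intro exI[of _ "max M1 M2"]) simp
qed

end

abbreviation finv :: "('a \<Rightarrow> 'b) \<Rightarrow> 'b \<Rightarrow> 'a" where
  "finv \<equiv> inv_into UNIV"

lemma supp_subset_iff: "supp f \<subseteq> {-R..R} \<longleftrightarrow> (\<forall>x. R < \<bar>x\<bar> \<longrightarrow> f x = x)"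
proof -
  have "supp f \<subseteq> {-R..R} \<longleftrightarrow> {x. f x \<noteq> x} \<subseteq> {-R..R}"
    unfolding supp_def by (meson closed_atLeastAtMost closure_minimal closure_subset order_trans)
  also have "\<dots> \<longleftrightarrow> (\<forall>x. R < \<bar>x\<bar> \<longrightarrow> f x = x)"
  proof (intro iffI allI impI subsetI)
    fix x assume "{x. f x \<noteq> x} \<subseteq> {-R..R}" "R < \<bar>x\<bar>"
    then have "x \<notin> {x. f x \<noteq> x}" by (meson abs_le_iff atLeastAtMost_iff leD minus_le_iff subsetD)
    then show "f x = x" by simp
  next
    fix x assume "\<forall>x. R < \<bar>x\<bar> \<longrightarrow> f x = x" "x \<in> {x. f x \<noteq> x}"
    then have "\<not> R < \<bar>x\<bar>" by blast
    then show "x \<in> {-R..R}" by auto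
  qed
  finally show ?thesis .
qed

lemma compact_supp_iff: "compact (supp f) \<longleftrightarrow> (\<exists>R\<ge>0. \<forall>x. R < \<bar>x\<bar> \<longrightarrow> f x = x)"
proof
  assume "compact (supp f)"
  then have "bounded (supp f)" by (rule compact_imp_bounded)
  then obtain R where R: "\<And>x. x \<in> supp f \<Longrightarrow> \<bar>x\<bar> \<le> R" unfolding bounded_iff by auto
  have "supp f \<subseteq> {- max R 0..max R 0}"
  proof
    fix x assume "x \<in> supp f"
    then show "x \<in> {- max R 0..max R 0}" using R[of x] by auto
  qed
  then show "\<exists>R\<ge>0. \<forall>x. R < \<bar>x\<bar> \<longrightarrow> f x = x"
    unfolding supp_subset_iff by (intro exI[of _ "max R 0"]) auto
next
  assume "\<exists>R\<ge>0. \<forall>x. R < \<bar>x\<bar> \<longrightarrow> f x = x"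
  then obtain R where "supp f \<subseteq> {-R..R}" unfolding supp_subset_iff by blast
  then have "bounded (supp f)" by (rule bounded_subset[OF bounded_closed_interval[of "-R" R]])
  then show "compact (supp f)" unfolding supp_def by (simp add: compact_eq_bounded_closed)
qed

locale modulus_order = modulus +
  fixes k :: nat
  assumes k: "1 \<le> k"
begin

abbreviation "Dc \<equiv> Diff_c k \<alpha>"
abbreviation "\<G> \<equiv> Diff_c_group k \<alpha>"

lemma Diff_cI:
  assumes "strict_mono f" "\<And>x. f (v x) = x" "\<And>x. v (f x) = x" "Ckalpha k \<alpha> f" "Ckalpha k \<alpha> v"
    "\<And>x. R < \<bar>x\<bar> \<Longrightarrow> f x = x"
  shows "f \<in> Dc"
proof -
  have "bij f" using assms(2,3) by (intro bij_betw_byWitness[of UNIV v]) auto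
  moreover have "inv_into UNIV f = v" using assms(2,3) by (intro inv_equality) auto
  moreover have "compact (supp f)"
    unfolding compact_supp_iff using assms(6) by (intro exI[of _ "max R 0"]) auto
  ultimately show ?thesis using assms unfolding Diff_c_def by simp
qed

lemma Diff_cD:
  assumes "f \<in> Dc"
  shows "strict_mono f" "f (finv f x) = x" "finv f (f x) = x" "Ckalpha k \<alpha> f" "Ckalpha k \<alpha> (finv f)"
    "\<exists>R\<ge>0. \<forall>x. R < \<bar>x\<bar> \<longrightarrow> f x = x"
  using assms unfolding Diff_c_def compact_supp_iff
  by (auto simp: bij_is_surj surj_f_inv_f bij_is_inj)

lemma Diff_c_Ck: "f \<in> Dc \<Longrightarrow> Ck k f"
  using Ckalpha_imp_Ck Diff_cD(4) by blast

lemma Diff_c_C1: "f \<in> Dc \<Longrightarrow> Ck 1 f"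
  using Diff_c_Ck Ck_mono k by blast

lemma Ckalpha_compose': "Ckalpha k \<alpha> f \<Longrightarrow> Ckalpha k \<alpha> g \<Longrightarrow> Ckalpha k \<alpha> (\<lambda>x. f (g x))"
  using Ckalpha_compose Ckalpha_imp_Ck Ck_mono k by blast

lemma inv_unique: "f \<in> Dc \<Longrightarrow> f x = y \<Longrightarrow> finv f y = x"
  using Diff_cD(3) by blast

lemma Diff_c_inv:
  assumes "f \<in> Dc"
  shows "finv f \<in> Dc"
proof -
  obtain R where R: "\<And>x. R < \<bar>x\<bar> \<Longrightarrow> f x = x" using Diff_cD(6)[OF assms] by blast
  show ?thesis
  proof (rule Diff_cI)
    show "strict_mono (finv f)"
    proof (rule strict_monoI)
      fix x y :: real assume "x < y"
      then have "f (finv f x) < f (finv f y)" by (simp add: Diff_cD(2)[OF assms])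
      then show "finv f x < finv f y" using Diff_cD(1)[OF assms] strict_mono_less by blast
    qed
    show "finv f x = x" if "R < \<bar>x\<bar>" for x using inv_unique[OF assms R[OF that]] .
  qed (use Diff_cD[OF assms] in auto)
qed

lemma Diff_c_compose:
  assumes f: "f \<in> Dc" and g: "g \<in> Dc"
  shows "(\<lambda>x. f (g x)) \<in> Dc"
proof -
  obtain R where R: "\<And>x. R < \<bar>x\<bar> \<Longrightarrow> f x = x" using Diff_cD(6)[OF f] by blast
  obtain R' where R': "\<And>x. R' < \<bar>x\<bar> \<Longrightarrow> g x = x" using Diff_cD(6)[OF g] by blast
  show ?thesis
  proof (rule Diff_cI[of _ "\<lambda>x. finv g (finv f x)" "max R R'"])
    show "strict_mono (\<lambda>x. f (g x))"
      using Diff_cD(1)[OF f] Diff_cD(1)[OF g] by (simp add: strict_mono_def)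
    show "Ckalpha k \<alpha> (\<lambda>x. f (g x))" by (rule Ckalpha_compose'[OF Diff_cD(4)[OF f] Diff_cD(4)[OF g]])
    show "Ckalpha k \<alpha> (\<lambda>x. finv g (finv f x))" by (rule Ckalpha_compose'[OF Diff_cD(5)[OF g] Diff_cD(5)[OF f]])
  qed (use Diff_cD(2,3)[OF f] Diff_cD(2,3)[OF g] R R' in auto)
qed

lemma Diff_c_id: "(\<lambda>x. x) \<in> Dc"
  by (rule Diff_cI[of _ "\<lambda>x. x" 0]) (auto simp: strict_mono_def)

lemma Diff_c_group: "group \<G>"
proof (rule groupI)
  fix f assume "f \<in> carrier \<G>"
  then have f: "f \<in> Dc" by (simp add: Diff_c_group_def)
  have "finv f \<circ> f = id" using Diff_cD(3)[OF f] by auto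
  then show "\<exists>g\<in>carrier \<G>. g \<otimes>\<^bsub>\<G>\<^esub> f = \<one>\<^bsub>\<G>\<^esub>"
    using Diff_c_inv[OF f] by (auto simp: Diff_c_group_def)
qed (use Diff_c_compose Diff_c_id in \<open>auto simp: Diff_c_group_def comp_def id_def\<close>)

lemma carrier_eq [simp]: "carrier \<G> = Dc"
  and mult_eq: "f \<otimes>\<^bsub>\<G>\<^esub> g = (\<lambda>x. f (g x))"
  by (auto simp: Diff_c_group_def comp_def)

lemma m_inv_eq:
  assumes "f \<in> Dc"
  shows "inv\<^bsub>\<G>\<^esub> f = finv f"
proof (rule group.inv_equality[OF Diff_c_group])
  have "finv f \<circ> f = id" using Diff_cD(3)[OF assms] by auto
  then show "finv f \<otimes>\<^bsub>\<G>\<^esub> f = \<one>\<^bsub>\<G>\<^esub>" by (simp add: Diff_c_group_def)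
qed (use assms Diff_c_inv in auto)

text \<open>Membership in the group is part of the relation, so that chains of it carry their own
  side conditions.\<close>

definition homologous :: "(real \<Rightarrow> real) \<Rightarrow> (real \<Rightarrow> real) \<Rightarrow> bool" (infix "\<doteq>" 50) where
  "f \<doteq> g \<longleftrightarrow> f \<in> Dc \<and> g \<in> Dc \<and> H1_class \<G> f = H1_class \<G> g"

lemma homologous_refl: "f \<in> Dc \<Longrightarrow> f \<doteq> f"
  and homologous_trans [trans]: "f \<doteq> g \<Longrightarrow> g \<doteq> h \<Longrightarrow> f \<doteq> h"
  by (auto simp: homologous_def)

lemma homologous_compose:
  assumes "f \<doteq> f'" "g \<doteq> g'"
  shows "(\<lambda>x. f (g x)) \<doteq> (\<lambda>x. f' (g' x))"
  using H1_class_mult_cong[OF Diff_c_group, of f f' g g'] assms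
  by (auto simp: homologous_def mult_eq intro: Diff_c_compose)

lemma homologous_conj:
  assumes "a \<in> Dc" "f \<in> Dc"
  shows "(\<lambda>x. a (f (finv a x))) \<doteq> f"
  using H1_class_conj[OF Diff_c_group, of a f] assms Diff_c_compose[OF Diff_c_compose[OF assms] Diff_c_inv[OF assms(1)]]
  by (simp add: homologous_def mult_eq m_inv_eq)

lemma homologous_commute:
  assumes "f \<in> Dc" "g \<in> Dc"
  shows "(\<lambda>x. f (g x)) \<doteq> (\<lambda>x. g (f x))"
  using H1_class_commute[OF Diff_c_group, of f g] assms Diff_c_compose
  by (simp add: homologous_def mult_eq)

lemma homologous_cancel_right:
  assumes "(\<lambda>x. f (g x)) \<doteq> (\<lambda>x. f' (g' x))" "g \<doteq> g'" "f \<in> Dc" "f' \<in> Dc"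
  shows "f \<doteq> f'"
  using H1_class_mult_right_cancel[OF Diff_c_group, of f f' g g'] assms
  by (simp add: homologous_def mult_eq)

section \<open>Small perturbations of the identity and conjugation by affine maps\<close>

lemma perturbation_Diff_c:
  assumes f: "Ckalpha k \<alpha> f" "\<And>x. \<bar>deriv f x\<bar> \<le> 1 / 2" "vanishes_outside R f"
  shows "(\<lambda>x. x + f x) \<in> Dc"
proof -
  let ?g = "\<lambda>x. x + f x"
  have C1: "Ck 1 f" using Ckalpha_imp_Ck[OF f(1)] k by (rule Ck_mono)
  have D: "(?g has_real_derivative 1 + deriv f x) (at x)" for x
    by (intro derivative_intros Ck_has_deriv'[OF C1]) auto
  have pos: "0 < 1 + deriv f x" for x using f(2)[of x] by auto
  have mono: "strict_mono ?g"
    by (rule strict_monoI, rule DERIV_pos_imp_increasing) (use D pos in blast)+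
  have cont: "continuous_on UNIV ?g"
    by (intro continuous_at_imp_continuous_on ballI DERIV_isCont[OF D])
  have "surj ?g"
    unfolding surj_def
  proof
    fix y
    define b where "b = \<bar>R\<bar> + \<bar>y\<bar> + 1"
    have "f b = 0" "f (- b) = 0" by (rule vanishes_outsideD[OF f(3)], simp add: b_def)+
    then have "?g (- b) \<le> y" "y \<le> ?g b" "- b \<le> b" by (auto simp: b_def)
    then obtain x where "?g x = y"
      using IVT'[of ?g "- b" y b] continuous_on_subset[OF cont subset_UNIV] by blast
    then show "\<exists>x. y = ?g x" by blast
  qed
  then have b: "bij ?g" using strict_mono_imp_inj_on[OF mono] by (simp add: bij_def)
  define v where "v = finv ?g"
  have v: "?g (v x) = x" "v (?g x) = x" for x
    using surj_f_inv_f[OF bij_is_surj[OF b], of x] inv_f_f[OF bij_is_inj[OF b], of x] by (simp_all only: v_def)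
  have Cg: "Ckalpha k \<alpha> ?g" by (intro Ckalpha_add f(1) Ckalpha_ident)
  show ?thesis
  proof (rule Diff_cI[OF mono v Cg])
    show "Ckalpha k \<alpha> v"
      by (rule Ckalpha_inverse_function[OF Cg k _ v]) (use pos deriv_eqI[OF D] in \<open>simp add: less_imp_neq[symmetric]\<close>)
    show "?g x = x" if "R < \<bar>x\<bar>" for x using vanishes_outsideD[OF f(3) that] by simp
  qed
qed

lemma Diff_c_fixed_interval:
  assumes h: "h \<in> Dc" "\<And>x. R \<le> \<bar>x\<bar> \<Longrightarrow> h x = x" and x: "\<bar>x\<bar> \<le> R"
  shows "\<bar>h x\<bar> \<le> R"
proof -
  have "h x \<le> h R" "h (- R) \<le> h x"
    using strict_mono_less_eq[OF Diff_cD(1)[OF h(1)]] x by auto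
  moreover have "h R = R" "h (- R) = - R" using h(2) x by auto
  ultimately show ?thesis by auto
qed

text \<open>Conjugating \<open>h\<close> involves the conjugator only on an interval that carries
  \<open>h\<close>. A map \<open>A\<close> outside the group therefore acts on \<open>h\<close> like
  the compactly supported \<open>b\<close>.\<close>

lemma conj_eq_of_agree:
  assumes b: "b \<in> Dc" and h: "h \<in> Dc" "\<And>x. R \<le> \<bar>x\<bar> \<Longrightarrow> h x = x"
    and A: "\<And>y. A (A' y) = y" "\<And>y. A' (A y) = y" and eq: "\<And>x. \<bar>x\<bar> \<le> R \<Longrightarrow> b x = A x"
  shows "A (h (A' y)) = b (h (finv b y))"
proof (cases "\<bar>finv b y\<bar> \<le> R")
  case True
  then have "A (finv b y) = y" using eq Diff_cD(2)[OF b] by metis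
  then have "A' y = finv b y" using A(2) by metis
  then show ?thesis using eq[OF Diff_c_fixed_interval[OF h True]] by simp
next
  case False
  then have 1: "b (h (finv b y)) = y" using h(2) Diff_cD(2)[OF b] by simp
  have "R \<le> \<bar>A' y\<bar>"
  proof (rule ccontr)
    assume "\<not> R \<le> \<bar>A' y\<bar>"
    then have "\<bar>A' y\<bar> \<le> R" by simp
    then have "b (A' y) = y" using eq A(1) by simp
    then have "finv b y = A' y" by (rule inv_unique[OF b])
    then show False using False \<open>\<bar>A' y\<bar> \<le> R\<close> by simp
  qed
  then show ?thesis using 1 h(2) A(1) by simp
qed

definition affine_conj :: "real \<Rightarrow> real \<Rightarrow> (real \<Rightarrow> real) \<Rightarrow> real \<Rightarrow> real" where
  "affine_conj a c h = (\<lambda>x. a * h ((x - c) / a) + c)"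

text \<open>Cut the displacement (a - 1) x + c off at scale \<open>\<rho>\<close>. A large
  \<open>\<rho>\<close> makes the translation part harmless for every \<open>c\<close>, but (a - 1)
  x grows with the scale, so \<open>a\<close> must be close to 1; how close depends on the cutoff
  only.\<close>

lemma affine_conj_homologous_aux:
  obtains \<kappa> where "0 < \<kappa>" "\<And>a c h. \<bar>a - 1\<bar> \<le> \<kappa> \<Longrightarrow> 0 < a \<Longrightarrow> h \<in> Dc \<Longrightarrow> affine_conj a c h \<doteq> h"
proof -
  obtain \<theta> :: "real \<Rightarrow> real" where \<theta>: "Ck (Suc k) \<theta>" "\<And>x. x \<le> - 1 \<Longrightarrow> \<theta> x = 0" "\<And>x. 1 \<le> x \<Longrightarrow> \<theta> x = 1"
      "\<And>x. 0 \<le> \<theta> x" "\<And>x. \<theta> x \<le> 1"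
    using Ck_step_exists[of "Suc k"] by blast
  define \<zeta> where "\<zeta> = (\<lambda>x. \<theta> (2 * x + 3) * \<theta> (- 2 * x + 3))"
  have Ck\<zeta>: "Ck (Suc k) \<zeta>" unfolding \<zeta>_def
    by (intro Ck_mult Ck_compose[OF \<theta>(1)] Ck_add Ck_const Ck_ident)
  have \<zeta>1: "\<zeta> x = 1" if "\<bar>x\<bar> \<le> 1" for x using that by (simp add: \<zeta>_def \<theta>(3))
  have \<zeta>0: "\<zeta> x = 0" if "2 < \<bar>x\<bar>" for x
  proof (cases "0 < x")
    case True
    then show ?thesis using that by (simp add: \<zeta>_def \<theta>(2))
  next
    case False
    then show ?thesis using that by (simp add: \<zeta>_def \<theta>(2))
  qed
  have \<zeta>le: "\<bar>\<zeta> x\<bar> \<le> 1" for x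
    using \<theta>(4,5) by (simp add: \<zeta>_def abs_mult mult_le_one)
  have van: "vanishes_outside 2 \<zeta>" using \<zeta>0 by (simp add: vanishes_outside_def)
  obtain B where B: "0 \<le> B" "\<And>x. \<bar>deriv \<zeta> x\<bar> \<le> B"
    using bounded_of_support[of "deriv \<zeta>" 2] Ck_continuous[of k "deriv \<zeta>"] Ck\<zeta> vanishes_outside_deriv[OF van]
    unfolding Ck_Suc[of k] vanishes_outside_def by blast
  \<comment> \<open>On the support of the cutoff, where |x| is at most \<open>2 * \<rho>\<close>,
    the dilation part contributes at most \<open>\<kappa> * (2 * B + 1)\<close> to the derivative of
    \<open>p\<close>: one half of the admissible 1/2.\<close>
  define \<kappa> where "\<kappa> = 1 / (4 * (2 * B + 1))"
  have \<kappa>: "0 < \<kappa>" "\<kappa> * (2 * B + 1) = 1 / 4" using B(1) by (auto simp: \<kappa>_def field_simps add_pos_nonneg)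
  show thesis
  proof (rule that[OF \<kappa>(1)])
    fix a c h assume a: "\<bar>a - 1\<bar> \<le> \<kappa>" "0 < a" and h: "h \<in> Dc"
    obtain R where R: "0 \<le> R" "\<And>x. R < \<bar>x\<bar> \<Longrightarrow> h x = x" using Diff_cD(6)[OF h] by blast
    \<comment> \<open>Large enough to carry \<open>h\<close> inside, and to bound the contribution
      of \<open>c\<close>, at most \<open>B * \<bar>c\<bar> / \<rho>\<close>, by 1/4.\<close>
    define \<rho> where "\<rho> = R + 1 + 4 * B * \<bar>c\<bar>"
    have \<rho>: "R < \<rho>" "1 \<le> \<rho>" "4 * B * \<bar>c\<bar> \<le> \<rho>" using R(1) B(1) by (auto simp: \<rho>_def add_pos_nonneg)
    define p where "p = (\<lambda>x. \<zeta> ((1 / \<rho>) * x + 0) * ((a - 1) * x + c))"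
    define b where "b = (\<lambda>x. x + p x)"
    have Ck1: "Ck (Suc k) (\<lambda>x. \<zeta> ((1 / \<rho>) * x + 0))" by (intro Ck_compose[OF Ck\<zeta>] Ck_add Ck_mult Ck_const Ck_ident)
    have Ckp: "Ck (Suc k) p" unfolding p_def by (intro Ck_mult[OF Ck1] Ck_add Ck_mult Ck_const Ck_ident)
    have D: "(p has_real_derivative deriv \<zeta> (1 / \<rho> * x + 0) * (1 / \<rho>) * ((a - 1) * x + c) + (a - 1) * \<zeta> (1 / \<rho> * x + 0)) (at x)" for x
    proof -
      have "((\<lambda>x. \<zeta> ((1 / \<rho>) * x + 0)) has_real_derivative deriv \<zeta> (1 / \<rho> * x + 0) * (1 / \<rho>)) (at x)"
        using \<rho>(2) by (intro DERIV_chain2[OF Ck_has_deriv[OF Ck\<zeta>]]) (auto intro!: derivative_eq_intros)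
      moreover have "((\<lambda>x. (a - 1) * x + c) has_real_derivative a - 1) (at x)"
        by (auto intro!: derivative_eq_intros)
      ultimately show ?thesis unfolding p_def by (rule DERIV_mult)
    qed
    have dp: "\<bar>deriv p x\<bar> \<le> 1 / 2" for x
    proof (cases "2 * \<rho> < \<bar>x\<bar>")
      case True
      have "2 < \<bar>1 / \<rho> * x + 0\<bar>" using True \<rho> by (simp add: abs_divide pos_less_divide_eq)
      then have "deriv \<zeta> (1 / \<rho> * x + 0) = 0" "\<zeta> (1 / \<rho> * x + 0) = 0"
        using \<zeta>0 vanishes_outsideD[OF vanishes_outside_deriv[OF van]] by auto
      then show ?thesis using DERIV_imp_deriv[OF D[of x]] by simp
    next
      case False
      have *: "\<bar>1 / \<rho> * ((a - 1) * x + c)\<bar> \<le> \<kappa> * 2 + \<bar>c\<bar> / \<rho>"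
      proof -
        have "\<bar>(a - 1) * x + c\<bar> \<le> \<kappa> * (2 * \<rho>) + \<bar>c\<bar>"
          using mult_mono[OF a(1), of "\<bar>x\<bar>" "2 * \<rho>"] False \<kappa>(1) by (simp add: abs_mult order_trans[OF abs_triangle_ineq])
        then have "\<bar>(a - 1) * x + c\<bar> / \<rho> \<le> (\<kappa> * (2 * \<rho>) + \<bar>c\<bar>) / \<rho>"
          using \<rho> by (intro divide_right_mono) auto
        also have "\<dots> = \<kappa> * 2 + \<bar>c\<bar> / \<rho>" using \<rho> by (simp add: field_simps)
        finally show ?thesis using \<rho> by (simp add: abs_mult abs_divide)
      qed
      have "\<bar>deriv p x\<bar> = \<bar>deriv \<zeta> (1 / \<rho> * x + 0) * (1 / \<rho> * ((a - 1) * x + c)) + (a - 1) * \<zeta> (1 / \<rho> * x + 0)\<bar>"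
        unfolding DERIV_imp_deriv[OF D[of x]] by (simp only: mult.assoc)
      also have "\<dots> \<le> B * (\<kappa> * 2 + \<bar>c\<bar> / \<rho>) + \<kappa> * 1"
        by (rule order_trans[OF abs_triangle_ineq], unfold abs_mult[of "deriv \<zeta> (1 / \<rho> * x + 0)"] abs_mult[of "a - 1"])
          (intro add_mono mult_mono B * a \<zeta>le abs_ge_zero less_imp_le[OF \<kappa>(1)])
      also have "\<dots> = \<kappa> * (2 * B + 1) + B * \<bar>c\<bar> / \<rho>" by (simp add: algebra_simps)
      also have "B * \<bar>c\<bar> / \<rho> \<le> 1 / 4" using \<rho> by (simp add: pos_divide_le_eq)
      finally show ?thesis using \<kappa>(2) by simp
    qed
    have "b \<in> Dc" unfolding b_def
    proof (rule perturbation_Diff_c[OF Ck_Suc_imp_Ckalpha[OF Ckp] dp])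
      show "vanishes_outside (2 * \<rho>) p"
        using \<rho> \<zeta>0 by (auto simp: vanishes_outside_def p_def abs_divide pos_less_divide_eq)
    qed
    have agree: "b x = a * x + c" if "\<bar>x\<bar> \<le> \<rho>" for x
    proof -
      have "\<zeta> (1 / \<rho> * x + 0) = 1" using that \<rho> by (intro \<zeta>1) (simp add: abs_divide)
      then show ?thesis by (simp add: b_def p_def algebra_simps)
    qed
    have "affine_conj a c h = (\<lambda>x. b (h (finv b x)))"
    proof
      fix y
      show "affine_conj a c h y = b (h (finv b y))"
        unfolding affine_conj_def
        by (rule conj_eq_of_agree[OF \<open>b \<in> Dc\<close> h, where R = \<rho> and A = "\<lambda>x. a * x + c" and A' = "\<lambda>y. (y - c) / a"])
          (use R(2) \<rho> a agree in auto)
    qed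
    then show "affine_conj a c h \<doteq> h" using homologous_conj[OF \<open>b \<in> Dc\<close> h] by simp
  qed
qed

definition shift :: "real \<Rightarrow> (real \<Rightarrow> real) \<Rightarrow> real \<Rightarrow> real" where
  "shift c h = (\<lambda>x. h (x - c) + c)"

lemma shift_homologous:
  assumes "h \<in> Dc"
  shows "shift c h \<doteq> h"
proof -
  obtain \<kappa> where "0 < \<kappa>" "\<And>a c h. \<bar>a - 1\<bar> \<le> \<kappa> \<Longrightarrow> 0 < a \<Longrightarrow> h \<in> Dc \<Longrightarrow> affine_conj a c h \<doteq> h"
    using affine_conj_homologous_aux by blast
  then have "affine_conj 1 c h \<doteq> h" using assms by simp
  then show ?thesis by (simp add: affine_conj_def shift_def)
qed

text \<open>The n-th root of \<open>r\<close> tends to 1, so the dilation by \<open>r\<close> is an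
  iterate of dilations close to the identity.\<close>

lemma dilation_homologous:
  assumes "h \<in> Dc" "0 < r"
  shows "(\<lambda>x. r * h (x / r)) \<doteq> h"
proof -
  obtain \<kappa> where \<kappa>: "0 < \<kappa>" "\<And>a c h. \<bar>a - 1\<bar> \<le> \<kappa> \<Longrightarrow> 0 < a \<Longrightarrow> h \<in> Dc \<Longrightarrow> affine_conj a c h \<doteq> h"
    using affine_conj_homologous_aux by blast
  have "(\<lambda>n. root n r) \<longlonglongrightarrow> 1" by (rule LIMSEQ_root_const[OF assms(2)])
  then obtain N where N: "\<And>n. N \<le> n \<Longrightarrow> \<bar>root n r - 1\<bar> < \<kappa>"
    using \<kappa>(1) unfolding LIMSEQ_iff real_norm_def by blast
  define n where "n = Suc N"
  define a where "a = root n r"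
  have a: "\<bar>a - 1\<bar> \<le> \<kappa>" "0 < a" "a ^ n = r"
    using N[of n] assms(2) by (simp_all add: a_def n_def real_root_pow_pos del: power_Suc)
  have "(\<lambda>x. a ^ m * h (x / a ^ m)) \<doteq> h" for m
  proof (induction m)
    case 0
    then show ?case using homologous_refl[OF assms(1)] by simp
  next
    case (Suc m)
    have "affine_conj a 0 (\<lambda>x. a ^ m * h (x / a ^ m)) \<doteq> (\<lambda>x. a ^ m * h (x / a ^ m))"
      using Suc by (intro \<kappa>(2) a) (simp add: homologous_def)
    also have "affine_conj a 0 (\<lambda>x. a ^ m * h (x / a ^ m)) = (\<lambda>x. a ^ Suc m * h (x / a ^ Suc m))"
      using a(2) by (simp add: affine_conj_def fun_eq_iff mult.assoc)
    finally show ?case using Suc homologous_trans by blast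
  qed
  from this[of n] show ?thesis by (simp add: a(3))
qed

end

subsection \<open>Spreading out a diffeomorphism of class 1\<close>

text \<open>For the continuity of the map to be constructed, inverses must depend on the
  diffeomorphism in a Lipschitz way in C^0: \<open>f\<close> contracts by 1/2, so the error at most
  doubles.\<close>

lemma inverse_perturbation_close:
  assumes f: "Ck 1 f" "\<And>x. \<bar>deriv f x\<bar> \<le> 1 / 2" and close: "\<And>x. \<bar>f x - f' x\<bar> \<le> \<eta>"
    and v: "v + f v = x" "v' + f' v' = x"
  shows "\<bar>v - v'\<bar> \<le> 2 * \<eta>"
proof -
  have "norm (f v - f v') \<le> 1 / 2 * norm (v - v')"
  proof (rule field_differentiable_bound[of UNIV f "deriv f"])
    show "(f has_field_derivative deriv f z) (at z within UNIV)" for z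
      using Ck_has_deriv'[OF f(1), of z] by simp
  qed (use f in auto)
  then have 1: "\<bar>f v - f v'\<bar> \<le> 1 / 2 * \<bar>v - v'\<bar>" by simp
  have "v - v' = - ((f v - f v') + (f v' - f' v'))" using v by linarith
  then have "\<bar>v - v'\<bar> \<le> \<bar>f v - f v'\<bar> + \<bar>f v' - f' v'\<bar>"
    by (simp only: abs_minus_cancel abs_triangle_ineq)
  also have "\<dots> \<le> 1 / 2 * \<bar>v - v'\<bar> + \<eta>" by (intro add_mono 1 close)
  finally show ?thesis by simp
qed

section \<open>Reduction of the theorem to estimates with real constants\<close>

context modulus_order
begin

lemma homologous_eq_trans: "f = g \<Longrightarrow> g \<doteq> h \<Longrightarrow> h = h' \<Longrightarrow> f \<doteq> h'"
  by simp

text \<open>\<open>e\<close> is any real bound for the seminorm, which keeps the estimates inside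
  the reals; \<open>transferI\<close> returns to extended reals.\<close>

definition admissible :: "real \<Rightarrow> real \<Rightarrow> (real \<Rightarrow> real) \<Rightarrow> real \<Rightarrow> bool" where
  "admissible R \<delta> g e \<longleftrightarrow> g \<in> Dc \<and> vanishes_outside R (\<lambda>x. g x - x) \<and>
     holder_on e UNIV ((deriv ^^ k) (\<lambda>x. g x - x)) \<and> 0 \<le> e \<and> e < \<delta>"

lemma admissibleD:
  assumes "admissible R \<delta> g e"
  shows "g \<in> Dc" "vanishes_outside R (\<lambda>x. g x - x)" "holder_on e UNIV ((deriv ^^ k) (\<lambda>x. g x - x))" "0 \<le> e" "e < \<delta>"
    "Ck k (\<lambda>x. g x - x)" "Ckalpha k \<alpha> (\<lambda>x. g x - x)"
proof -
  show "g \<in> Dc" using assms by (simp add: admissible_def)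
  then have "Ckalpha k \<alpha> (\<lambda>x. g x + - 1 * x)"
    by (intro Ckalpha_add Ckalpha_mult Ckalpha_const Ckalpha_ident Diff_cD(4))
  then show "Ckalpha k \<alpha> (\<lambda>x. g x - x)" by simp
  then show "Ck k (\<lambda>x. g x - x)" by (rule Ckalpha_imp_Ck)
qed (use assms in \<open>simp_all add: admissible_def\<close>)

lemma Diff_c_minus_id: "g \<in> Dc \<Longrightarrow> Ck k (\<lambda>x. g x - x)"
  by (intro Ck_diff Diff_c_Ck Ck_ident)

lemma holder_seminorm_diff_const: "holder_seminorm \<alpha> S (\<lambda>x. f x - c) = holder_seminorm \<alpha> S f"
  by (simp add: holder_seminorm_def)

text \<open>As k is at least 1, the k-th derivative of the identity is constant, and Hoelder
  seminorms ignore constants. This links the neighbourhood, defined with g - id, to claim (1), about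
  the seminorm of the map itself.\<close>

lemma kalpha_seminorm_minus_id:
  assumes "Ck k g"
  shows "kalpha_seminorm k \<alpha> (\<lambda>x. g x - x) = kalpha_seminorm k \<alpha> g"
  unfolding kalpha_seminorm_def funpow_deriv_minus_id[OF assms] funpow_deriv_ident[OF k]
  by (rule holder_seminorm_diff_const)

lemma kalpha_seminorm_le_iff:
  assumes "Ck k g" "0 \<le> M"
  shows "kalpha_seminorm k \<alpha> g \<le> ennreal M \<longleftrightarrow> holder_on M UNIV ((deriv ^^ k) (\<lambda>x. g x - x))"
  using kalpha_seminorm_minus_id[OF assms(1)]
    holder_seminorm_le_iff_holder[OF assms(2), of UNIV "(deriv ^^ k) (\<lambda>x. g x - x)"]
  unfolding kalpha_seminorm_def by simp

lemma vanishes_outside_iff_supp: "vanishes_outside R (\<lambda>x. g x - x) \<longleftrightarrow> supp g \<subseteq> {-R..R}"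
  by (simp add: supp_subset_iff vanishes_outside_def)

lemma V_nbhd_admissible:
  assumes "g \<in> V_nbhd {-R..R} k \<alpha> \<delta>"
  obtains e where "admissible R \<delta> g e" "kalpha_seminorm k \<alpha> g = ennreal e"
proof -
  have g: "g \<in> Dc" "supp g \<subseteq> {-R..R}" "kalpha_seminorm k \<alpha> (\<lambda>x. g x - x) < ennreal \<delta>"
    using assms by (auto simp: V_nbhd_def Diff_on_def)
  have lt: "kalpha_seminorm k \<alpha> g < ennreal \<delta>"
    using g(3) by (simp add: kalpha_seminorm_minus_id[OF Diff_c_Ck[OF g(1)]])
  then have "kalpha_seminorm k \<alpha> g < \<infinity>" using less_top top.not_eq_extremum by fastforce
  then obtain e where e: "0 \<le> e" "kalpha_seminorm k \<alpha> g = ennreal e"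
    by (cases "kalpha_seminorm k \<alpha> g") auto
  have "e < \<delta>" using lt e by (simp add: ennreal_less_iff)
  moreover have "holder_on e UNIV ((deriv ^^ k) (\<lambda>x. g x - x))"
    using kalpha_seminorm_le_iff[OF Diff_c_Ck[OF g(1)] e(1)] e(2) by simp
  ultimately have "admissible R \<delta> g e"
    using g e(1) by (simp add: admissible_def vanishes_outside_iff_supp)
  then show ?thesis using e(2) by (rule that)
qed

lemma Ck_dist_less_imp:
  assumes "Ck_dist k f g < ennreal \<eta>" "0 < \<eta>"
  shows "\<bar>f x - g x\<bar> \<le> \<eta>"
proof -
  have "ennreal \<bar>f x - g x\<bar> \<le> sup_seminorm 0 (\<lambda>x. f x - g x)"
    unfolding sup_seminorm_def by (rule SUP_upper2[of x]) auto
  also have "\<dots> \<le> Ck_dist k f g"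
    unfolding Ck_dist_def by (rule SUP_upper) simp
  also have "\<dots> < ennreal \<eta>" by (rule assms(1))
  finally show ?thesis using assms(2) by (simp add: ennreal_less_iff)
qed

text \<open>The Hoelder bounds on \<^term>\<open>\<Psi> g\<close> are uniform, so by interpolation \<open>C\<^sup>0\<close>-continuity
  of \<^term>\<open>\<Psi>\<close> already gives \<open>C\<^sup>k\<close>-continuity.\<close>

lemma Ck_continuous_onI:
  assumes R: "0 \<le> R" and M: "0 \<le> M" and L: "0 \<le> L"
    and \<Psi>: "\<And>g. g \<in> S \<Longrightarrow> \<Psi> g \<in> Dc" "\<And>g. g \<in> S \<Longrightarrow> vanishes_outside R (\<lambda>x. \<Psi> g x - x)"
      "\<And>g. g \<in> S \<Longrightarrow> holder_on M UNIV ((deriv ^^ k) (\<lambda>x. \<Psi> g x - x))"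
    and lip: "\<And>f g \<eta> x. f \<in> S \<Longrightarrow> g \<in> S \<Longrightarrow> (\<And>x. \<bar>f x - g x\<bar> \<le> \<eta>) \<Longrightarrow> \<bar>\<Psi> f x - \<Psi> g x\<bar> \<le> L * \<eta>"
  shows "Ck_continuous_on k S \<Psi>"
  unfolding Ck_continuous_on_def
proof (intro ballI allI impI)
  fix f and \<epsilon> :: real assume f: "f \<in> S" and \<epsilon>: "0 < \<epsilon>"
  \<comment> \<open>The difference of two image maps has the seminorm bound M + M. A supremum
    inherits only weak inequalities, hence half of \<open>\<epsilon>\<close>.\<close>
  have "0 \<le> M + M" "0 < \<epsilon> / 2" using M \<epsilon> by auto
  from interpolation[OF R this, of k] obtain \<eta> where \<eta>: "0 < \<eta>" and
    small: "\<And>h i x. Ck k h \<Longrightarrow> vanishes_outside R h \<Longrightarrow> holder_on (M + M) UNIV ((deriv ^^ k) h) \<Longrightarrow>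
      (\<And>x. \<bar>h x\<bar> \<le> \<eta>) \<Longrightarrow> i \<le> k \<Longrightarrow> \<bar>(deriv ^^ i) h x\<bar> \<le> \<epsilon> / 2"
    by blast
  show "\<exists>\<eta>>0. \<forall>g\<in>S. Ck_dist k f g < ennreal \<eta> \<longrightarrow> Ck_dist k (\<Psi> f) (\<Psi> g) < ennreal \<epsilon>"
  proof (intro exI[of _ "\<eta> / (L + 1)"] conjI ballI impI)
    show pos: "0 < \<eta> / (L + 1)" using \<eta> L by simp
    fix g assume g: "g \<in> S" and d: "Ck_dist k f g < ennreal (\<eta> / (L + 1))"
    let ?h = "\<lambda>x. \<Psi> f x - \<Psi> g x"
    have h: "?h = (\<lambda>x. (\<Psi> f x - x) + - 1 * (\<Psi> g x - x))" by auto
    have Ck: "Ck k (\<lambda>x. \<Psi> f x - x)" "Ck k (\<lambda>x. - 1 * (\<Psi> g x - x))" "Ck k (\<lambda>x. \<Psi> g x - x)"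
      by (intro Diff_c_minus_id \<Psi>(1) f g Ck_mult[OF Ck_const])+
    have holder_on: "holder_on (M + M) UNIV ((deriv ^^ k) ?h)"
      unfolding h funpow_deriv_add[OF Ck(1,2)] funpow_deriv_cmult[OF Ck(3)]
      using holder_on_add[OF \<Psi>(3)[OF f] holder_on_cmult[OF \<Psi>(3)[OF g], of "- 1"]] by simp
    have sup: "\<bar>?h x\<bar> \<le> \<eta>" for x
    proof -
      have "\<bar>?h x\<bar> \<le> L * (\<eta> / (L + 1))"
        by (rule lip[OF f g]) (rule Ck_dist_less_imp[OF d pos])
      also have "\<dots> \<le> (L + 1) * (\<eta> / (L + 1))" using pos by (intro mult_right_mono) auto
      also have "\<dots> = \<eta>" using L by simp
      finally show ?thesis .
    qed
    have "vanishes_outside R ?h"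
      using \<Psi>(2)[OF f] \<Psi>(2)[OF g] by (auto simp: vanishes_outside_def)
    then have "\<bar>(deriv ^^ i) ?h x\<bar> \<le> \<epsilon> / 2" if "i \<le> k" for i x
      using Ck_diff[OF Diff_c_Ck[OF \<Psi>(1)[OF f]] Diff_c_Ck[OF \<Psi>(1)[OF g]]] holder_on sup that by (intro small)
    then have "Ck_dist k (\<Psi> f) (\<Psi> g) \<le> ennreal (\<epsilon> / 2)"
      unfolding Ck_dist_def sup_seminorm_def by (intro SUP_least ennreal_leI) auto
    also have "\<dots> < ennreal \<epsilon>" using \<epsilon> by (simp add: ennreal_less_iff)
    finally show "Ck_dist k (\<Psi> f) (\<Psi> g) < ennreal \<epsilon>" .
  qed
qed

text \<open>The common frame of both cases: class, support, a linear bound for the seminorm, and a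
  C^0 Lipschitz estimate suffice. The Lipschitz constant may depend on anything.\<close>

lemma transferI:
  assumes \<delta>: "0 < \<delta>" and C: "0 \<le> C" and R': "0 \<le> R'" and L: "0 \<le> L"
    and \<Psi>: "\<And>g e. admissible R \<delta> g e \<Longrightarrow> \<Psi> g \<doteq> g"
      "\<And>g e. admissible R \<delta> g e \<Longrightarrow> vanishes_outside R' (\<lambda>x. \<Psi> g x - x)"
      "\<And>g e. admissible R \<delta> g e \<Longrightarrow> holder_on (C * e) UNIV ((deriv ^^ k) (\<lambda>x. \<Psi> g x - x))"
    and lip: "\<And>f g e e' \<eta> x. admissible R \<delta> f e \<Longrightarrow> admissible R \<delta> g e' \<Longrightarrow> (\<And>x. \<bar>f x - g x\<bar> \<le> \<eta>) \<Longrightarrow>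
      \<bar>\<Psi> f x - \<Psi> g x\<bar> \<le> L * \<eta>"
  shows "\<exists>\<delta>>0. \<exists>\<Psi>. \<Psi> \<in> V_nbhd {-R..R} k \<alpha> \<delta> \<rightarrow> Diff_on {-R'..R'} k \<alpha> \<and>
    Ck_continuous_on k (V_nbhd {-R..R} k \<alpha> \<delta>) \<Psi> \<and>
    (\<forall>g \<in> V_nbhd {-R..R} k \<alpha> \<delta>. kalpha_seminorm k \<alpha> (\<Psi> g) \<le> ennreal C * kalpha_seminorm k \<alpha> g \<and>
       H1_class \<G> (\<Psi> g) = H1_class \<G> g)"
proof (intro exI[of _ \<delta>] exI[of _ \<Psi>] conjI \<delta> ballI)
  let ?V = "V_nbhd {-R..R} k \<alpha> \<delta>"
  have Dc: "\<Psi> g \<in> Dc" "vanishes_outside R' (\<lambda>x. \<Psi> g x - x)"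
    "holder_on (C * \<delta>) UNIV ((deriv ^^ k) (\<lambda>x. \<Psi> g x - x))" if g: "g \<in> ?V" for g
  proof -
    obtain e where e: "admissible R \<delta> g e" using V_nbhd_admissible[OF g] by blast
    show "\<Psi> g \<in> Dc" using \<Psi>(1)[OF e] by (simp add: homologous_def)
    show "vanishes_outside R' (\<lambda>x. \<Psi> g x - x)" by (rule \<Psi>(2)[OF e])
    have "C * e \<le> C * \<delta>" using admissibleD(5)[OF e] C by (simp add: mult_left_mono)
    with \<Psi>(3)[OF e] show "holder_on (C * \<delta>) UNIV ((deriv ^^ k) (\<lambda>x. \<Psi> g x - x))" by (rule holder_on_mono)
  qed
  show "\<Psi> \<in> ?V \<rightarrow> Diff_on {-R'..R'} k \<alpha>"
    using Dc(1,2) by (auto simp: Diff_on_def vanishes_outside_iff_supp)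
  show "Ck_continuous_on k ?V \<Psi>"
  proof (rule Ck_continuous_onI[OF R' _ L Dc])
    show "0 \<le> C * \<delta>" using C \<delta> by simp
    fix f g \<eta> x assume fg: "f \<in> ?V" "g \<in> ?V" and \<eta>: "\<And>x. \<bar>f x - g x\<bar> \<le> \<eta>"
    obtain e where e: "admissible R \<delta> f e" using V_nbhd_admissible[OF fg(1)] by blast
    obtain e' where e': "admissible R \<delta> g e'" using V_nbhd_admissible[OF fg(2)] by blast
    show "\<bar>\<Psi> f x - \<Psi> g x\<bar> \<le> L * \<eta>" by (rule lip[OF e e' \<eta>])
  qed
  fix g assume "g \<in> ?V"
  then obtain e where e: "admissible R \<delta> g e" "kalpha_seminorm k \<alpha> g = ennreal e"
    by (rule V_nbhd_admissible)
  have "0 \<le> C * e" using C admissibleD(4)[OF e(1)] by simp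
  then have "kalpha_seminorm k \<alpha> (\<Psi> g) \<le> ennreal (C * e)"
    using \<Psi>(3)[OF e(1)] kalpha_seminorm_le_iff[OF Diff_c_Ck[OF Dc(1)[OF \<open>g \<in> ?V\<close>]]] by blast
  then show "kalpha_seminorm k \<alpha> (\<Psi> g) \<le> ennreal C * kalpha_seminorm k \<alpha> g"
    using e(2) C by (simp add: ennreal_mult')
  show "H1_class \<G> (\<Psi> g) = H1_class \<G> g"
    using \<Psi>(1)[OF e(1)] by (simp add: homologous_def)
qed

text \<open>For \<open>k = 1\<close>, cut the path \<open>id + t f\<close> from the identity to \<open>g = id + f\<close> into \<open>A\<close> steps
  \<open>q i = id + (1/A) f \<circ> (id + (i/A) f)\<^sup>-\<^sup>1\<close>, and let these act on disjoint intervals instead of one after the other.\<close>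

definition path_inv :: "(real \<Rightarrow> real) \<Rightarrow> real \<Rightarrow> real \<Rightarrow> real" where
  "path_inv g t = finv (\<lambda>x. x + t * (g x - x))"

text \<open>Centres of A intervals of length 4 that tile [-2A, 2A].\<close>

definition spread_center :: "nat \<Rightarrow> nat \<Rightarrow> real" where
  "spread_center A i = 4 * real i + 2 - 2 * real A"

text \<open>The displacement of the i-th step, before the factor 1/A.\<close>

definition spread_bump :: "nat \<Rightarrow> (real \<Rightarrow> real) \<Rightarrow> nat \<Rightarrow> real \<Rightarrow> real" where
  "spread_bump A g i x = g (path_inv g (real i / real A) x) - path_inv g (real i / real A) x"

definition spread :: "nat \<Rightarrow> nat \<Rightarrow> (real \<Rightarrow> real) \<Rightarrow> real \<Rightarrow> real" where
  "spread A n g x = x + (\<Sum>i<n. 1 / real A * spread_bump A g i (x - spread_center A i))"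

text \<open>Keeps the derivative of g - id below 1/2 for supports in [-2, 2], so that the whole path
  consists of diffeomorphisms.\<close>

definition step_radius :: real where
  "step_radius = 1 / (2 * taylor_const k 2)"

lemma step_radius_pos: "0 < step_radius"
  using taylor_const_ge_1[of 2 k] by (simp add: step_radius_def)

context
  fixes g e
  assumes adm: "admissible 2 step_radius g e"
begin

private abbreviation "f \<equiv> \<lambda>x. g x - x"

lemma f_deriv_le: "\<bar>deriv f x\<bar> \<le> 1 / 2"
proof -
  have K: "1 \<le> taylor_const k 2" by (rule taylor_const_ge_1) simp
  have "Ckalpha_bound k UNIV (taylor_const k 2 * e) f"
    by (intro Ckalpha_bound_of_support admissibleD[OF adm]) auto
  then have "\<bar>deriv f x\<bar> \<le> taylor_const k 2 * e" using k by (intro Ckalpha_bound_deriv_le) auto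
  also have "\<dots> \<le> taylor_const k 2 * step_radius" using admissibleD(5)[OF adm] K by (intro mult_left_mono) auto
  also have "\<dots> = 1 / 2" using K by (simp add: step_radius_def)
  finally show ?thesis .
qed

lemma f_C1: "Ck 1 f"
  using admissibleD(6)[OF adm] k by (rule Ck_mono)

lemma f_eq_0: "2 \<le> \<bar>x\<bar> \<Longrightarrow> f x = 0"
  using continuous_eq_0_boundary[OF Ck_continuous[OF f_C1], of 2] vanishes_outsideD[OF admissibleD(2)[OF adm]] by simp

lemma path_deriv:
  assumes "0 \<le> t" "t \<le> 1"
  shows "deriv (\<lambda>x. t * f x) = (\<lambda>x. t * deriv f x)" "\<bar>deriv (\<lambda>x. t * f x) x\<bar> \<le> 1 / 2"
proof -
  show 1: "deriv (\<lambda>x. t * f x) = (\<lambda>x. t * deriv f x)"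
    using deriv_mult'[of 0 "\<lambda>x. t" f] f_C1 by simp
  show "\<bar>deriv (\<lambda>x. t * f x) x\<bar> \<le> 1 / 2"
    unfolding 1 abs_mult using mult_mono[of "\<bar>t\<bar>" 1 "\<bar>deriv f x\<bar>" "1 / 2"] assms f_deriv_le[of x] by simp
qed

lemma path_Diff_c:
  assumes "0 \<le> t" "t \<le> 1"
  shows "(\<lambda>x. x + t * f x) \<in> Dc"
proof (rule perturbation_Diff_c[of "\<lambda>x. t * f x" 2])
  show "Ckalpha k \<alpha> (\<lambda>x. t * f x)" by (intro Ckalpha_mult Ckalpha_const admissibleD(7)[OF adm])
  show "vanishes_outside 2 (\<lambda>x. t * f x)" using admissibleD(2)[OF adm] by (simp add: vanishes_outside_def)
qed (rule path_deriv(2)[OF assms])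

lemma path_inv_eq:
  assumes "0 \<le> t" "t \<le> 1"
  shows "path_inv g t x + t * f (path_inv g t x) = x" "path_inv g t (x + t * f x) = x"
  using Diff_cD(2,3)[OF path_Diff_c[OF assms]] by (simp_all add: path_inv_def)

lemma path_inv_Diff_c: "0 \<le> t \<Longrightarrow> t \<le> 1 \<Longrightarrow> path_inv g t \<in> Dc"
  unfolding path_inv_def by (intro Diff_c_inv path_Diff_c)

lemma spread_bump_eq_0:
  assumes "i \<le> A" "1 \<le> A" "2 \<le> \<bar>x\<bar>"
  shows "spread_bump A g i x = 0"
proof -
  have t: "0 \<le> real i / real A" "real i / real A \<le> 1" using assms by auto
  have "path_inv g (real i / real A) x = x"
    using path_inv_eq(2)[OF t, of x] f_eq_0[OF assms(3)] by simp
  then show ?thesis using f_eq_0[OF assms(3)] by (simp add: spread_bump_def)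
qed

lemma spread_step:
  assumes "i < A"
  shows "(\<lambda>x. x + 1 / real A * spread_bump A g i x) \<in> Dc"
    "x + real (Suc i) / real A * f x = (x + real i / real A * f x) + 1 / real A * spread_bump A g i (x + real i / real A * f x)"
proof -
  have t: "0 \<le> real i / real A" "real i / real A \<le> 1" "0 \<le> real (Suc i) / real A" "real (Suc i) / real A \<le> 1"
    using assms by auto
  let ?u = "path_inv g (real i / real A)"
  have "(\<lambda>x. ?u x + real (Suc i) / real A * f (?u x)) \<in> Dc"
    by (rule Diff_c_compose[OF path_Diff_c[OF t(3,4)] path_inv_Diff_c[OF t(1,2)]])
  moreover have "?u x + real (Suc i) / real A * f (?u x) = x + 1 / real A * spread_bump A g i x" for x
  proof -
    have "?u x + real (Suc i) / real A * f (?u x) = (?u x + real i / real A * f (?u x)) + 1 / real A * f (?u x)"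
      by (simp add: add_divide_distrib distrib_right)
    then show ?thesis unfolding path_inv_eq(1)[OF t(1,2)] spread_bump_def .
  qed
  ultimately show "(\<lambda>x. x + 1 / real A * spread_bump A g i x) \<in> Dc" by simp
  show "x + real (Suc i) / real A * f x = (x + real i / real A * f x) + 1 / real A * spread_bump A g i (x + real i / real A * f x)"
    unfolding spread_bump_def path_inv_eq(2)[OF t(1,2)] by (simp add: add_divide_distrib distrib_right)
qed

text \<open>The bumps have disjoint supports, so adding one is composing with a translated step; the
  translated step has the class of the step, and the steps compose to the path.\<close>

lemma spread_homologous_path:
  assumes "n \<le> A"
  shows "spread A n g \<doteq> (\<lambda>x. x + real n / real A * f x)"
  using assms
proof (induction n)
  case 0
  then show ?case using homologous_refl[OF Diff_c_id] by (simp add: spread_def)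
next
  case (Suc n)
  let ?c = "spread_center A n"
  let ?q = "\<lambda>x. x + 1 / real A * spread_bump A g n x"
  have nA: "n < A" using Suc.prems by simp
  have IH: "spread A n g \<doteq> (\<lambda>x. x + real n / real A * f x)" using Suc by simp
  then have D: "spread A n g \<in> Dc" by (simp add: homologous_def)
  have zero: "spread_bump A g i (x - spread_center A i) = 0" if "i \<le> A" "2 \<le> \<bar>x - spread_center A i\<bar>" for i x
    using spread_bump_eq_0[of i A "x - spread_center A i"] that nA by auto
  \<comment> \<open>On the interval of the new step the earlier bumps vanish.\<close>
  have far: "spread A n g x = x" if "\<bar>x - ?c\<bar> \<le> 2" for x
  proof -
    have "spread_bump A g i (x - spread_center A i) = 0" if i: "i < n" for i
    proof (rule zero)
      have "real i + 1 \<le> real n" using i by linarith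
      then show "2 \<le> \<bar>x - spread_center A i\<bar>"
        using \<open>\<bar>x - ?c\<bar> \<le> 2\<close> unfolding spread_center_def by linarith
    qed (use i nA in auto)
    then have "(\<Sum>i<n. 1 / real A * spread_bump A g i (x - spread_center A i)) = 0"
      by (intro sum.neutral) simp
    then show ?thesis by (simp only: spread_def add_0_right)
  qed
  have rec: "spread A (Suc n) g x = spread A n g x + 1 / real A * spread_bump A g n (x - ?c)" for x
    by (simp add: spread_def)
  have "spread A (Suc n) g x = shift ?c ?q (spread A n g x)" for x
  proof (cases "\<bar>x - ?c\<bar> \<le> 2")
    case True
    then show ?thesis by (simp add: rec far shift_def)
  next
    case False
    \<comment> \<open>The earlier part is increasing and fixes both ends of the new interval, so it
      keeps outside points on their side, where the new step does nothing.\<close>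
    have ends: "spread A n g (?c - 2) = ?c - 2" "spread A n g (?c + 2) = ?c + 2" by (auto intro: far)
    have "x \<le> ?c - 2 \<or> ?c + 2 \<le> x" using False by linarith
    then have "spread A n g x \<le> ?c - 2 \<or> ?c + 2 \<le> spread A n g x"
      using strict_mono_less_eq[OF Diff_cD(1)[OF D], of x "?c - 2"] strict_mono_less_eq[OF Diff_cD(1)[OF D], of "?c + 2" x]
      unfolding ends by blast
    then have "spread_bump A g n (spread A n g x - ?c) = 0" using nA by (intro zero) auto
    then have "shift ?c ?q (spread A n g x) = spread A n g x" by (simp add: shift_def)
    moreover have "spread_bump A g n (x - ?c) = 0" using False nA by (intro zero) auto
    ultimately show ?thesis by (simp add: spread_def)
  qed
  then have "spread A (Suc n) g = (\<lambda>x. shift ?c ?q (spread A n g x))" by (rule ext)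
  then show ?case
  proof (rule homologous_eq_trans)
    show "(\<lambda>x. shift ?c ?q (spread A n g x)) \<doteq> (\<lambda>x. ?q (x + real n / real A * f x))"
      by (rule homologous_compose[OF shift_homologous[OF spread_step(1)[OF nA]] IH])
    show "(\<lambda>x. ?q (x + real n / real A * f x)) = (\<lambda>x. x + real (Suc n) / real A * f x)"
      unfolding spread_step(2)[OF nA] ..
  qed
qed

text \<open>For k = 1 the top derivative is the first one, so no lower-order constants arise. The 8
  is 2, the Lipschitz constant of the inverse, times 4 for two denominators that are at least
  1/2.\<close>

lemma spread_bump_deriv:
  assumes "i < A" "k = 1"
  shows "((spread_bump A g i) has_real_derivative deriv (spread_bump A g i) x) (at x)"
    "holder_on (8 * e) UNIV (deriv (spread_bump A g i))"
proof -
  define t where "t = real i / real A"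
  have t: "0 \<le> t" "t \<le> 1" using assms by (auto simp: t_def)
  let ?u = "path_inv g t"
  have B: "spread_bump A g i = (\<lambda>x. f (?u x))" by (simp add: spread_bump_def fun_eq_iff t_def)
  have tf: "Ck 1 (\<lambda>x. t * f x)" by (intro Ck_mult Ck_const f_C1)
  have du: "(?u has_real_derivative 1 / (1 + t * deriv f (?u x))) (at x)" for x
  proof -
    have "((\<lambda>x. ?u x - x + x) has_real_derivative - (deriv (\<lambda>x. t * f x) (?u x) * (1 / (1 + deriv (\<lambda>x. t * f x) (?u x)))) + 1) (at x)"
      by (intro DERIV_add DERIV_ident inverse_perturbation_deriv tf path_deriv(2)[OF t] path_inv_eq[OF t])
    moreover have "1 + t * deriv f (?u x) \<noteq> 0"
      using path_deriv(2)[OF t, of "?u x"] unfolding path_deriv(1)[OF t] by auto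
    ultimately show ?thesis unfolding path_deriv(1)[OF t] by (simp add: field_simps)
  qed
  have D: "(spread_bump A g i has_real_derivative deriv f (?u x) * (1 / (1 + t * deriv f (?u x)))) (at x)" for x
    unfolding B by (rule DERIV_chain2[OF Ck_has_deriv'[OF f_C1] du]) simp
  show "(spread_bump A g i has_real_derivative deriv (spread_bump A g i) x) (at x)"
    using D[of x] DERIV_imp_deriv[OF D[of x]] by simp
  show "holder_on (8 * e) UNIV (deriv (spread_bump A g i))"
    unfolding deriv_eqI[OF D]
  proof (rule holder_onI)
    fix x y
    let ?p = "deriv f (?u x)" and ?q = "deriv f (?u y)"
    have low: "1 / 2 \<le> 1 + t * ?p" "1 / 2 \<le> 1 + t * ?q"
      using path_deriv(2)[OF t, of "?u x"] path_deriv(2)[OF t, of "?u y"] unfolding path_deriv(1)[OF t] by auto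
    have "?p * (1 / (1 + t * ?p)) - ?q * (1 / (1 + t * ?q)) = (?p - ?q) / ((1 + t * ?p) * (1 + t * ?q))"
      using low by (simp add: field_simps)
    then have "\<bar>?p * (1 / (1 + t * ?p)) - ?q * (1 / (1 + t * ?q))\<bar> = \<bar>?p - ?q\<bar> / ((1 + t * ?p) * (1 + t * ?q))"
      using low by (simp add: abs_mult)
    also have "\<dots> \<le> (2 * e * \<alpha> \<bar>x - y\<bar>) / (1 / 2 * (1 / 2))"
    proof (rule frac_le)
      have "holder_on (2 * e) UNIV (\<lambda>x. deriv f (?u x))"
      proof (rule holder_on_compose[where f = "deriv f" and t = ?u])
        show "holder_on e UNIV (deriv f)" using admissibleD(3)[OF adm] assms(2) by simp
        show "\<bar>?u x - ?u y\<bar> \<le> 2 * \<bar>x - y\<bar>" for x y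
          by (rule inverse_perturbation_lipschitz[OF tf path_deriv(2)[OF t] path_inv_eq(1)[OF t]])
      qed (use admissibleD(4)[OF adm] in auto)
      then show "\<bar>?p - ?q\<bar> \<le> 2 * e * \<alpha> \<bar>x - y\<bar>" by (auto dest: holder_onD)
      show "1 / 2 * (1 / 2) \<le> (1 + t * ?p) * (1 + t * ?q)" using low by (intro mult_mono) auto
      show "0 \<le> 2 * e * \<alpha> \<bar>x - y\<bar>" using admissibleD(4)[OF adm] by (simp add: alpha_nonneg)
    qed simp
    finally show "\<bar>?p * (1 / (1 + t * ?p)) - ?q * (1 / (1 + t * ?q))\<bar> \<le> 8 * e * \<alpha> \<bar>x - y\<bar>" by simp
  qed
qed

text \<open>At most one bump is alive at each of the two points compared, so only two of the A
  summands contribute: 16 = 2 * 8.\<close>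

lemma spread_holder:
  assumes "1 \<le> A" "k = 1"
  shows "holder_on (16 / real A * e) UNIV ((deriv ^^ k) (\<lambda>x. spread A A g x - x))"
proof -
  let ?b = "\<lambda>i x. deriv (spread_bump A g i) (x - spread_center A i)"
  have summand: "((\<lambda>x. 1 / real A * spread_bump A g i (x - spread_center A i)) has_real_derivative 1 / real A * ?b i x) (at x)"
    if "i \<in> {..<A}" for i x
  proof (rule DERIV_cmult)
    have "((\<lambda>x. spread_bump A g i (x - spread_center A i)) has_real_derivative ?b i x * (1 - 0)) (at x)"
      using that assms(2)
      by (intro DERIV_chain2[where f = "spread_bump A g i"] spread_bump_deriv(1) DERIV_diff DERIV_ident DERIV_const) auto
    then show "((\<lambda>x. spread_bump A g i (x - spread_center A i)) has_real_derivative ?b i x) (at x)" by simp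
  qed
  have D: "((\<lambda>x. spread A A g x - x) has_real_derivative (\<Sum>i<A. 1 / real A * ?b i x)) (at x)" for x
    unfolding spread_def add_diff_cancel_left' by (rule DERIV_sum) (rule summand)
  have zero: "?b i x = 0" if i: "i < A" and far: "2 \<le> \<bar>x - spread_center A i\<bar>" for i x
  proof (rule continuous_eq_0_boundary[OF _ _ far])
    have t: "0 \<le> real i / real A" "real i / real A \<le> 1" using i by auto
    have "Ck 1 (\<lambda>x. f (path_inv g (real i / real A) x))"
      by (rule Ck_compose[OF f_C1 Diff_c_C1[OF path_inv_Diff_c[OF t]]])
    then have "Ck 1 (spread_bump A g i)" unfolding spread_bump_def[abs_def] .
    then show "continuous_on UNIV (deriv (spread_bump A g i))" by (simp add: Ck_Suc Ck_0)
    have "vanishes_outside 2 (spread_bump A g i)"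
      using spread_bump_eq_0[of i A] i by (auto simp: vanishes_outside_def)
    then show "deriv (spread_bump A g i) y = 0" if "2 < \<bar>y\<bar>" for y
      using vanishes_outsideD[OF vanishes_outside_deriv that] by blast
  qed simp
  let ?N = "\<lambda>x. {i. i < A \<and> \<bar>x - spread_center A i\<bar> < 2}"
  have one: "card (?N x) \<le> 1" "finite (?N x)" for x
  proof -
    have "i = j" if "\<bar>x - spread_center A i\<bar> < 2" "\<bar>x - spread_center A j\<bar> < 2" for i j
    proof -
      have "\<bar>spread_center A i - spread_center A j\<bar> < 4" using that by linarith
      then have "\<bar>real i - real j\<bar> < 1" unfolding spread_center_def by linarith
      then show ?thesis by linarith
    qed
    then show "card (?N x) \<le> 1" by (auto simp: card_le_Suc0_iff_eq)
  qed simp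
  have "holder_on (16 / real A * e) UNIV (deriv (\<lambda>x. spread A A g x - x))"
    unfolding deriv_eqI[OF D]
  proof (rule holder_onI)
    fix x y
    let ?d = "\<lambda>i. 1 / real A * ?b i x - 1 / real A * ?b i y"
    let ?J = "?N x \<union> ?N y"
    have cJ: "real (card ?J) \<le> 2"
      using card_Un_le[of "?N x" "?N y"] one(1)[of x] one(1)[of y] by linarith
    have bound: "\<bar>?d i\<bar> \<le> 8 * e / real A * \<alpha> \<bar>x - y\<bar>" if "i \<in> ?J" for i
    proof -
      have "\<bar>?b i x - ?b i y\<bar> \<le> 8 * e * \<alpha> \<bar>(x - spread_center A i) - (y - spread_center A i)\<bar>"
        using spread_bump_deriv(2)[of i A] that assms(2) by (intro holder_onD[of _ UNIV]) auto
      then have "\<bar>?b i x - ?b i y\<bar> / real A \<le> 8 * e * \<alpha> \<bar>x - y\<bar> / real A"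
        by (intro divide_right_mono) auto
      moreover have "\<bar>?d i\<bar> = \<bar>?b i x - ?b i y\<bar> / real A"
        by (simp add: diff_divide_distrib[symmetric])
      ultimately show ?thesis by simp
    qed
    have nonneg: "0 \<le> 8 * e / real A * \<alpha> \<bar>x - y\<bar>"
      using admissibleD(4)[OF adm] by (simp add: alpha_nonneg)
    have eq: "(\<Sum>i<A. 1 / real A * ?b i x) - (\<Sum>i<A. 1 / real A * ?b i y) = (\<Sum>i\<in>?J. ?d i)"
      unfolding sum_subtractf[symmetric]
    proof (rule sum.mono_neutral_right)
      show "\<forall>i\<in>{..<A} - ?J. ?d i = 0"
      proof
        fix i assume "i \<in> {..<A} - ?J"
        then have "i < A" "2 \<le> \<bar>x - spread_center A i\<bar>" "2 \<le> \<bar>y - spread_center A i\<bar>" by auto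
        then show "?d i = 0" by (simp add: zero)
      qed
    qed auto
    have "\<bar>(\<Sum>i<A. 1 / real A * ?b i x) - (\<Sum>i<A. 1 / real A * ?b i y)\<bar> \<le> (\<Sum>i\<in>?J. \<bar>?d i\<bar>)"
      unfolding eq by (rule sum_abs)
    also have "\<dots> \<le> real (card ?J) * (8 * e / real A * \<alpha> \<bar>x - y\<bar>)"
      by (rule sum_bounded_above) (rule bound)
    also have "\<dots> \<le> 2 * (8 * e / real A * \<alpha> \<bar>x - y\<bar>)"
      by (rule mult_right_mono[OF cJ nonneg])
    finally show "\<bar>(\<Sum>i<A. 1 / real A * ?b i x) - (\<Sum>i<A. 1 / real A * ?b i y)\<bar> \<le> 16 / real A * e * \<alpha> \<bar>x - y\<bar>"
      by simp
  qed
  then show ?thesis by (simp add: assms(2))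
qed

lemma spread_vanishes_outside:
  assumes "1 \<le> A"
  shows "vanishes_outside (2 * real A) (\<lambda>x. spread A A g x - x)"
  unfolding vanishes_outside_def
proof (intro allI impI)
  fix x assume x: "2 * real A < \<bar>x\<bar>"
  have "spread_bump A g i (x - spread_center A i) = 0" if "i < A" for i
  proof (rule spread_bump_eq_0)
    have "real i + 1 \<le> real A" using that by linarith
    then show "2 \<le> \<bar>x - spread_center A i\<bar>" using x unfolding spread_center_def by linarith
  qed (use that assms in auto)
  then have "(\<Sum>i<A. 1 / real A * spread_bump A g i (x - spread_center A i)) = 0"
    by (intro sum.neutral) simp
  then show "spread A A g x - x = 0" by (simp only: spread_def add_0_right diff_self)
qed

end

text \<open>Each bump changes by at most \<open>\<eta>\<close> through the change of the inverse and
  by \<open>\<eta>\<close> through the change of \<open>g\<close>; the weights 1/A balance the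
  number of bumps.\<close>

lemma spread_close:
  assumes g: "admissible 2 step_radius g e" "admissible 2 step_radius g' e'"
    and close: "\<And>x. \<bar>g x - g' x\<bar> \<le> \<eta>" and A: "1 \<le> A"
  shows "\<bar>spread A A g x - spread A A g' x\<bar> \<le> 2 * \<eta>"
proof -
  have \<eta>: "0 \<le> \<eta>" using close[of 0] by linarith
  have bump: "\<bar>spread_bump A g i z - spread_bump A g' i z\<bar> \<le> 2 * \<eta>" if "i < A" for i z
  proof -
    define t where "t = real i / real A"
    have t: "0 \<le> t" "t \<le> 1" using that by (auto simp: t_def)
    let ?u = "path_inv g t z" and ?u' = "path_inv g' t z"
    have eq: "?u + t * (g ?u - ?u) = z" "?u' + t * (g' ?u' - ?u') = z"
      by (rule path_inv_eq(1)[OF g(1) t] path_inv_eq(1)[OF g(2) t])+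
    have C1: "Ck 1 (\<lambda>x. t * (g x - x))" by (intro Ck_mult Ck_const f_C1[OF g(1)])
    have "\<bar>t * (g x - x) - t * (g' x - x)\<bar> \<le> \<eta>" for x
    proof -
      have "\<bar>t * (g x - x) - t * (g' x - x)\<bar> = t * \<bar>g x - g' x\<bar>"
        using t by (simp add: abs_mult flip: right_diff_distrib)
      also have "\<dots> \<le> 1 * \<eta>" using t close[of x] by (intro mult_mono) auto
      finally show ?thesis by simp
    qed
    then have u: "\<bar>?u - ?u'\<bar> \<le> 2 * \<eta>"
      by (rule inverse_perturbation_close[where f = "\<lambda>x. t * (g x - x)" and f' = "\<lambda>x. t * (g' x - x)",
            OF C1 path_deriv(2)[OF g(1) t] _ eq])
    have "\<bar>(g ?u - ?u) - (g ?u' - ?u')\<bar> \<le> 1 / 2 * \<bar>?u - ?u'\<bar>"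
    proof -
      have "norm ((g ?u - ?u) - (g ?u' - ?u')) \<le> 1 / 2 * norm (?u - ?u')"
      proof (rule field_differentiable_bound[of UNIV "\<lambda>x. g x - x" "deriv (\<lambda>x. g x - x)"])
        show "((\<lambda>x. g x - x) has_field_derivative deriv (\<lambda>x. g x - x) w) (at w within UNIV)" for w
          using Ck_has_deriv'[OF f_C1[OF g(1)], of w] by simp
      qed (use f_deriv_le[OF g(1)] in auto)
      then show ?thesis by simp
    qed
    moreover have "1 / 2 * \<bar>?u - ?u'\<bar> \<le> \<eta>" using u by simp
    ultimately have 1: "\<bar>(g ?u - ?u) - (g ?u' - ?u')\<bar> \<le> \<eta>" by (rule order_trans)
    have 2: "\<bar>(g ?u' - ?u') - (g' ?u' - ?u')\<bar> \<le> \<eta>" using close[of ?u'] by simp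
    have "\<bar>p - r\<bar> \<le> 2 * \<eta>" if "\<bar>p - q\<bar> \<le> \<eta>" "\<bar>q - r\<bar> \<le> \<eta>" for p q r :: real
      using that by linarith
    from this[OF 1 2] show ?thesis by (simp only: spread_bump_def t_def)
  qed
  have eq: "spread A A g x - spread A A g' x = (\<Sum>i<A. 1 / real A *
      (spread_bump A g i (x - spread_center A i) - spread_bump A g' i (x - spread_center A i)))"
    by (simp add: spread_def right_diff_distrib sum_subtractf diff_divide_distrib)
  have "\<bar>spread A A g x - spread A A g' x\<bar> \<le> (\<Sum>i<A. \<bar>1 / real A *
      (spread_bump A g i (x - spread_center A i) - spread_bump A g' i (x - spread_center A i))\<bar>)"
    unfolding eq by (rule sum_abs)
  also have "\<dots> \<le> (\<Sum>i<A. 1 / real A * (2 * \<eta>))"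
  proof (rule sum_mono)
    fix i assume "i \<in> {..<A}"
    then show "\<bar>1 / real A * (spread_bump A g i (x - spread_center A i) - spread_bump A g' i (x - spread_center A i))\<bar>
        \<le> 1 / real A * (2 * \<eta>)"
      unfolding abs_mult using bump[of i "x - spread_center A i"] by (intro mult_mono) auto
  qed
  also have "\<dots> = 2 * \<eta>" using A by simp
  finally show ?thesis .
qed

lemma transfer_spread:
  assumes "k = 1" "1 \<le> A"
  shows "\<exists>\<delta>>0. \<exists>\<Psi>. \<Psi> \<in> V_nbhd {-2..2} k \<alpha> \<delta> \<rightarrow> Diff_on {- (2 * real A)..2 * real A} k \<alpha> \<and>
    Ck_continuous_on k (V_nbhd {-2..2} k \<alpha> \<delta>) \<Psi> \<and>
    (\<forall>g \<in> V_nbhd {-2..2} k \<alpha> \<delta>. kalpha_seminorm k \<alpha> (\<Psi> g) \<le> ennreal (16 / real A) * kalpha_seminorm k \<alpha> g \<and>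
       H1_class \<G> (\<Psi> g) = H1_class \<G> g)"
proof (rule transferI[OF step_radius_pos, where \<Psi> = "spread A A" and L = 2])
  fix g e assume g: "admissible 2 step_radius g e"
  show "spread A A g \<doteq> g" using spread_homologous_path[OF g, of A A] assms(2) by simp
  show "vanishes_outside (2 * real A) (\<lambda>x. spread A A g x - x)"
    by (rule spread_vanishes_outside[OF g assms(2)])
  show "holder_on (16 / real A * e) UNIV ((deriv ^^ k) (\<lambda>x. spread A A g x - x))"
    by (rule spread_holder[OF g assms(2,1)])
next
  fix f g e e' \<eta> x
  assume "admissible 2 step_radius f e" "admissible 2 step_radius g e'" "\<And>x. \<bar>f x - g x\<bar> \<le> \<eta>"
  then show "\<bar>spread A A f x - spread A A g x\<bar> \<le> 2 * \<eta>" using assms(2) by (rule spread_close)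
qed auto

end

subsection \<open>Rolling up\<close>

context modulus_order
begin

text \<open>The support radius 3A of \<open>balanced g\<close> plus a margin of 12: the two
  outermost translates do nothing on (-12, 12).\<close>

definition roll_half :: "nat \<Rightarrow> nat" where
  "roll_half A = 3 * A + 12"

definition roll_len :: "nat \<Rightarrow> nat" where
  "roll_len A = 2 * roll_half A + 1"

definition roll_radius :: "nat \<Rightarrow> real" where
  "roll_radius A = real (roll_half A) + 1 + 3 * real A"

primrec local_const :: "nat \<Rightarrow> real" where
  "local_const 0 = 1 + \<alpha> 5"
| "local_const (Suc n) = 1 + 5 * local_const n"

lemma local_const_ge_1: "1 \<le> local_const n"
  by (induction n) (auto simp: alpha_nonneg)

text \<open>Integration as in \<open>Ckalpha_bound_of_support\<close>, but starting at points of
  [0, 1]. From there all of [-4, 4] lies within distance 5, so the constant does not depend on the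
  support.\<close>

lemma Ckalpha_bound_of_small_values:
  "Ck n F \<Longrightarrow> holder_on E UNIV ((deriv ^^ n) F) \<Longrightarrow> 0 \<le> E \<Longrightarrow> (\<And>i. i \<le> n \<Longrightarrow> \<exists>x\<in>{0..1}. \<bar>(deriv ^^ i) F x\<bar> \<le> E) \<Longrightarrow>
    Ckalpha_bound n {-4..4} (local_const n * E) F"
proof (induction n arbitrary: F)
  case 0
  obtain z where z: "z \<in> {0..1}" "\<bar>F z\<bar> \<le> E" using 0(4)[of 0] by auto
  have "\<bar>F x\<bar> \<le> (1 + \<alpha> 5) * E" if x: "x \<in> {-4..4}" for x
  proof -
    have "\<bar>F x - F z\<bar> \<le> E * \<alpha> \<bar>x - z\<bar>" using 0(2) by (auto intro: holder_onD)
    also have "\<dots> \<le> E * \<alpha> 5" using x z by (intro mult_left_mono alpha_mono 0(3)) auto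
    finally have "\<bar>F x\<bar> \<le> E + E * \<alpha> 5" using z(2) by linarith
    then show ?thesis by (simp add: algebra_simps)
  qed
  moreover have "1 * E \<le> (1 + \<alpha> 5) * E" by (intro mult_right_mono 0(3)) (simp add: alpha_nonneg)
  then have "holder_on ((1 + \<alpha> 5) * E) UNIV F" using holder_on_mono[of E UNIV F] 0(2) by simp
  then have "holder_on ((1 + \<alpha> 5) * E) {-4..4} F" by (simp add: holder_on_def)
  ultimately show ?case by simp
next
  case (Suc n)
  obtain z where z: "z \<in> {0..1}" "\<bar>F z\<bar> \<le> E" using Suc.prems(4)[of 0] by auto
  have d: "Ckalpha_bound n {-4..4} (local_const n * E) (deriv F)"
  proof (rule Suc.IH)
    show "\<exists>x\<in>{0..1}. \<bar>(deriv ^^ i) (deriv F) x\<bar> \<le> E" if "i \<le> n" for i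
      using Suc.prems(4)[of "Suc i"] that unfolding funpow_deriv_Suc by simp
    show "holder_on E UNIV ((deriv ^^ n) (deriv F))" using Suc.prems(2) unfolding funpow_deriv_Suc .
  qed (use Suc.prems in \<open>auto simp: Ck_Suc[of n]\<close>)
  have L: "0 \<le> local_const n * E" using local_const_ge_1[of n] Suc.prems(3) by simp
  have eq: "local_const (Suc n) * E = E + 5 * (local_const n * E)" by (simp add: algebra_simps)
  have "\<bar>F x\<bar> \<le> local_const (Suc n) * E" if x: "x \<in> {-4..4}" for x
  proof -
    have "\<bar>F x - F z\<bar> \<le> local_const n * E * \<bar>x - z\<bar>"
      using Ck_mono[OF Suc.prems(1), of 1] Ckalpha_bound_abs_le[OF d] x z
      by (intro deriv_bound_imp_lipschitz[of F "{-4..4}"]) auto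
    also have "\<dots> \<le> local_const n * E * 5" using x z by (intro mult_left_mono L) auto
    finally show ?thesis unfolding eq using z(2) by linarith
  qed
  moreover have "Ckalpha_bound n {-4..4} (local_const (Suc n) * E) (deriv F)"
    by (rule Ckalpha_bound_mono[OF d]) (use eq L Suc.prems(3) in linarith)
  ultimately show ?case by simp
qed

text \<open>The mean of \<open>f = g - id\<close> is killed to first order: it contributes twice through \<open>g \<circ> g\<close>,
  and pushing forward by the dilation by \<open>\<surd>2\<close> multiplies it by 2.\<close>

definition balanced :: "(real \<Rightarrow> real) \<Rightarrow> real \<Rightarrow> real" where
  "balanced g x = g (g (sqrt 2 * finv g (x / sqrt 2)))"

primrec roll :: "nat \<Rightarrow> (real \<Rightarrow> real) \<Rightarrow> nat \<Rightarrow> real \<Rightarrow> real" where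
  "roll A h 0 = (\<lambda>x. x)"
| "roll A h (Suc n) = (\<lambda>x. roll A h n (shift (real n - real (roll_half A)) h x))"

lemma shift_Diff_c: "h \<in> Dc \<Longrightarrow> shift c h \<in> Dc"
  using shift_homologous by (auto simp: homologous_def)

lemma roll_Diff_c: "h \<in> Dc \<Longrightarrow> roll A h n \<in> Dc"
  by (induction n) (simp_all add: Diff_c_id Diff_c_compose shift_Diff_c)

text \<open>Conjugation by the unit translation renumbers the factors: every index drops by one, so
  a factor with a new lowest index appears on the outside and the last one is lost.\<close>

lemma shift_roll:
  "roll A h (Suc n) (x + 1) - 1 = shift (- real (roll_half A) - 1) h (roll A h n x)"
proof (induction n arbitrary: x)
  case 0
  then show ?case by (simp add: shift_def algebra_simps)
next
  case (Suc n)
  have "roll A h (Suc (Suc n)) (x + 1) = roll A h (Suc n) (shift (real (Suc n) - real (roll_half A)) h (x + 1))"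
    by simp
  also have "shift (real (Suc n) - real (roll_half A)) h (x + 1) = shift (real n - real (roll_half A)) h x + 1"
    by (simp add: shift_def algebra_simps)
  finally show ?case using Suc.IH[of "shift (real n - real (roll_half A)) h x"] by simp
qed

text \<open>Dilation preserves classes, so the class is [g] + [g] - [g].\<close>

lemma balanced_homologous:
  assumes "g \<in> Dc"
  shows "balanced g \<doteq> g"
proof -
  have X: "(\<lambda>x. sqrt 2 * finv g (x / sqrt 2)) \<doteq> finv g"
    by (rule dilation_homologous[OF Diff_c_inv[OF assms]]) simp
  have "(\<lambda>x. g (g (sqrt 2 * finv g (x / sqrt 2)))) \<doteq> (\<lambda>x. g (g (finv g x)))"
    by (rule homologous_compose[OF homologous_refl[OF assms] homologous_compose[OF homologous_refl[OF assms] X]])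
  then show ?thesis unfolding balanced_def[abs_def] by (simp add: Diff_cD(2)[OF assms])
qed

lemma holder_on_shift:
  assumes "h \<in> Dc" "holder_on e UNIV ((deriv ^^ k) (\<lambda>x. h x - x))"
  shows "holder_on e UNIV ((deriv ^^ k) (\<lambda>x. shift c h x - x))"
proof -
  have eq: "(\<lambda>x. shift c h x - x) = (\<lambda>x. (\<lambda>y. h y - y) (1 * x + - c))" by (auto simp: shift_def)
  have "(deriv ^^ k) (\<lambda>x. shift c h x - x) = (\<lambda>x. (deriv ^^ k) (\<lambda>y. h y - y) (x - c))"
    unfolding eq funpow_deriv_affine[OF Diff_c_minus_id[OF assms(1)]] by simp
  moreover have "holder_on e UNIV (\<lambda>x. (deriv ^^ k) (\<lambda>y. h y - y) (x - c))"
    by (rule holder_onI, rule order_trans[OF holder_onD[OF assms(2)]]) simp_all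
  ultimately show ?thesis by simp
qed

text \<open>The k-th derivative is scaled by r^(1 - k), at most 1 because k is at least 1, and its
  argument is contracted.\<close>

lemma holder_on_dilation:
  assumes h: "h \<in> Dc" "holder_on e UNIV ((deriv ^^ k) (\<lambda>x. h x - x))" and e: "0 \<le> e" and r: "1 \<le> r"
  shows "holder_on e UNIV ((deriv ^^ k) (\<lambda>x. r * h (x / r) - x))"
proof -
  have Ck: "Ck k (\<lambda>y. h y - y)" by (rule Diff_c_minus_id[OF h(1)])
  have eq: "(\<lambda>x. r * h (x / r) - x) = (\<lambda>x. r * (\<lambda>y. h y - y) ((1 / r) * x + 0))"
    using r by (auto simp: algebra_simps)
  have Ck': "Ck k (\<lambda>x. (\<lambda>y. h y - y) ((1 / r) * x + 0))"
    by (rule Ck_compose[OF Ck]) (intro Ck_add Ck_mult Ck_const Ck_ident)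
  have D: "(deriv ^^ k) (\<lambda>x. r * h (x / r) - x) = (\<lambda>x. r * ((1 / r) ^ k * (deriv ^^ k) (\<lambda>y. h y - y) ((1 / r) * x + 0)))"
    unfolding eq funpow_deriv_cmult[OF Ck'] funpow_deriv_affine[OF Ck] ..
  have H: "holder_on (\<bar>r\<bar> * (\<bar>(1 / r) ^ k\<bar> * (1 * e))) UNIV (\<lambda>x. r * ((1 / r) ^ k * (deriv ^^ k) (\<lambda>y. h y - y) ((1 / r) * x + 0)))"
  proof (intro holder_on_cmult holder_on_compose[OF h(2) e])
    fix x y
    have "\<bar>(1 / r * x + 0) - (1 / r * y + 0)\<bar> = \<bar>x - y\<bar> / r"
      using r by (simp add: abs_divide flip: diff_divide_distrib)
    also have "\<dots> \<le> \<bar>x - y\<bar> / 1" using r by (intro divide_left_mono) auto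
    finally show "\<bar>(1 / r * x + 0) - (1 / r * y + 0)\<bar> \<le> 1 * \<bar>x - y\<bar>" by simp
  qed simp
  have le: "\<bar>r\<bar> * (\<bar>(1 / r) ^ k\<bar> * (1 * e)) \<le> e"
  proof -
    have "(1 / r) ^ k \<le> (1 / r) ^ 1" using r k by (intro power_decreasing) auto
    then have "r * (1 / r) ^ k \<le> 1" using r by (simp add: field_simps)
    then have "(r * (1 / r) ^ k) * e \<le> 1 * e" by (intro mult_right_mono e)
    then show ?thesis using r by (simp add: mult.assoc)
  qed
  show ?thesis unfolding D by (rule holder_on_mono[OF H le])
qed

text \<open>The second-order term is charged to \<open>q\<close>. If \<open>p\<close> is a long
  product and \<open>q\<close> its next factor, each factor then costs twice its own bound, whatever
  the length.\<close>

lemma holder_on_compose_Diff_c: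
  assumes p: "p \<in> Dc" "vanishes_outside R (\<lambda>x. p x - x)" "holder_on e1 UNIV ((deriv ^^ k) (\<lambda>x. p x - x))"
    and q: "q \<in> Dc" "vanishes_outside R (\<lambda>x. q x - x)" "holder_on e2 UNIV ((deriv ^^ k) (\<lambda>x. q x - x))"
    and e: "0 \<le> R" "0 \<le> e1" "0 \<le> e2" "e2 \<le> 1" "compose_err k R * e1 \<le> 1"
  shows "vanishes_outside R (\<lambda>x. p (q x) - x)" "holder_on (e1 + 2 * e2) UNIV ((deriv ^^ k) (\<lambda>x. p (q x) - x))"
proof -
  show "vanishes_outside R (\<lambda>x. p (q x) - x)" using p(2) q(2) by (auto simp: vanishes_outside_def)
  have "holder_on (e2 + e1 + compose_err k R * (e1 * e2)) UNIV ((deriv ^^ k) (\<lambda>x. (q x - x) + (p (x + (q x - x)) - (x + (q x - x)))))"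
    by (rule holder_on_compose_sum[OF k e(1) Diff_c_minus_id[OF p(1)] Diff_c_minus_id[OF q(1)] p(2) q(2) p(3) q(3) e(2-4)])
  then have "holder_on (e2 + e1 + compose_err k R * (e1 * e2)) UNIV ((deriv ^^ k) (\<lambda>x. p (q x) - x))" by simp
  moreover have "(compose_err k R * e1) * e2 \<le> 1 * e2" by (rule mult_right_mono[OF e(5,3)])
  ultimately show "holder_on (e1 + 2 * e2) UNIV ((deriv ^^ k) (\<lambda>x. p (q x) - x))"
    by (elim holder_on_mono) (simp add: mult.assoc)
qed

end

text \<open>The step function and its two constants are independent of A, whereas
  \<open>\<delta>\<close> may depend on it. Each condition in \<open>small\<close> has the form
  \<open>a * \<delta> \<le> 1\<close>, so \<open>small_multiplier_exists\<close> meets all of them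
  at once.\<close>

locale rolling = modulus_order +
  fixes A :: nat and \<theta> :: "real \<Rightarrow> real" and c\<theta> c\<omega> \<delta> :: real
  assumes A: "1 \<le> A"
    and \<theta>: "Ck k \<theta>" "Ckalpha k \<alpha> \<theta>" "\<And>x. x \<le> - 1 \<Longrightarrow> \<theta> x = 0" "\<And>x. 1 \<le> x \<Longrightarrow> \<theta> x = 1" "\<And>x. \<bar>\<theta> x\<bar> \<le> 1"
      "\<And>x. \<bar>\<theta> (x + 1) - \<theta> x\<bar> \<le> 1"
    and c: "0 \<le> c\<theta>" "Ckalpha_bound k UNIV c\<theta> \<theta>" "0 \<le> c\<omega>" "Ckalpha_bound k UNIV c\<omega> (\<lambda>x. \<theta> (x + 1) - \<theta> x)"
    and inv_holder: "\<And>f v e. Ck k f \<Longrightarrow> Ck k v \<Longrightarrow> (\<And>x. v x + f (v x) = x) \<Longrightarrow> (\<And>x. v (x + f x) = x) \<Longrightarrow>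
      vanishes_outside (2 * real A) f \<Longrightarrow> holder_on e UNIV ((deriv ^^ k) f) \<Longrightarrow> 0 \<le> e \<Longrightarrow> e \<le> \<delta> \<Longrightarrow>
      holder_on (2 * e) UNIV ((deriv ^^ k) (\<lambda>x. v x - x))"
    and small: "24 * real (roll_len A) * \<delta> \<le> 1"
      "compose_err k (roll_radius A) * (24 * real (roll_len A)) * \<delta> \<le> 1"
      "2 * taylor_const k (roll_radius A) * (24 * real (roll_len A)) * \<delta> \<le> 1"
      "102 * real (roll_len A) * (taylor_const k (roll_radius A))\<^sup>2 * \<delta> \<le> 1"
      "2 * (product_const k * c\<theta> * taylor_const k (roll_radius A) * (24 * real (roll_len A))) * \<delta> \<le> 1"
      "product_const k * c\<theta> * taylor_const k (roll_radius A) * (24 * real (roll_len A)) / inverse_radius k * \<delta> \<le> 1"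
      "inverse_const k * (product_const k * c\<theta> * taylor_const k (roll_radius A) * (24 * real (roll_len A))) * \<delta> \<le> 1"
      "product_const k * c\<omega> * local_const k * (24 * real (roll_len A)) * \<delta> \<le> 1"
begin

abbreviation "M \<equiv> roll_half A"
abbreviation "N \<equiv> roll_len A"
abbreviation "\<rho> \<equiv> roll_radius A"
abbreviation "K \<equiv> taylor_const k (roll_radius A)"

lemma radius: "0 \<le> \<rho>" "2 * real A \<le> \<rho>" "3 * real A \<le> \<rho>" "real M + 3 * real A + 1 = \<rho>"
  by (auto simp: roll_radius_def roll_half_def)

lemma K: "1 \<le> K"
  by (rule taylor_const_ge_1[OF radius(1)])

text \<open>The number of translates is 6A + 25, at most 31A.\<close>

lemma N: "1 \<le> N" "real N \<le> 31 * real A"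
  using A by (auto simp: roll_len_def roll_half_def)

lemma sqrt2: "1 \<le> sqrt 2" "sqrt 2 \<le> 3 / 2" "0 < sqrt (2 :: real)"
proof -
  show "sqrt 2 \<le> 3 / 2" by (rule real_le_lsqrt) (simp_all add: power2_eq_square)
qed simp_all

context
  fixes g e
  assumes adm: "admissible (2 * real A) \<delta> g e"
begin

private lemma scaled:
  assumes "a * \<delta> \<le> 1" "0 \<le> a"
  shows "a * e \<le> 1"
  using assms mult_left_mono[of e \<delta> a] admissibleD(5)[OF adm] by linarith

lemma e_nonneg: "0 \<le> e"
  by (rule admissibleD(4)[OF adm])

lemma e_small: "24 * real N * e \<le> 1" "compose_err k \<rho> * (24 * real N * e) \<le> 1" "K * (24 * real N * e) \<le> 1 / 2"
    "102 * real N * (K * K) * e \<le> 1" "24 * e \<le> 24 * real N * e"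
    "product_const k * (c\<theta> * (K * (24 * real N * e))) \<le> 1 / 2"
    "product_const k * (c\<theta> * (K * (24 * real N * e))) \<le> inverse_radius k"
    "inverse_const k * (product_const k * (c\<theta> * (K * (24 * real N * e)))) \<le> 1"
    "product_const k * (c\<omega> * (local_const k * (24 * real N * e))) \<le> 1"
proof -
  note nn = compose_err_nonneg[OF radius(1), of k] K product_const_nonneg[of k] c inverse_const_ge_1[of k]
    local_const_ge_1[of k] inverse_radius_pos[of k]
  show "24 * real N * e \<le> 1" by (rule scaled[OF small(1)]) simp
  show "compose_err k \<rho> * (24 * real N * e) \<le> 1" using scaled[OF small(2)] nn by (simp add: mult.assoc)
  show "K * (24 * real N * e) \<le> 1 / 2" using scaled[OF small(3)] nn by (simp add: mult.assoc)
  show "102 * real N * (K * K) * e \<le> 1" using scaled[OF small(4)] nn by (simp add: power2_eq_square)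
  show "24 * e \<le> 24 * real N * e" using mult_right_mono[of 1 "real N" e] N(1) e_nonneg by simp
  show "product_const k * (c\<theta> * (K * (24 * real N * e))) \<le> 1 / 2"
    using scaled[OF small(5)] nn by (simp add: mult.assoc)
  have "product_const k * c\<theta> * K * (24 * real N) / inverse_radius k * e \<le> 1"
    using nn by (intro scaled[OF small(6)]) simp
  then show "product_const k * (c\<theta> * (K * (24 * real N * e))) \<le> inverse_radius k"
    using nn by (simp add: mult.assoc pos_divide_le_eq)
  show "inverse_const k * (product_const k * (c\<theta> * (K * (24 * real N * e)))) \<le> 1"
    using scaled[OF small(7)] nn by (simp add: mult.assoc)
  show "product_const k * (c\<omega> * (local_const k * (24 * real N * e))) \<le> 1"
    using scaled[OF small(8)] nn by (simp add: mult.assoc)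
qed

lemma g_Dc: "g \<in> Dc"
  by (rule admissibleD(1)[OF adm])

private abbreviation "\<phi> \<equiv> \<lambda>x. g x - x"

lemma phi_C1: "Ck 1 \<phi>"
  using admissibleD(6)[OF adm] k by (rule Ck_mono)

lemma phi_Ckalpha_bound: "Ckalpha_bound k UNIV (K * e) \<phi>"
  by (rule Ckalpha_bound_of_support[OF radius(1) e_nonneg admissibleD(6)[OF adm]
      vanishes_outside_mono[OF admissibleD(2)[OF adm] radius(2)] admissibleD(3)[OF adm]])

lemma phi_le: "\<bar>\<phi> x\<bar> \<le> K * e" "\<bar>deriv \<phi> x\<bar> \<le> K * e" "K * e \<le> 1 / 2"
proof -
  show "\<bar>\<phi> x\<bar> \<le> K * e" by (rule Ckalpha_bound_abs_le[OF phi_Ckalpha_bound]) simp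
  show "\<bar>deriv \<phi> x\<bar> \<le> K * e" by (rule Ckalpha_bound_deriv_le[OF phi_Ckalpha_bound k]) simp
  have "K * e \<le> K * (24 * real N * e)" using e_small(5) e_nonneg K by (intro mult_left_mono) auto
  then show "K * e \<le> 1 / 2" using e_small(3) by linarith
qed

lemma phi_half: "\<bar>deriv \<phi> x\<bar> \<le> 1 / 2"
  using phi_le(2,3) order_trans by blast

lemma finv_eq: "finv g x + \<phi> (finv g x) = x" "finv g (x + \<phi> x) = x"
  using Diff_cD(2,3)[OF g_Dc] by simp_all

lemma finv_vanishes: "vanishes_outside (2 * real A) (\<lambda>x. finv g x - x)"
  using admissibleD(2)[OF adm] finv_eq(2) unfolding vanishes_outside_def by (metis add.right_neutral diff_self)

lemma finv_holder: "holder_on (2 * e) UNIV ((deriv ^^ k) (\<lambda>x. finv g x - x))"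
  using admissibleD(5)[OF adm]
  by (intro inv_holder[OF admissibleD(6)[OF adm] Diff_c_Ck[OF Diff_c_inv[OF g_Dc]] finv_eq admissibleD(2,3)[OF adm] e_nonneg]) simp

private abbreviation "X \<equiv> \<lambda>x. sqrt 2 * finv g (x / sqrt 2)"

lemma X_Dc: "X \<in> Dc"
  using dilation_homologous[OF Diff_c_inv[OF g_Dc], of "sqrt 2"] by (simp add: homologous_def)

lemma X_vanishes: "vanishes_outside (3 * real A) (\<lambda>x. X x - x)"
  unfolding vanishes_outside_def
proof (intro allI impI)
  fix x assume x: "3 * real A < \<bar>x\<bar>"
  \<comment> \<open>The dilated support has radius 2 sqrt(2) A, rounded up to 3A.\<close>
  have "2 * real A * sqrt 2 \<le> 2 * real A * (3 / 2)" by (intro mult_left_mono sqrt2) simp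
  then have "2 * real A * sqrt 2 < \<bar>x\<bar>" using x by linarith
  then have "2 * real A < \<bar>x / sqrt 2\<bar>" by (simp add: abs_divide pos_less_divide_eq)
  then have "finv g (x / sqrt 2) = x / sqrt 2" using vanishes_outsideD[OF finv_vanishes] by fastforce
  then show "X x - x = 0" by simp
qed

lemma balanced_Dc: "balanced g \<in> Dc"
  using balanced_homologous[OF g_Dc] by (simp add: homologous_def)

text \<open>The inverse and its dilation cost 2e, a first \<open>g\<close> makes this e + 2 * 2e =
  5e, a second one e + 2 * 5e = 11e.\<close>

lemma balanced_bounds:
  "vanishes_outside (3 * real A) (\<lambda>x. balanced g x - x)" "holder_on (12 * e) UNIV ((deriv ^^ k) (\<lambda>x. balanced g x - x))"
proof -
  show van: "vanishes_outside (3 * real A) (\<lambda>x. balanced g x - x)"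
    using X_vanishes admissibleD(2)[OF adm] unfolding vanishes_outside_def balanced_def by auto
  have e: "24 * e \<le> 1" "compose_err k \<rho> * e \<le> 1"
  proof -
    show "24 * e \<le> 1" using e_small(1,5) by linarith
    have "e \<le> 24 * real N * e" using e_small(5) e_nonneg by linarith
    then have "compose_err k \<rho> * e \<le> compose_err k \<rho> * (24 * real N * e)"
      by (intro mult_left_mono compose_err_nonneg radius)
    then show "compose_err k \<rho> * e \<le> 1" using e_small(2) by linarith
  qed
  have vg: "vanishes_outside \<rho> \<phi>" by (rule vanishes_outside_mono[OF admissibleD(2)[OF adm] radius(2)])
  have X: "vanishes_outside \<rho> (\<lambda>x. X x - x)" "holder_on (2 * e) UNIV ((deriv ^^ k) (\<lambda>x. X x - x))"
    using e_nonneg by (auto intro!: vanishes_outside_mono[OF X_vanishes radius(3)]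
        holder_on_dilation[OF Diff_c_inv[OF g_Dc] finv_holder] sqrt2)
  have gX: "vanishes_outside \<rho> (\<lambda>x. g (X x) - x)" "holder_on (e + 2 * (2 * e)) UNIV ((deriv ^^ k) (\<lambda>x. g (X x) - x))"
    by (rule holder_on_compose_Diff_c[OF g_Dc vg admissibleD(3)[OF adm] X_Dc X radius(1) e_nonneg]; use e e_nonneg in linarith)+
  have 3: "holder_on (5 * e) UNIV ((deriv ^^ k) (\<lambda>x. g (X x) - x))" using gX(2) by simp
  have "holder_on (e + 2 * (5 * e)) UNIV ((deriv ^^ k) (\<lambda>x. g (g (X x)) - x))"
    by (rule holder_on_compose_Diff_c(2)[OF g_Dc vg admissibleD(3)[OF adm] Diff_c_compose[OF g_Dc X_Dc] gX(1) 3 radius(1) e_nonneg];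
        use e e_nonneg in linarith)
  then show "holder_on (12 * e) UNIV ((deriv ^^ k) (\<lambda>x. balanced g x - x))"
    unfolding balanced_def by (rule holder_on_mono) (use e_nonneg in simp)
qed

end

end

section \<open>The product of the translates and its first-order part\<close>

context rolling
begin

context
  fixes g e
  assumes adm: "admissible (2 * real A) \<delta> g e"
begin

private abbreviation "\<xi> \<equiv> \<lambda>x. g x - x"

lemma shift_balanced:
  assumes "n < N"
  defines "q \<equiv> shift (real n - real M) (balanced g)"
  shows "q \<in> Dc" "vanishes_outside \<rho> (\<lambda>x. q x - x)" "holder_on (12 * e) UNIV ((deriv ^^ k) (\<lambda>x. q x - x))"
proof -
  show "q \<in> Dc" unfolding q_def by (rule shift_Diff_c[OF balanced_Dc[OF adm]])
  show "holder_on (12 * e) UNIV ((deriv ^^ k) (\<lambda>x. q x - x))"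
    unfolding q_def by (rule holder_on_shift[OF balanced_Dc[OF adm] balanced_bounds(2)[OF adm]])
  show "vanishes_outside \<rho> (\<lambda>x. q x - x)"
    unfolding vanishes_outside_def
  proof (intro allI impI)
    fix x assume "\<rho> < \<bar>x\<bar>"
    moreover have "\<bar>real n - real M\<bar> \<le> real M" using assms(1) by (simp add: roll_len_def)
    ultimately have "3 * real A < \<bar>x - (real n - real M)\<bar>" using radius(4) by linarith
    from vanishes_outsideD[OF balanced_bounds(1)[OF adm] this] show "q x - x = 0"
      by (simp add: q_def shift_def)
  qed
qed

text \<open>Each translate adds twice its own bound 12e, by
  \<open>holder_on_compose_Diff_c\<close>.\<close>

lemma roll_bounds:
  "n \<le> N \<Longrightarrow> vanishes_outside \<rho> (\<lambda>x. roll A (balanced g) n x - x) \<and>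
    holder_on (24 * real n * e) UNIV ((deriv ^^ k) (\<lambda>x. roll A (balanced g) n x - x))"
proof (induction n)
  case 0
  have "(\<lambda>x::real. x - x) = (\<lambda>x. 0)" by simp
  then show ?case by (simp add: vanishes_outside_def funpow_deriv_const holder_on_def)
next
  case (Suc n)
  have nN: "n < N" using Suc.prems by simp
  note q = shift_balanced[OF nN]
  have IH: "vanishes_outside \<rho> (\<lambda>x. roll A (balanced g) n x - x)"
    "holder_on (24 * real n * e) UNIV ((deriv ^^ k) (\<lambda>x. roll A (balanced g) n x - x))"
    using Suc by auto
  have e: "0 \<le> e" by (rule e_nonneg[OF adm])
  have 1: "0 \<le> 24 * real n * e" "0 \<le> 12 * e" using e by auto
  have 2: "12 * e \<le> 1" using e_small(1,5)[OF adm] e by linarith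
  have "24 * real n * e \<le> 24 * real N * e" using nN e by (intro mult_right_mono) auto
  then have "compose_err k \<rho> * (24 * real n * e) \<le> compose_err k \<rho> * (24 * real N * e)"
    by (intro mult_left_mono compose_err_nonneg radius)
  then have 3: "compose_err k \<rho> * (24 * real n * e) \<le> 1" using e_small(2)[OF adm] by linarith
  have "24 * real (Suc n) * e = 24 * real n * e + 2 * (12 * e)" by (simp add: algebra_simps)
  then show ?case
    using holder_on_compose_Diff_c[OF roll_Diff_c[OF balanced_Dc[OF adm]] IH q radius(1) 1 2 3] by simp
qed

lemma roll_Ckalpha_bound:
  assumes "n \<le> N"
  shows "Ckalpha_bound k UNIV (K * (24 * real n * e)) (\<lambda>x. roll A (balanced g) n x - x)"
  using roll_bounds[OF assms] e_nonneg[OF adm]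
  by (intro Ckalpha_bound_of_support[OF radius(1)] Diff_c_minus_id roll_Diff_c balanced_Dc[OF adm]) auto

lemma roll_lipschitz:
  assumes "n \<le> N"
  shows "\<bar>(roll A (balanced g) n x - x) - (roll A (balanced g) n y - y)\<bar> \<le> K * (24 * real n * e) * \<bar>x - y\<bar>"
proof (rule deriv_bound_imp_lipschitz[of _ UNIV])
  show "Ck 1 (\<lambda>x. roll A (balanced g) n x - x)"
    using Diff_c_minus_id[OF roll_Diff_c[OF balanced_Dc[OF adm]]] k by (rule Ck_mono)
  show "\<bar>deriv (\<lambda>x. roll A (balanced g) n x - x) z\<bar> \<le> K * (24 * real n * e)" for z
    using Ckalpha_bound_deriv_le[OF roll_Ckalpha_bound[OF assms] k] by simp
qed auto

lemma phi_lipschitz: "\<bar>\<xi> x - \<xi> y\<bar> \<le> K * e * \<bar>x - y\<bar>"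
  using phi_C1[OF adm] phi_le(2)[OF adm] by (intro deriv_bound_imp_lipschitz[of \<xi> UNIV]) auto

text \<open>The part of the displacement of \<open>balanced g\<close> that is linear in g - id. Its
  integral vanishes: substituting x / sqrt 2 produces a second factor sqrt 2.\<close>

definition linear_part :: "real \<Rightarrow> real" where
  "linear_part x = 2 * \<xi> x - sqrt 2 * \<xi> (x / sqrt 2)"

text \<open>K e bounds g - id and its Lipschitz constant. The 7 is 2 for the inverse, plus 2 and 3
  for evaluating g - id at points displaced by at most 2 K e and 3 K e.\<close>

lemma balanced_linear_part:
  "\<bar>(balanced g x - x) - linear_part x\<bar> \<le> 7 * (K * e)\<^sup>2" "\<bar>balanced g x - x\<bar> \<le> 4 * (K * e)"
proof -
  define \<kappa> where "\<kappa> = K * e"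
  have \<kappa>: "0 \<le> \<kappa>" unfolding \<kappa>_def using K e_nonneg[OF adm] by simp
  note le = phi_le(1)[OF adm, folded \<kappa>_def] and lip = phi_lipschitz[folded \<kappa>_def]
  define y where "y = x / sqrt 2"
  define w where "w = finv g y - y"
  define a where "a = sqrt 2 * w"
  define b where "b = a + \<xi> (x + a)"
  have x: "x = sqrt 2 * y" by (simp add: y_def)
  have w: "w = - \<xi> (finv g y)" using finv_eq(1)[OF adm, of y] by (simp add: w_def)
  have wle: "\<bar>w\<bar> \<le> \<kappa>" unfolding w using le[of "finv g y"] by simp
  have "\<bar>\<xi> y - \<xi> (finv g y)\<bar> \<le> \<kappa> * \<bar>y - finv g y\<bar>" by (rule lip)
  also have "\<dots> \<le> \<kappa> * \<kappa>" using wle by (intro mult_left_mono \<kappa>) (simp add: w_def abs_minus_commute)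
  finally have "\<bar>w + \<xi> y\<bar> \<le> \<kappa> * \<kappa>" unfolding w by simp
  then have "sqrt 2 * \<bar>w + \<xi> y\<bar> \<le> 2 * (\<kappa> * \<kappa>)" using sqrt2 by (intro mult_mono) auto
  then have 1: "\<bar>a + sqrt 2 * \<xi> y\<bar> \<le> 2 * (\<kappa> * \<kappa>)"
    by (simp add: a_def abs_mult flip: distrib_left)
  have ale: "\<bar>a\<bar> \<le> 2 * \<kappa>" unfolding a_def abs_mult using sqrt2 wle by (intro mult_mono) auto
  have "\<bar>\<xi> (x + a) - \<xi> x\<bar> \<le> \<kappa> * \<bar>x + a - x\<bar>" by (rule lip)
  also have "\<dots> \<le> \<kappa> * (2 * \<kappa>)" using ale by (intro mult_left_mono \<kappa>) simp
  finally have 2: "\<bar>\<xi> (x + a) - \<xi> x\<bar> \<le> 2 * (\<kappa> * \<kappa>)" by simp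
  have "\<bar>b\<bar> \<le> \<bar>a\<bar> + \<bar>\<xi> (x + a)\<bar>" unfolding b_def by (rule abs_triangle_ineq)
  then have ble: "\<bar>b\<bar> \<le> 3 * \<kappa>" using ale le[of "x + a"] by linarith
  have "\<bar>\<xi> (x + b) - \<xi> x\<bar> \<le> \<kappa> * \<bar>x + b - x\<bar>" by (rule lip)
  also have "\<dots> \<le> \<kappa> * (3 * \<kappa>)" using ble by (intro mult_left_mono \<kappa>) simp
  finally have 3: "\<bar>\<xi> (x + b) - \<xi> x\<bar> \<le> 3 * (\<kappa> * \<kappa>)" by simp
  have "sqrt 2 * finv g (x / sqrt 2) = x + a"
    unfolding y_def[symmetric] a_def w_def by (subst x) (simp add: right_diff_distrib)
  moreover have "g (x + a) = x + b" by (simp add: b_def)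
  ultimately have h: "balanced g x - x = b + \<xi> (x + b)" by (simp add: balanced_def)
  have "(balanced g x - x) - linear_part x
      = (a + sqrt 2 * \<xi> y) + (\<xi> (x + a) - \<xi> x) + (\<xi> (x + b) - \<xi> x)"
    unfolding h linear_part_def y_def[symmetric] b_def by simp
  moreover have "\<bar>p + q + r\<bar> \<le> 7 * s" if "\<bar>p\<bar> \<le> 2 * s" "\<bar>q\<bar> \<le> 2 * s" "\<bar>r\<bar> \<le> 3 * s" for p q r s :: real
    using that by linarith
  ultimately show "\<bar>(balanced g x - x) - linear_part x\<bar> \<le> 7 * (K * e)\<^sup>2"
    using 1 2 3 unfolding \<kappa>_def[symmetric] power2_eq_square by metis
  have "\<bar>balanced g x - x\<bar> \<le> \<bar>b\<bar> + \<bar>\<xi> (x + b)\<bar>" unfolding h by (rule abs_triangle_ineq)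
  then show "\<bar>balanced g x - x\<bar> \<le> 4 * (K * e)"
    using ble le[of "x + b"] unfolding \<kappa>_def[symmetric] by linarith
qed

text \<open>A new factor errs by 7 (K e)^2 itself and displaces the argument of the earlier product,
  with Lipschitz constant 24 n K e, by at most 4 K e; 7 + 96 n is below 102 N.\<close>

lemma roll_linear_part:
  "n \<le> N \<Longrightarrow> \<bar>(roll A (balanced g) n x - x) - (\<Sum>i<n. linear_part (x - (real i - real M)))\<bar>
    \<le> real n * (102 * real N * (K * e)\<^sup>2)"
proof (induction n)
  case (Suc n)
  define \<kappa> where "\<kappa> = K * e"
  have \<kappa>: "0 \<le> \<kappa>" unfolding \<kappa>_def using K e_nonneg[OF adm] by simp
  define c where "c = real n - real M"
  define q where "q = balanced g (x - c) - (x - c)"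
  define Fn where "Fn = (\<lambda>x. roll A (balanced g) n x - x)"
  define S where "S = (\<Sum>i<n. linear_part (x - (real i - real M)))"
  have nN: "n \<le> N" "n < N" using Suc.prems by auto
  have 1: "\<bar>q - linear_part (x - c)\<bar> \<le> 7 * \<kappa>\<^sup>2"
    unfolding q_def \<kappa>_def by (rule balanced_linear_part(1))
  have q: "\<bar>q\<bar> \<le> 4 * \<kappa>" unfolding q_def \<kappa>_def by (rule balanced_linear_part(2))
  have "\<bar>Fn (x + q) - Fn x\<bar> \<le> K * (24 * real n * e) * \<bar>x + q - x\<bar>"
    unfolding Fn_def by (rule roll_lipschitz[OF nN(1)])
  also have "\<dots> \<le> K * (24 * real n * e) * (4 * \<kappa>)"
    using q K e_nonneg[OF adm] by (intro mult_left_mono mult_nonneg_nonneg) auto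
  also have "\<dots> = 96 * real n * \<kappa>\<^sup>2" by (simp add: \<kappa>_def power2_eq_square)
  finally have 2: "\<bar>Fn (x + q) - Fn x\<bar> \<le> 96 * real n * \<kappa>\<^sup>2" .
  have 3: "\<bar>Fn x - S\<bar> \<le> real n * (102 * real N * \<kappa>\<^sup>2)"
    unfolding Fn_def S_def \<kappa>_def using Suc by simp
  have "shift c (balanced g) x = x + q" by (simp add: shift_def q_def)
  then have "(roll A (balanced g) (Suc n) x - x) - (\<Sum>i<Suc n. linear_part (x - (real i - real M)))
      = (q - linear_part (x - c)) + (Fn (x + q) - Fn x) + (Fn x - S)"
    by (simp add: Fn_def S_def c_def)
  moreover have "7 * \<kappa>\<^sup>2 + 96 * real n * \<kappa>\<^sup>2 + real n * (102 * real N * \<kappa>\<^sup>2) \<le> real (Suc n) * (102 * real N * \<kappa>\<^sup>2)"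
  proof -
    have "(7 + 96 * real n) * \<kappa>\<^sup>2 \<le> (102 * real N) * \<kappa>\<^sup>2" using nN by (intro mult_right_mono) auto
    then show ?thesis by (simp add: algebra_simps)
  qed
  moreover have "\<bar>p + q + r\<bar> \<le> s" if "\<bar>p\<bar> \<le> p'" "\<bar>q\<bar> \<le> q'" "\<bar>r\<bar> \<le> r'" "p' + q' + r' \<le> s" for p q r p' q' r' s :: real
    using that by linarith
  ultimately show ?case using 1 2 3 unfolding \<kappa>_def[symmetric] by presburger
qed simp

text \<open>The integral over a period of the sum of the translates is the total integral of
  \<open>linear_part\<close>, that is 0. The proof puts this as the mean value theorem for an
  antiderivative.\<close>

lemma linear_part_sum_zero:
  obtains z where "0 < z" "z < 1" "(\<Sum>i<N. linear_part (z - (real i - real M))) = 0"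
proof -
  \<comment> \<open>An interval that contains all points x - (i - M) with x in [0, 1] in its
    interior.\<close>
  define c where "c = real M + 2"
  have "continuous_on {-c..c} \<xi>"
    using Ck_continuous[OF phi_C1[OF adm]] by (rule continuous_on_subset) simp
  then obtain Q where Q: "\<And>x. x \<in> {-c..c} \<Longrightarrow> (Q has_vector_derivative \<xi> x) (at x within {-c..c})"
    using antiderivative_continuous by blast
  have Q': "(Q has_real_derivative \<xi> x) (at x)" if "- c < x" "x < c" for x
  proof -
    have "at x within {-c..c} = at x" using that by (intro at_within_interior) auto
    then show ?thesis using Q[of x] that by (simp add: has_real_derivative_iff_has_vector_derivative)
  qed
  have Qconst: "Q b = Q a" if ab: "a < b" "- c < a" "b < c" "2 * real A < a \<or> b < - 2 * real A" for a b
  proof -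
    have "(Q has_real_derivative \<xi> x) (at x)" if "a \<le> x" "x \<le> b" for x
      using ab that by (intro Q') auto
    with ab(1) obtain z where z: "a < z" "z < b" "Q b - Q a = (b - a) * \<xi> z"
      using MVT2[of a b Q \<xi>] by blast
    have "2 * real A < \<bar>z\<bar>" using z(1,2) ab(4) by linarith
    then show ?thesis using z(3) vanishes_outsideD[OF admissibleD(2)[OF adm]] by simp
  qed
  \<comment> \<open>An antiderivative of \<open>linear_part\<close>; the factor sqrt 2 makes both
    coefficients equal to 2. On either side of the support \<open>Q x\<close> and
    \<open>Q (x / sqrt 2)\<close> are the same constant, so \<open>w\<close> vanishes there.\<close>
  define w where "w = (\<lambda>x. 2 * Q x - 2 * Q (x / sqrt 2))"
  have div: "\<bar>x / sqrt 2\<bar> \<le> \<bar>x\<bar>" for x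
  proof -
    have "\<bar>x\<bar> / sqrt 2 \<le> \<bar>x\<bar> / 1" using sqrt2 by (intro divide_left_mono) auto
    then show ?thesis by (simp add: abs_divide)
  qed
  have w': "(w has_real_derivative linear_part x) (at x)" if "- c < x" "x < c" for x
  proof -
    have "- c < x / sqrt 2" "x / sqrt 2 < c" using div[of x] that by linarith+
    then have "((\<lambda>x. Q (x / sqrt 2)) has_real_derivative \<xi> (x / sqrt 2) * (1 / sqrt 2)) (at x)"
      by (intro DERIV_chain2[where f = Q] Q' DERIV_cdivide DERIV_ident)
    then have "(w has_real_derivative 2 * \<xi> x - 2 * (\<xi> (x / sqrt 2) * (1 / sqrt 2))) (at x)"
      unfolding w_def using that by (intro DERIV_diff DERIV_cmult Q')
    moreover have "2 * (\<xi> (x / sqrt 2) * (1 / sqrt 2)) = sqrt 2 * \<xi> (x / sqrt 2)"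
    proof -
      have "2 / sqrt 2 = sqrt (2 :: real)" by (simp add: real_div_sqrt)
      then show ?thesis by (simp add: field_simps)
    qed
    ultimately show ?thesis by (simp add: linear_part_def)
  qed
  have sq: "2 * real A < x / sqrt 2" if "3 * real A < x" for x
  proof -
    have "2 * real A * sqrt 2 \<le> 2 * real A * (3 / 2)" by (intro mult_left_mono sqrt2) simp
    then have "2 * real A * sqrt 2 < x" using that by linarith
    then show ?thesis by (simp add: pos_less_divide_eq)
  qed
  have w0: "w x = 0" if "3 * real A < \<bar>x\<bar>" "\<bar>x\<bar> < c" for x
  proof (cases "0 < x")
    case True
    have "x / sqrt 2 < x" using True by (simp add: field_simps)
    moreover have "2 * real A < x / sqrt 2" using True that by (intro sq) simp
    moreover have "0 < x / sqrt 2" using True by simp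
    ultimately have "Q x = Q (x / sqrt 2)" using True that by (intro Qconst) auto
    then show ?thesis by (simp add: w_def)
  next
    case False
    have neg: "x < 0" using False that A by auto
    have "x < x / sqrt 2" using neg by (simp add: field_simps)
    moreover have "2 * real A < - x / sqrt 2" using neg that by (intro sq) simp
    moreover have "x / sqrt 2 < c" using div[of x] that by linarith
    ultimately have "Q (x / sqrt 2) = Q x" using neg that by (intro Qconst) auto
    then show ?thesis by (simp add: w_def)
  qed
  define W where "W = (\<lambda>x. \<Sum>i<N. w (x - (real i - real M)))"
  have "(W has_real_derivative (\<Sum>i<N. linear_part (x - (real i - real M)))) (at x)" if "0 \<le> x" "x \<le> 1" for x
    unfolding W_def
  proof (rule DERIV_sum)
    fix i assume "i \<in> {..<N}"
    then have "real i \<le> 2 * real M" by (simp add: roll_len_def)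
    then have "(w has_real_derivative linear_part (x - (real i - real M))) (at (x - (real i - real M)))"
      using that by (intro w') (auto simp: c_def)
    moreover have "((\<lambda>x. x - (real i - real M)) has_real_derivative 1) (at x)"
      by (auto intro!: derivative_eq_intros)
    ultimately show "((\<lambda>x. w (x - (real i - real M))) has_real_derivative linear_part (x - (real i - real M))) (at x)"
      using DERIV_chain2 by fastforce
  qed
  then obtain z where z: "0 < z" "z < 1" "W 1 - W 0 = (1 - 0) * (\<Sum>i<N. linear_part (z - (real i - real M)))"
    using MVT2[of 0 1 W "\<lambda>x. \<Sum>i<N. linear_part (x - (real i - real M))"] by auto
  \<comment> \<open>Consecutive translates telescope and leave the values of \<open>w\<close> at M +
    1 and -M, both beyond the support radius 3A.\<close>
  have "W 1 - W 0 = (\<Sum>i<N. w (real M + 1 - real i) - w (real M + 1 - real (Suc i)))"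
    unfolding W_def sum_subtractf[symmetric] by (intro sum.cong refl) (simp add: algebra_simps)
  also have "\<dots> = w (real M + 1 - real 0) - w (real M + 1 - real N)"
    by (rule sum_lessThan_telescope')
  also have "\<dots> = 0"
  proof -
    have "w (real M + 1) = 0" "w (- real M) = 0" by (rule w0; simp add: c_def roll_half_def)+
    moreover have "real M + 1 - real N = - real M" by (simp add: roll_len_def)
    ultimately show ?thesis by (simp only: of_nat_0 diff_0_right)
  qed
  finally show ?thesis using that z by simp
qed

text \<open>At the zero of the first-order part only a multiple of e^2 is left, and its factor,
  which depends on A, is absorbed by \<open>\<delta>\<close>.\<close>

lemma roll_small_value:
  "\<exists>z\<in>{0..1}. \<bar>roll A (balanced g) N z - z\<bar> \<le> 24 * real N * e"
proof -
  obtain z where z: "0 < z" "z < 1" "(\<Sum>i<N. linear_part (z - (real i - real M))) = 0"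
    by (rule linear_part_sum_zero)
  have "\<bar>roll A (balanced g) N z - z\<bar> \<le> real N * (102 * real N * (K * e)\<^sup>2)"
    using roll_linear_part[of N z] z(3) by simp
  also have "\<dots> = (102 * real N * (K * K) * e) * (real N * e)" by (simp add: power2_eq_square)
  also have "\<dots> \<le> 1 * (real N * e)"
    using e_small(4)[OF adm] e_nonneg[OF adm] by (intro mult_right_mono) auto
  also have "\<dots> \<le> 24 * real N * e" using e_nonneg[OF adm] by simp
  finally show ?thesis using z(1,2) by (intro bexI[of _ z]) auto
qed

end

end

section \<open>The compressed diffeomorphism\<close>

context rolling
begin

definition rolled_up :: "(real \<Rightarrow> real) \<Rightarrow> real \<Rightarrow> real" where
  "rolled_up g = roll A (balanced g) N"

definition transition :: "(real \<Rightarrow> real) \<Rightarrow> real \<Rightarrow> real" where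
  "transition g x = x + \<theta> x * (rolled_up g x - x)"

text \<open>With F = G - id and L = \<open>transition g\<close>, this is T^-1 L T x - L x wherever
  F(x + 1) = F(x).\<close>

definition bump :: "(real \<Rightarrow> real) \<Rightarrow> real \<Rightarrow> real" where
  "bump g x = (\<theta> (x + 1) - \<theta> x) * (rolled_up g x - x)"

text \<open>Near the origin this is T^-1 L T L^-1. The formula is used as the definition because
  that commutator also acts at the right end of G and has trivial class.\<close>

definition compressed :: "(real \<Rightarrow> real) \<Rightarrow> real \<Rightarrow> real" where
  "compressed g x = x + bump g (finv (transition g) x)"

lemma Ckalpha_bound_subset: "Ckalpha_bound n UNIV c h \<Longrightarrow> Ckalpha_bound n S c h"
  by (simp add: Ckalpha_bound_iff holder_on_def)

lemma Ck_step_diff: "Ck k (\<lambda>x. \<theta> (x + 1) - \<theta> x)"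
proof (rule Ck_diff)
  show "Ck k (\<lambda>x. \<theta> (x + 1))" by (rule Ck_compose[OF \<theta>(1)]) (intro Ck_add Ck_ident Ck_const)
qed (rule \<theta>(1))

context
  fixes g e
  assumes adm: "admissible (2 * real A) \<delta> g e"
begin

private abbreviation "G \<equiv> rolled_up g"
private abbreviation "F \<equiv> \<lambda>x. rolled_up g x - x"
private abbreviation "E \<equiv> 24 * real N * e"
private abbreviation "v \<equiv> finv (transition g)"

lemma E_nonneg: "0 \<le> E"
  using e_nonneg[OF adm] by simp

lemma G_Dc: "G \<in> Dc"
  unfolding rolled_up_def by (rule roll_Diff_c[OF balanced_Dc[OF adm]])

lemma F_vanishes: "vanishes_outside \<rho> F"
  using roll_bounds[OF adm, of N] by (simp add: rolled_up_def)

lemma F_holder: "holder_on E UNIV ((deriv ^^ k) F)"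
  using roll_bounds[OF adm, of N] by (simp add: rolled_up_def)

lemma F_Ckalpha_bound: "Ckalpha_bound k UNIV (K * E) F"
  unfolding rolled_up_def by (rule roll_Ckalpha_bound[OF adm order_refl])

lemma F_Ck: "Ck k F"
  by (rule Diff_c_minus_id[OF G_Dc])

lemma F_half: "\<bar>F x\<bar> \<le> 1 / 2"
  using Ckalpha_bound_abs_le[OF F_Ckalpha_bound, of x] e_small(3)[OF adm] by simp

lemma shift_far: "- 12 \<le> z \<Longrightarrow> shift (- real M - 1) (balanced g) z = z"
  using vanishes_outsideD[OF balanced_bounds(1)[OF adm], of "z + real M + 1"]
  by (simp add: shift_def roll_half_def algebra_simps)

lemma G_shift:
  assumes "x \<le> 10"
  shows "G (x + 1) - 1 = shift (- real M - 1) (balanced g) (G x)"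
proof -
  have len: "N = Suc (2 * M)" by (simp add: roll_len_def)
  have "3 * real A < \<bar>x - real M\<bar>" using assms unfolding roll_half_def by (simp add: abs_if)
  then have "balanced g (x - real M) = x - real M"
    using vanishes_outsideD[OF balanced_bounds(1)[OF adm]] by fastforce
  then have "G x = roll A (balanced g) (2 * M) x"
    unfolding rolled_up_def len by (simp add: shift_def)
  then show ?thesis
    using shift_roll[of A "balanced g" "2 * M" x] unfolding rolled_up_def len by simp
qed

text \<open>F moves points by at most 1/2, so G x is at least -12, out of reach of the extra factor
  produced by \<open>G_shift\<close>.\<close>

lemma F_periodic:
  assumes "- 11 \<le> x" "x \<le> 10"
  shows "F (x + 1) = F x"
proof -
  have "- 12 \<le> G x" using F_half[of x] assms(1) by linarith
  then show ?thesis using G_shift[OF assms(2)] shift_far by simp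
qed

text \<open>Rolle's theorem on one period. The value of F itself is not covered and comes from
  \<open>roll_small_value\<close>.\<close>

lemma F_deriv_zero:
  assumes "j < k"
  shows "\<exists>z\<in>{0..1}. (deriv ^^ Suc j) F z = 0"
proof -
  have Ckj: "Ck j F" by (rule Ck_mono[OF F_Ck]) (use assms in simp)
  have C1: "Ck 1 ((deriv ^^ j) F)"
    by (rule Ck_funpow_deriv, rule Ck_mono[OF F_Ck]) (use assms in simp)
  have "(deriv ^^ j) (\<lambda>x. F (1 * x + 1)) 0 = (deriv ^^ j) F 0"
    by (rule funpow_deriv_cong_on_open[of "{-11<..<10}"]) (use F_periodic in auto)
  then have eq: "(deriv ^^ j) F 1 = (deriv ^^ j) F 0"
    unfolding funpow_deriv_affine[OF Ckj] by simp
  obtain z where z: "0 < z" "z < 1" "(deriv ^^ j) F 1 - (deriv ^^ j) F 0 = (1 - 0) * deriv ((deriv ^^ j) F) z"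
    using MVT2[of 0 1 "(deriv ^^ j) F" "deriv ((deriv ^^ j) F)"] Ck_has_deriv'[OF C1] by auto
  then have "(deriv ^^ Suc j) F z = 0" using eq by simp
  then show ?thesis using z(1,2) by (intro bexI[of _ z]) auto
qed

lemma F_local: "Ckalpha_bound k {-4..4} (local_const k * E) F"
proof (rule Ckalpha_bound_of_small_values[OF F_Ck F_holder E_nonneg])
  fix i assume "i \<le> k"
  show "\<exists>x\<in>{0..1}. \<bar>(deriv ^^ i) F x\<bar> \<le> E"
  proof (cases i)
    case 0
    then show ?thesis using roll_small_value[OF adm] by (simp add: rolled_up_def)
  next
    case (Suc j)
    then obtain z where "z \<in> {0..1}" "(deriv ^^ i) F z = 0"
      using F_deriv_zero[of j] \<open>i \<le> k\<close> by auto
    then show ?thesis using E_nonneg by (intro bexI[of _ z]) simp_all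
  qed
qed

lemma bump_Ck: "Ck k (bump g)"
  unfolding bump_def[abs_def] by (rule Ck_mult[OF Ck_step_diff F_Ck])

lemma bump_vanishes: "vanishes_outside 2 (bump g)"
  unfolding vanishes_outside_def
proof (intro allI impI)
  fix x :: real assume "2 < \<bar>x\<bar>"
  then consider "1 \<le> x" | "x \<le> - 2" by linarith
  then show "bump g x = 0" by cases (simp_all add: bump_def \<theta>(3,4))
qed

text \<open>The support lies in [-2, 2], so the bound for F on [-4, 4] suffices. Its constants are
  free of A, which enters only through the number of translates in E.\<close>

lemma bump_Ckalpha_bound: "Ckalpha_bound k UNIV (product_const k * (c\<omega> * (local_const k * E))) (bump g)"
proof (rule Ckalpha_bound_extend[OF _ bump_vanishes])
  have L: "0 \<le> local_const k * E" by (rule mult_nonneg_nonneg[OF order_trans[OF zero_le_one local_const_ge_1] E_nonneg])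
  show "Ckalpha_bound k {-4..4} (product_const k * (c\<omega> * (local_const k * E))) (bump g)"
    unfolding bump_def[abs_def]
    by (rule Ckalpha_bound_mult[OF _ c(3) L Ck_step_diff F_Ck Ckalpha_bound_subset[OF c(4)] F_local]) simp
  show "0 \<le> product_const k * (c\<omega> * (local_const k * E))"
    by (intro mult_nonneg_nonneg[OF product_const_nonneg] mult_nonneg_nonneg[OF c(3)] L)
qed auto

lemma step_Ck: "Ck k (\<lambda>x. \<theta> x * F x)"
  by (rule Ck_mult[OF \<theta>(1) F_Ck])

text \<open>This function is not confined to the window, so K, which depends on A, appears; the
  bound serves only as a smallness condition.\<close>

lemma step_Ckalpha_bound: "Ckalpha_bound k UNIV (product_const k * (c\<theta> * (K * E))) (\<lambda>x. \<theta> x * F x)"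
  using K E_nonneg by (intro Ckalpha_bound_mult[OF _ c(1) _ \<theta>(1) F_Ck c(2) F_Ckalpha_bound]) auto

lemma step_deriv: "\<bar>deriv (\<lambda>x. \<theta> x * F x) x\<bar> \<le> 1 / 2"
  using Ckalpha_bound_deriv_le[OF step_Ckalpha_bound k, of x] e_small(6)[OF adm] by simp

lemma transition_Dc: "transition g \<in> Dc"
  unfolding transition_def[abs_def]
proof (rule perturbation_Diff_c[OF _ step_deriv])
  have "Ckalpha k \<alpha> (\<lambda>x. rolled_up g x + - 1 * x)"
    by (intro Ckalpha_add Ckalpha_mult Ckalpha_const Ckalpha_ident Diff_cD(4)[OF G_Dc])
  then show "Ckalpha k \<alpha> (\<lambda>x. \<theta> x * F x)" by (intro Ckalpha_mult[OF \<theta>(2)]) simp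
  show "vanishes_outside \<rho> (\<lambda>x. \<theta> x * F x)" using F_vanishes by (simp add: vanishes_outside_def)
qed

lemma v_eq: "v x + \<theta> (v x) * F (v x) = x" "v (x + \<theta> x * F x) = x"
  using Diff_cD(2,3)[OF transition_Dc] by (simp_all add: transition_def)

text \<open>The crude bound 1 is enough: it enters the final constant as
  \<open>compose_const k 1\<close>, which is free of A.\<close>

lemma v_Ckalpha_bound: "Ckalpha_bound k UNIV 1 (\<lambda>x. v x - x)"
proof (rule Ckalpha_bound_mono)
  have C1: "Ck 1 (\<lambda>x. \<theta> x * F x)" using step_Ck k by (rule Ck_mono)
  have nn: "0 \<le> product_const k * (c\<theta> * (K * E))"
    by (intro mult_nonneg_nonneg[OF product_const_nonneg] mult_nonneg_nonneg[OF c(1)]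
        mult_nonneg_nonneg[OF order_trans[OF zero_le_one K] E_nonneg])
  show "Ckalpha_bound k UNIV (inverse_const k * (product_const k * (c\<theta> * (K * E)))) (\<lambda>x. v x - x)"
    by (rule Ckalpha_bound_inverse[OF C1 step_deriv v_eq step_Ck Diff_c_Ck[OF Diff_c_inv[OF transition_Dc]] nn e_small(7)[OF adm] step_Ckalpha_bound])
qed (rule e_small(8)[OF adm])

lemma compressed_holder:
  "holder_on (compose_const k 1 * (product_const k * (c\<omega> * (local_const k * E)))) UNIV
    ((deriv ^^ k) (\<lambda>x. compressed g x - x))"
proof -
  have Ckv: "Ck k (\<lambda>x. v x - x)" by (rule Diff_c_minus_id[OF Diff_c_inv[OF transition_Dc]])
  have nn: "0 \<le> product_const k * (c\<omega> * (local_const k * E))"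
    by (rule order_trans[OF abs_ge_zero Ckalpha_bound_abs_le[OF bump_Ckalpha_bound UNIV_I]])
  have dv: "\<bar>deriv (\<lambda>x. v x - x) x\<bar> \<le> 1" for x by (rule Ckalpha_bound_deriv_le[OF v_Ckalpha_bound k]) simp
  have "Ckalpha_bound k UNIV (compose_const k 1 * (product_const k * (c\<omega> * (local_const k * E)))) (\<lambda>x. bump g (x + (v x - x)))"
    by (rule Ckalpha_bound_compose[OF bump_Ck Ckv Ck_mono[OF Ckv k] dv v_Ckalpha_bound bump_Ckalpha_bound nn]) simp
  from Ckalpha_bound_holder[OF this] show ?thesis by (simp add: compressed_def)
qed

lemma transition_mono: "transition g x \<le> transition g y \<longleftrightarrow> x \<le> y"
  by (rule strict_mono_less_eq[OF Diff_cD(1)[OF transition_Dc]])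

text \<open>\<open>bump g\<close> vanishes outside [-2, 1], and \<open>transition g\<close> maps
  this interval into [-2, 2] since it fixes -2 and sends 1 to at most 3/2.\<close>

lemma compressed_vanishes: "vanishes_outside 2 (\<lambda>x. compressed g x - x)"
  unfolding vanishes_outside_def
proof (intro allI impI)
  fix x :: real assume "2 < \<bar>x\<bar>"
  then consider "2 < x" | "x < - 2" by linarith
  then show "compressed g x - x = 0"
  proof cases
    case 1
    have "G 1 \<le> 2" using F_half[of 1] by linarith
    then have "transition g 1 \<le> 2" by (simp add: transition_def \<theta>(4))
    also have "\<dots> \<le> transition g (v x)" using 1 by (simp add: Diff_cD(2)[OF transition_Dc])
    finally have "1 \<le> v x" by (simp only: transition_mono)
    then show ?thesis by (simp add: compressed_def bump_def \<theta>(4))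
  next
    case 2
    have "transition g (v x) \<le> - 2" using 2 by (simp add: Diff_cD(2)[OF transition_Dc])
    also have "- 2 = transition g (- 2)" by (simp add: transition_def \<theta>(3))
    finally have "v x \<le> - 2" by (simp only: transition_mono)
    then show ?thesis by (simp add: compressed_def bump_def \<theta>(3))
  qed
qed

text \<open>With \<open>L = transition g\<close> and \<open>\<Phi> = G L\<^sup>-\<^sup>1\<close>, this says that \<open>T\<^sup>-\<^sup>1 \<Phi> T \<circ> compressed g\<close> is the composition of a translate of
  \<open>balanced g\<close> with \<open>\<Phi>\<close>. On the left \<open>L\<close> is the identity, on the right \<open>L = G\<close>, and
  in between \<open>G\<close> commutes with \<open>T\<close>.\<close>

lemma conjugacy:
  "shift (- 1) (\<lambda>x. G (v x)) (compressed g x) = shift (- real M - 1) (balanced g) (G (v x))"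
proof -
  define y where "y = v x"
  have x: "x = y + \<theta> y * F y" using v_eq(1)[of x] by (simp add: y_def)
  have c: "compressed g x = y + \<theta> (y + 1) * F y"
    unfolding compressed_def y_def[symmetric] bump_def by (subst x) (simp add: algebra_simps)
  have "G (v (compressed g x + 1)) - 1 = shift (- real M - 1) (balanced g) (G y)"
  proof (cases "y < 2")
    case True
    have "compressed g x + 1 = transition g (y + 1)"
    proof (cases "- 11 \<le> y")
      case True
      then show ?thesis using \<open>y < 2\<close> F_periodic[of y] unfolding c transition_def by simp
    next
      case False
      then show ?thesis unfolding c transition_def by (simp add: \<theta>(3))
    qed
    then have "v (compressed g x + 1) = y + 1" by (simp add: Diff_cD(3)[OF transition_Dc])
    then show ?thesis using G_shift[of y] True by simp
  next
    case False
    \<comment> \<open>From here on both values of the step function are 1, so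
      \<open>transition g\<close> is G at all points involved.\<close>
    have cG: "compressed g x = G y" unfolding c using False by (simp add: \<theta>(4))
    have Gy: "3 / 2 \<le> G y" using F_half[of y] False by linarith
    define z where "z = finv G (G y + 1)"
    have Gz: "G z = G y + 1" by (simp add: z_def Diff_cD(2)[OF G_Dc])
    then have "1 \<le> z" using Gy F_half[of z] by linarith
    then have "transition g z = G y + 1" by (simp add: transition_def \<theta>(4) Gz)
    then have "v (G y + 1) = z" by (rule inv_unique[OF transition_Dc])
    then have "G (v (compressed g x + 1)) - 1 = G y" by (simp add: cG Gz)
    then show ?thesis using shift_far[of "G y"] Gy by simp
  qed
  then show ?thesis unfolding shift_def[of "- 1"] y_def by simp
qed

text \<open>The conjugacy also proves that \<open>compressed g\<close> is a diffeomorphism, as a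
  composition of group elements. In homology the two copies of G L^-1, one of them translated,
  cancel.\<close>

lemma compressed_homologous: "compressed g \<doteq> g"
proof -
  let ?\<Phi> = "\<lambda>x. G (v x)" and ?b = "shift (- real M - 1) (balanced g)"
  have \<Phi>: "?\<Phi> \<in> Dc" by (rule Diff_c_compose[OF G_Dc Diff_c_inv[OF transition_Dc]])
  have \<Phi>': "shift (- 1) ?\<Phi> \<in> Dc" "shift (- 1) ?\<Phi> \<doteq> ?\<Phi>"
    by (rule shift_Diff_c[OF \<Phi>], rule shift_homologous[OF \<Phi>])
  have b: "?b \<in> Dc" by (rule shift_Diff_c[OF balanced_Dc[OF adm]])
  have "(\<lambda>x. finv (shift (- 1) ?\<Phi>) (?b (?\<Phi> x))) \<in> Dc"
    by (rule Diff_c_compose[OF Diff_c_inv[OF \<Phi>'(1)] Diff_c_compose[OF b \<Phi>]])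
  moreover have "finv (shift (- 1) ?\<Phi>) (?b (?\<Phi> x)) = compressed g x" for x
    by (rule inv_unique[OF \<Phi>'(1) conjugacy])
  ultimately have D: "compressed g \<in> Dc" by simp
  have "(\<lambda>x. compressed g (shift (- 1) ?\<Phi> x)) \<doteq> (\<lambda>x. shift (- 1) ?\<Phi> (compressed g x))"
    by (rule homologous_commute[OF D \<Phi>'(1)])
  then have "(\<lambda>x. compressed g (shift (- 1) ?\<Phi> x)) \<doteq> (\<lambda>x. ?b (?\<Phi> x))" unfolding conjugacy .
  then have "compressed g \<doteq> ?b" using \<Phi>'(2) D b by (rule homologous_cancel_right)
  also have "?b \<doteq> balanced g" by (rule shift_homologous[OF balanced_Dc[OF adm]])
  also have "balanced g \<doteq> g" by (rule balanced_homologous[OF g_Dc[OF adm]])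
  finally show ?thesis .
qed

end

text \<open>\<open>balanced\<close> costs 2 (2 * 4 + 1) + 1 = 19, each factor of the product twice
  that, and the final inverse and bump a factor 3: 114 = 3 * 38. Growth with A is harmless for
  continuity.\<close>

lemma compressed_close:
  assumes g: "admissible (2 * real A) \<delta> g e" "admissible (2 * real A) \<delta> g' e'"
    and close: "\<And>x. \<bar>g x - g' x\<bar> \<le> \<eta>"
  shows "\<bar>compressed g x - compressed g' x\<bar> \<le> 114 * real N * \<eta>"
proof -
  have \<eta>: "0 \<le> \<eta>" using close[of 0] by linarith
  have lip_g: "\<bar>g x - g y\<bar> \<le> 2 * \<bar>x - y\<bar>" for x y
  proof -
    have "\<bar>g x - g y\<bar> \<le> (1 + 1 / 2) * \<bar>x - y\<bar>"
      using perturbation_lipschitz[OF phi_C1[OF g(1)] phi_half[OF g(1)], of x y] by simp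
    also have "\<dots> \<le> 2 * \<bar>x - y\<bar>" by (intro mult_right_mono) auto
    finally show ?thesis .
  qed
  have two: "\<bar>p - r\<bar> \<le> a + b" if "\<bar>p - q\<bar> \<le> a" "\<bar>q - r\<bar> \<le> b" for p q r a b :: real
    using that by linarith
  have gg: "\<bar>g x - g' y\<bar> \<le> 2 * \<bar>x - y\<bar> + \<eta>" for x y
    by (rule two[OF lip_g close])
  have inv: "\<bar>finv g y - finv g' y\<bar> \<le> 2 * \<eta>" for y
    by (rule inverse_perturbation_close[where f = "\<lambda>x. g x - x" and f' = "\<lambda>x. g' x - x",
          OF phi_C1[OF g(1)] phi_half[OF g(1)] _ finv_eq(1)[OF g(1)] finv_eq(1)[OF g(2)]]) (simp add: close)
  have bal: "\<bar>balanced g x - balanced g' x\<bar> \<le> 19 * \<eta>" for x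
  proof -
    let ?X = "sqrt 2 * finv g (x / sqrt 2)" and ?X' = "sqrt 2 * finv g' (x / sqrt 2)"
    have "\<bar>?X - ?X'\<bar> = sqrt 2 * \<bar>finv g (x / sqrt 2) - finv g' (x / sqrt 2)\<bar>"
      by (simp add: abs_mult flip: right_diff_distrib)
    also have "\<dots> \<le> 2 * (2 * \<eta>)" using sqrt2 by (intro mult_mono inv) auto
    finally have X: "\<bar>?X - ?X'\<bar> \<le> 4 * \<eta>" by simp
    have step: "p \<le> (2 * a + 1) * \<eta>" if "p \<le> 2 * q + \<eta>" "q \<le> a * \<eta>" for p q a
      using that by (simp add: algebra_simps)
    from step[OF gg step[OF gg X]] show ?thesis by (simp add: balanced_def)
  qed
  have roll: "\<bar>roll A (balanced g) n x - roll A (balanced g') n x\<bar> \<le> 38 * real n * \<eta>" if "n \<le> N" for n x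
    using that
  proof (induction n arbitrary: x)
    case (Suc n)
    define s where "s = shift (real n - real M) (balanced g) x"
    define s' where "s' = shift (real n - real M) (balanced g') x"
    have s: "\<bar>s - s'\<bar> \<le> 19 * \<eta>" unfolding s_def s'_def shift_def using bal by simp
    have n: "n \<le> N" using Suc.prems by simp
    have "K * (24 * real n * e) \<le> K * (24 * real N * e)"
      using n K e_nonneg[OF g(1)] by (intro mult_left_mono mult_right_mono) auto
    then have "K * (24 * real n * e) \<le> 1" using e_small(3)[OF g(1)] by linarith
    then have "K * (24 * real n * e) * \<bar>s - s'\<bar> \<le> 1 * \<bar>s - s'\<bar>" by (intro mult_right_mono) auto
    from order_trans[OF roll_lipschitz[OF g(1) n] this]
    have "\<bar>(roll A (balanced g) n s - s) - (roll A (balanced g) n s' - s')\<bar> \<le> \<bar>s - s'\<bar>" by simp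
    from order_trans[OF this s] have 1: "\<bar>(roll A (balanced g) n s - s) - (roll A (balanced g) n s' - s')\<bar> \<le> 19 * \<eta>" .
    have "\<bar>p - p'\<bar> \<le> 38 * \<eta>" if "\<bar>(p - q) - (p' - q')\<bar> \<le> 19 * \<eta>" "\<bar>q - q'\<bar> \<le> 19 * \<eta>" for p p' q q'
      using that by linarith
    from this[OF 1 s] have "\<bar>roll A (balanced g) n s - roll A (balanced g) n s'\<bar> \<le> 38 * \<eta>" .
    from two[OF this Suc.IH[OF n, of s']] have "\<bar>roll A (balanced g) n s - roll A (balanced g') n s'\<bar> \<le> 38 * \<eta> + 38 * real n * \<eta>" .
    then show ?case by (simp add: s_def s'_def algebra_simps)
  qed simp
  define \<zeta> where "\<zeta> = 38 * real N * \<eta>"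
  have F: "\<bar>(rolled_up g x - x) - (rolled_up g' x - x)\<bar> \<le> \<zeta>" for x
    unfolding rolled_up_def \<zeta>_def using roll[OF order_refl, of x] by simp
  have scale: "\<bar>a * p - a * q\<bar> \<le> \<zeta>" if "\<bar>a\<bar> \<le> 1" "\<bar>p - q\<bar> \<le> \<zeta>" for a p q
  proof -
    have "\<bar>a * p - a * q\<bar> = \<bar>a\<bar> * \<bar>p - q\<bar>" by (simp add: abs_mult flip: right_diff_distrib)
    also have "\<dots> \<le> 1 * \<zeta>" using that by (intro mult_mono) auto
    finally show ?thesis by simp
  qed
  let ?v = "finv (transition g) x" and ?v' = "finv (transition g') x"
  have v: "\<bar>?v - ?v'\<bar> \<le> 2 * \<zeta>"
    by (rule inverse_perturbation_close[where f = "\<lambda>x. \<theta> x * (rolled_up g x - x)" and f' = "\<lambda>x. \<theta> x * (rolled_up g' x - x)",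
          OF Ck_mono[OF step_Ck[OF g(1)] k] step_deriv[OF g(1)] scale[OF \<theta>(5) F] v_eq(1)[OF g(1)] v_eq(1)[OF g(2)]])
  have "\<bar>bump g ?v - bump g ?v'\<bar> \<le> 1 * \<bar>?v - ?v'\<bar>"
  proof (rule deriv_bound_imp_lipschitz[OF Ck_mono[OF bump_Ck[OF g(1)] k], of UNIV])
    show "\<bar>deriv (bump g) z\<bar> \<le> 1" for z
      using Ckalpha_bound_deriv_le[OF bump_Ckalpha_bound[OF g(1)] k, of z] e_small(9)[OF g(1)] by simp
  qed auto
  then have "\<bar>bump g ?v - bump g ?v'\<bar> \<le> 2 * \<zeta>" using v by simp
  moreover have "\<bar>bump g ?v' - bump g' ?v'\<bar> \<le> \<zeta>"
    unfolding bump_def by (rule scale[OF \<theta>(6) F])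
  ultimately have "\<bar>bump g ?v - bump g' ?v'\<bar> \<le> 2 * \<zeta> + \<zeta>" by (rule two)
  then show ?thesis by (simp add: compressed_def \<zeta>_def mult_ac)
qed

end

section \<open>Choice of the cutoff and of the constants\<close>

context modulus_order
begin

lemma step_function_exists:
  obtains \<theta> :: "real \<Rightarrow> real" and c\<theta> c\<omega> where "Ck k \<theta>" "Ckalpha k \<alpha> \<theta>" "\<And>x. x \<le> - 1 \<Longrightarrow> \<theta> x = 0" "\<And>x. 1 \<le> x \<Longrightarrow> \<theta> x = 1"
    "\<And>x. \<bar>\<theta> x\<bar> \<le> 1" "\<And>x. \<bar>\<theta> (x + 1) - \<theta> x\<bar> \<le> 1"
    "0 \<le> c\<theta>" "Ckalpha_bound k UNIV c\<theta> \<theta>" "0 \<le> c\<omega>" "Ckalpha_bound k UNIV c\<omega> (\<lambda>x. \<theta> (x + 1) - \<theta> x)"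
proof -
  obtain \<theta> :: "real \<Rightarrow> real" where \<theta>: "Ck (Suc k) \<theta>" "\<And>x. x \<le> - 1 \<Longrightarrow> \<theta> x = 0" "\<And>x. 1 \<le> x \<Longrightarrow> \<theta> x = 1"
      "\<And>x. 0 \<le> \<theta> x" "\<And>x. \<theta> x \<le> 1"
    using Ck_step_exists[of "Suc k"] by blast
  obtain k' where k': "k = Suc k'" using k by (cases k) auto
  \<comment> \<open>The step is not compactly supported but its derivative is, so the bound at order
    k is assembled from the values and the derivative.\<close>
  have "vanishes_outside 1 (deriv \<theta>)"
    unfolding vanishes_outside_def
  proof (intro allI impI)
    fix x :: real assume "1 < \<bar>x\<bar>"
    then consider "x \<in> {1<..}" | "x \<in> {..<- 1}" by fastforce
    then show "deriv \<theta> x = 0"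
    proof cases
      case 1
      have "(deriv ^^ 1) \<theta> x = (deriv ^^ 1) (\<lambda>x. 1) x"
        by (rule funpow_deriv_cong_on_open[OF _ _ 1]) (simp_all add: \<theta>(3))
      then show ?thesis by simp
    next
      case 2
      have "(deriv ^^ 1) \<theta> x = (deriv ^^ 1) (\<lambda>x. 0) x"
        by (rule funpow_deriv_cong_on_open[OF _ _ 2]) (simp_all add: \<theta>(2))
      then show ?thesis by simp
    qed
  qed
  moreover have "Ck (Suc k') (deriv \<theta>)" using \<theta>(1) by (simp add: k' Ck_Suc[of "Suc k'"])
  ultimately obtain m where m: "0 \<le> m" "Ckalpha_bound k' UNIV m (deriv \<theta>)"
    using Ckalpha_bound_exists_of_support by blast
  have le1: "\<bar>\<theta> x\<bar> \<le> 1" for x using \<theta>(4,5)[of x] by simp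
  have c1: "Ckalpha_bound k UNIV (max 1 m) \<theta>"
    using Ckalpha_bound_mono[OF m(2), of "max 1 m"] le1 unfolding k' by (simp add: le_max_iff_disj)
  have "Ck (Suc k) (\<lambda>x. \<theta> (x + 1) - \<theta> x)"
  proof (rule Ck_diff)
    show "Ck (Suc k) (\<lambda>x. \<theta> (x + 1))" by (rule Ck_compose[OF \<theta>(1)]) (intro Ck_add Ck_ident Ck_const)
  qed (rule \<theta>(1))
  moreover have "vanishes_outside 2 (\<lambda>x. \<theta> (x + 1) - \<theta> x)"
    unfolding vanishes_outside_def
  proof (intro allI impI)
    fix x :: real assume "2 < \<bar>x\<bar>"
    then consider "1 \<le> x" | "x \<le> - 2" by linarith
    then show "\<theta> (x + 1) - \<theta> x = 0" by cases (simp_all add: \<theta>(2,3))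
  qed
  ultimately obtain m' where "0 \<le> m'" "Ckalpha_bound k UNIV m' (\<lambda>x. \<theta> (x + 1) - \<theta> x)"
    using Ckalpha_bound_exists_of_support by blast
  moreover have "\<bar>\<theta> (x + 1) - \<theta> x\<bar> \<le> 1" for x
    using \<theta>(4,5)[of x] \<theta>(4,5)[of "x + 1"] by (simp add: abs_le_iff)
  ultimately show thesis
    using that[of \<theta> "max 1 m" m'] \<theta>(2,3) le1 c1 Ck_SucD[OF \<theta>(1)] Ck_Suc_imp_Ckalpha[OF \<theta>(1)] by simp
qed

lemma small_multiplier_exists:
  fixes S :: "real set"
  assumes "finite S" "\<And>a. a \<in> S \<Longrightarrow> 0 \<le> a" "0 < \<delta>"
  obtains d where "0 < d" "d \<le> \<delta>" "\<And>a. a \<in> S \<Longrightarrow> a * d \<le> 1"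
proof -
  define Z where "Z = \<Sum>S + 1"
  have Z: "0 < Z" using sum_nonneg[of S "\<lambda>a. a"] assms(2) by (simp add: Z_def add_nonneg_pos)
  show thesis
  proof (rule that[of "min \<delta> (1 / Z)"])
    fix a assume a: "a \<in> S"
    have "a * min \<delta> (1 / Z) \<le> a * (1 / Z)" using assms(2)[OF a] by (intro mult_left_mono) auto
    also have "\<dots> \<le> Z * (1 / Z)"
      using member_le_sum[of a S "\<lambda>a. a"] assms a Z by (intro mult_right_mono) (auto simp: Z_def)
    finally show "a * min \<delta> (1 / Z) \<le> 1" using Z by simp
  qed (use Z assms(3) in auto)
qed

lemma transfer_compress:
  obtains C where "0 < C" "\<And>A. 1 \<le> A \<Longrightarrow>
    \<exists>\<delta>>0. \<exists>\<Psi>. \<Psi> \<in> V_nbhd {- (2 * real A)..2 * real A} k \<alpha> \<delta> \<rightarrow> Diff_on {-2..2} k \<alpha> \<and>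
      Ck_continuous_on k (V_nbhd {- (2 * real A)..2 * real A} k \<alpha> \<delta>) \<Psi> \<and>
      (\<forall>g \<in> V_nbhd {- (2 * real A)..2 * real A} k \<alpha> \<delta>.
         kalpha_seminorm k \<alpha> (\<Psi> g) \<le> ennreal (C * real A) * kalpha_seminorm k \<alpha> g \<and>
         H1_class \<G> (\<Psi> g) = H1_class \<G> g)"
proof -
  obtain \<theta> :: "real \<Rightarrow> real" and c\<theta> c\<omega> where \<theta>: "Ck k \<theta>" "Ckalpha k \<alpha> \<theta>"
    "\<And>x. x \<le> - 1 \<Longrightarrow> \<theta> x = 0" "\<And>x. 1 \<le> x \<Longrightarrow> \<theta> x = 1"
    "\<And>x. \<bar>\<theta> x\<bar> \<le> 1" "\<And>x. \<bar>\<theta> (x + 1) - \<theta> x\<bar> \<le> 1"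
    and c: "0 \<le> c\<theta>" "Ckalpha_bound k UNIV c\<theta> \<theta>" "0 \<le> c\<omega>" "Ckalpha_bound k UNIV c\<omega> (\<lambda>x. \<theta> (x + 1) - \<theta> x)"
    using step_function_exists by blast
  \<comment> \<open>All constants of \<open>compressed_holder\<close> except the factor E; they are
    fixed before A.\<close>
  define Q where "Q = compose_const k 1 * (product_const k * (c\<omega> * local_const k))"
  have Q: "0 \<le> Q"
    unfolding Q_def using compose_const_nonneg[of 1 k] product_const_nonneg[of k] c(3) local_const_ge_1[of k]
    by (intro mult_nonneg_nonneg) auto
  \<comment> \<open>744 = 24 * 31, from E and the number of translates; the 1 keeps \<open>C\<close>
    positive.\<close>
  define C where "C = Q * 744 + 1"
  show thesis
  proof (rule that[of C])
    show "0 < C" using Q by (simp add: C_def)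
    fix A :: nat assume A: "1 \<le> A"
    have R2: "0 \<le> 2 * real A" by simp
    show "\<exists>\<delta>>0. \<exists>\<Psi>. \<Psi> \<in> V_nbhd {- (2 * real A)..2 * real A} k \<alpha> \<delta> \<rightarrow> Diff_on {-2..2} k \<alpha> \<and>
      Ck_continuous_on k (V_nbhd {- (2 * real A)..2 * real A} k \<alpha> \<delta>) \<Psi> \<and>
      (\<forall>g \<in> V_nbhd {- (2 * real A)..2 * real A} k \<alpha> \<delta>.
         kalpha_seminorm k \<alpha> (\<Psi> g) \<le> ennreal (C * real A) * kalpha_seminorm k \<alpha> g \<and>
         H1_class \<G> (\<Psi> g) = H1_class \<G> g)"
    proof (rule holder_on_inverse[OF k R2])
      fix \<delta>1 :: real
      assume \<delta>1: "0 < \<delta>1" and inv_holder: "\<And>f v e. Ck k f \<Longrightarrow> Ck k v \<Longrightarrow> (\<And>x. v x + f (v x) = x) \<Longrightarrow>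
          (\<And>x. v (x + f x) = x) \<Longrightarrow> vanishes_outside (2 * real A) f \<Longrightarrow> holder_on e UNIV ((deriv ^^ k) f) \<Longrightarrow> 0 \<le> e \<Longrightarrow>
          e \<le> \<delta>1 \<Longrightarrow> holder_on (2 * e) UNIV ((deriv ^^ k) (\<lambda>x. v x - x))"
      let ?\<beta> = "product_const k * c\<theta> * taylor_const k (roll_radius A) * (24 * real (roll_len A))"
      let ?S = "{24 * real (roll_len A), compose_err k (roll_radius A) * (24 * real (roll_len A)),
        2 * taylor_const k (roll_radius A) * (24 * real (roll_len A)),
        102 * real (roll_len A) * (taylor_const k (roll_radius A))\<^sup>2, 2 * ?\<beta>, ?\<beta> / inverse_radius k,
        inverse_const k * ?\<beta>, product_const k * c\<omega> * local_const k * (24 * real (roll_len A))}"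
      have R: "0 \<le> roll_radius A" by (simp add: roll_radius_def)
      have pos: "0 \<le> taylor_const k (roll_radius A)" "0 \<le> compose_err k (roll_radius A)" "0 \<le> inverse_const k"
        "0 \<le> inverse_radius k" "0 \<le> local_const k"
        using taylor_const_ge_1[OF R, of k] compose_err_nonneg[OF R] inverse_const_ge_1[of k]
          inverse_radius_pos[of k] local_const_ge_1[of k] by auto
      have nonneg: "0 \<le> a" if "a \<in> ?S" for a
        using that pos product_const_nonneg[of k] c(1,3) by auto
      obtain \<delta> where \<delta>: "0 < \<delta>" "\<delta> \<le> \<delta>1" "\<And>a. a \<in> ?S \<Longrightarrow> a * \<delta> \<le> 1"
        by (rule small_multiplier_exists[of ?S, OF _ nonneg \<delta>1]) auto
      interpret rolling \<alpha> k A \<theta> c\<theta> c\<omega> \<delta>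
      proof
        show "holder_on (2 * e) UNIV ((deriv ^^ k) (\<lambda>x. v x - x))"
          if "Ck k f" "Ck k v" "\<And>x. v x + f (v x) = x" "\<And>x. v (x + f x) = x" "vanishes_outside (2 * real A) f"
            "holder_on e UNIV ((deriv ^^ k) f)" "0 \<le> e" "e \<le> \<delta>" for f v e
          using that \<delta>(2) by (intro inv_holder[of f v e]) auto
      qed (fact A | fact \<theta> | fact c | (rule \<delta>(3), blast))+
      show ?thesis
      proof (rule transferI[OF \<delta>(1), where \<Psi> = compressed and L = "114 * real (roll_len A)"])
        fix g e assume g: "admissible (2 * real A) \<delta> g e"
        show "compressed g \<doteq> g" by (rule compressed_homologous[OF g])
        show "vanishes_outside 2 (\<lambda>x. compressed g x - x)" by (rule compressed_vanishes[OF g])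
        have "compose_const k 1 * (product_const k * (c\<omega> * (local_const k * (24 * real (roll_len A) * e))))
            = Q * 24 * e * real (roll_len A)" by (simp add: Q_def)
        also have "\<dots> \<le> Q * 24 * e * (31 * real A)"
          using Q e_nonneg[OF g] by (intro mult_left_mono N) simp
        also have "\<dots> = Q * 744 * (real A * e)" by simp
        also have "\<dots> \<le> C * (real A * e)" using e_nonneg[OF g] by (intro mult_right_mono) (simp_all add: C_def)
        finally show "holder_on (C * real A * e) UNIV ((deriv ^^ k) (\<lambda>x. compressed g x - x))"
          using holder_on_mono[OF compressed_holder[OF g]] by (simp add: mult.assoc)
      next
        fix f g e e' \<eta> x
        assume "admissible (2 * real A) \<delta> f e" "admissible (2 * real A) \<delta> g e'" "\<And>x. \<bar>f x - g x\<bar> \<le> \<eta>"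
        then show "\<bar>compressed f x - compressed g x\<bar> \<le> 114 * real (roll_len A) * \<eta>" by (rule compressed_close)
      qed (use Q in \<open>auto simp: C_def\<close>)
    qed
  qed
qed

end

theorem theorem5p1:
  fixes k :: nat and \<alpha> :: "real \<Rightarrow> real"
  assumes "k \<ge> 1" and "concave_modulus \<alpha>"
  shows "\<exists>C::real. C > 0 \<and>
    (\<forall>A::nat. A \<ge> 1 \<longrightarrow>
      (let D = (if k \<ge> 2 then {-2..2} else {-2 * real A..2 * real A});
           E = (if k \<ge> 2 then {-2 * real A..2 * real A} else {-2..2})
       in \<exists>\<delta>::real. \<delta> > 0 \<and>
         (\<exists>\<Psi>. \<Psi> \<in> V_nbhd E k \<alpha> \<delta> \<rightarrow> Diff_on D k \<alpha> \<and>
           Ck_continuous_on k (V_nbhd E k \<alpha> \<delta>) \<Psi> \<and>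
           (\<forall>g \<in> V_nbhd E k \<alpha> \<delta>.
             kalpha_seminorm k \<alpha> (\<Psi> g)
               \<le> ennreal (C * (measure lborel E / measure lborel D)) * kalpha_seminorm k \<alpha> g \<and>
             H1_class (Diff_c_group k \<alpha>) (\<Psi> g) = H1_class (Diff_c_group k \<alpha>) g))))"
proof -
  interpret modulus_order \<alpha> k
    using assms by unfold_locales
  show ?thesis
  proof (cases "k \<ge> 2")
    case True
    obtain C where C: "0 < C" "\<And>A. 1 \<le> A \<Longrightarrow>
        \<exists>\<delta>>0. \<exists>\<Psi>. \<Psi> \<in> V_nbhd {- (2 * real A)..2 * real A} k \<alpha> \<delta> \<rightarrow> Diff_on {-2..2} k \<alpha> \<and>
          Ck_continuous_on k (V_nbhd {- (2 * real A)..2 * real A} k \<alpha> \<delta>) \<Psi> \<and>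
          (\<forall>g \<in> V_nbhd {- (2 * real A)..2 * real A} k \<alpha> \<delta>.
             kalpha_seminorm k \<alpha> (\<Psi> g) \<le> ennreal (C * real A) * kalpha_seminorm k \<alpha> g \<and>
             H1_class \<G> (\<Psi> g) = H1_class \<G> g)"
      by (rule transfer_compress) blast
    show ?thesis
    proof (intro exI[of _ C] conjI allI impI C(1))
      fix A :: nat assume "1 \<le> A"
      have ratio: "measure lborel {- (2 * real A)..2 * real A} / measure lborel {- 2..2::real} = real A"
        by simp
      show "let D = (if k \<ge> 2 then {-2..2} else {-2 * real A..2 * real A});
           E = (if k \<ge> 2 then {-2 * real A..2 * real A} else {-2..2})
       in \<exists>\<delta>::real. \<delta> > 0 \<and>
         (\<exists>\<Psi>. \<Psi> \<in> V_nbhd E k \<alpha> \<delta> \<rightarrow> Diff_on D k \<alpha> \<and>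
           Ck_continuous_on k (V_nbhd E k \<alpha> \<delta>) \<Psi> \<and>
           (\<forall>g \<in> V_nbhd E k \<alpha> \<delta>.
             kalpha_seminorm k \<alpha> (\<Psi> g)
               \<le> ennreal (C * (measure lborel E / measure lborel D)) * kalpha_seminorm k \<alpha> g \<and>
             H1_class (Diff_c_group k \<alpha>) (\<Psi> g) = H1_class (Diff_c_group k \<alpha>) g))"
        unfolding Let_def mult_minus_left if_P[OF True] ratio by (rule C(2)[OF \<open>1 \<le> A\<close>])
    qed
  next
    case False
    then have "k = 1" using assms(1) by simp
    show ?thesis
    \<comment> \<open>\<open>spread_holder\<close> gives 16 / A, and for k = 1 the ratio of the
      lengths is 1 / A.\<close>
    proof (intro exI[of _ 16] conjI allI impI)
      fix A :: nat assume A: "1 \<le> A"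
      then have ratio: "16 * (measure lborel {- 2..2::real} / measure lborel {- (2 * real A)..2 * real A}) = 16 / real A"
        by simp
      show "let D = (if k \<ge> 2 then {-2..2} else {-2 * real A..2 * real A});
           E = (if k \<ge> 2 then {-2 * real A..2 * real A} else {-2..2})
       in \<exists>\<delta>::real. \<delta> > 0 \<and>
         (\<exists>\<Psi>. \<Psi> \<in> V_nbhd E k \<alpha> \<delta> \<rightarrow> Diff_on D k \<alpha> \<and>
           Ck_continuous_on k (V_nbhd E k \<alpha> \<delta>) \<Psi> \<and>
           (\<forall>g \<in> V_nbhd E k \<alpha> \<delta>.
             kalpha_seminorm k \<alpha> (\<Psi> g)
               \<le> ennreal (16 * (measure lborel E / measure lborel D)) * kalpha_seminorm k \<alpha> g \<and>
             H1_class (Diff_c_group k \<alpha>) (\<Psi> g) = H1_class (Diff_c_group k \<alpha>) g))"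
        unfolding Let_def mult_minus_left if_not_P[OF False] ratio by (rule transfer_spread[OF \<open>k = 1\<close> A])
    qed simp
  qed
qed

end
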